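(* There exists a family of increasing concave functions $\psi_\varepsilon:[0,1]\to[0,\infty)$ with $\psi_\varepsilon(0)=0$ $(0<\varepsilon<1)$ such that the corresponding Marcinkiewicz spaces satisfy $M_{\psi_\varepsilon}\subset M_{\psi_\delta}$ for all $0<\varepsilon\le\delta<1$, and the following conditions hold: (1) $M_{\psi_\varepsilon}\in\mathbb{K}$ for every $0<\varepsilon<1$. (2) For every r.i. space $E\in\mathbb{K}$ we have $M_{\psi_\varepsilon}\subset E$ for all sufficiently small $\varepsilon>0$. (3) The functions $\psi_\varepsilon$ are not pairwise equivalent; more precisely, $\lim_{t\to0}\frac{\psi_\varepsilon(t)}{\psi_\delta(t)}=0$ whenever $0<\varepsilon<\delta<1$. (4) $M_{\psi_\varepsilon}\subsetneq(\exp L_1)_0$ for all sufficiently small $\varepsilon>0$.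
   Context: Let $\mathrm{mes}$ be Lebesgue measure on $[0,1]$, and let $x^*$ denote the non-increasing left-continuous rearrangement of $|x|$. Two measurable functions are equimeasurable if their absolute values have the same distribution function. R.i. spaces. A (nonzero) Banach space $E$ of measurable functions on $[0,1]$ is rearrangement invariant (r.i.) if (i) $|x|\le|y|$ a.e. and $y\in E$ imply $x\in E$ and $\|x\|_E\le\|y\|_E$; (ii) if $x,y$ are equimeasurable and $y\in E$, then $x\in E$ and $\|x\|_E=\|y\|_E$. The Köthe dual $E'$ consists of all $x$ with $\|x\|_{E'}=\sup_{\|y\|_E\le1}\int_0^1x(t)y(t)\,dt<\infty$. Standing convention: every r.i. space $E$ is assumed to be either separable or to coincide with its second Köthe dual $E''$. The separable part $E_0$ of $E$ is the closure of $L_\infty$ in $E$. Kruglov property. For a measurable function (random variable) $f$ on $[0,1]$, $\pi(f)$ denotes a random variable $\sum_{i=1}^N f_i$, where the $f_i$ are independent copies of $f$ and $N$ is a Poisson random variable with parameter 1 independent of the $f_i$. An r.i. space $E$ has the Kruglov property, written $E\in\mathbb{K}$, if $f\in E\Longleftrightarrow\pi(f)\in E$ (meaning that functions on $[0,1]$ with the distribution of $\pi(f)$ belong to $E$). Concrete spaces. For an increasing concave $\psi$ on $[0,1]$ with $\psi(0)=0$, the Marcinkiewicz space $M_\psi$ has norm $\|x\|_{M_\psi}=\sup_{0<t\le1}\frac1{\psi(t)}\int_0^tx^*(s)\,ds$. $\exp L_1$ is the Orlicz space $L_M$ with $M(u)=e^u-1$ and norm $\|x\|_{L_M}=\inf\{\lambda>0:\int_0^1M(|x(t)|/\lambda)\,dt\le1\}$.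 *)

theory Defs
  imports "HOL-Probability.Probability"
begin

text \<open>
  Functions on the unit interval are represented by total functions on the reals that are
  measurable with respect to Lebesgue measure on the interval. Values outside the interval play
  no role, and functions are not quotiented by almost everywhere equality: a function space is a
  set of functions together with a seminorm that vanishes exactly on the null functions.
\<close>

abbreviation mes :: "real measure" where
  "mes \<equiv> lebesgue_on {0..1}"

section \<open>Distribution functions and rearrangements\<close>

definition dist_fun :: "(real \<Rightarrow> real) \<Rightarrow> real \<Rightarrow> real" where
  "dist_fun x \<tau> = measure mes {t \<in> space mes. \<tau> < \<bar>x t\<bar>}"

definition equimeasurable :: "(real \<Rightarrow> real) \<Rightarrow> (real \<Rightarrow> real) \<Rightarrow> bool" where
  "equimeasurable x y \<longleftrightarrow> (\<forall>\<tau>. dist_fun x \<tau> = dist_fun y \<tau>)"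

text \<open>
  The strict inequality \<open>dist_fun x \<tau> < t\<close> yields the left-continuous version. Only the values at
  \<open>0 < t \<le> 1\<close> are meaningful: at \<open>t = 0\<close> the infimum is over the empty set.
\<close>

definition rearrangement :: "(real \<Rightarrow> real) \<Rightarrow> real \<Rightarrow> real" where
  "rearrangement x t = Inf {\<tau>. 0 \<le> \<tau> \<and> dist_fun x \<tau> < t}"

section \<open>Rearrangement invariant spaces\<close>

definition banach_fun_space :: "(real \<Rightarrow> real) set \<Rightarrow> ((real \<Rightarrow> real) \<Rightarrow> real) \<Rightarrow> bool" where
  "banach_fun_space E N \<longleftrightarrow>
     E \<subseteq> borel_measurable mes \<and>
     (\<exists>x\<in>E. \<not> (AE t in mes. x t = 0)) \<and>
     (\<forall>x\<in>E. \<forall>y\<in>E. (\<lambda>t. x t + y t) \<in> E \<and> N (\<lambda>t. x t + y t) \<le> N x + N y) \<and>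
     (\<forall>c. \<forall>x\<in>E. (\<lambda>t. c * x t) \<in> E \<and> N (\<lambda>t. c * x t) = \<bar>c\<bar> * N x) \<and>
     (\<forall>x\<in>E. N x = 0 \<longleftrightarrow> (AE t in mes. x t = 0)) \<and>
     (\<forall>X. (\<forall>n. X n \<in> E) \<and>
          (\<forall>e>0. \<exists>K. \<forall>m\<ge>K. \<forall>n\<ge>K. N (\<lambda>t. X m t - X n t) < e) \<longrightarrow>
          (\<exists>x\<in>E. (\<lambda>n::nat. N (\<lambda>t. X n t - x t)) \<longlonglongrightarrow> 0))"

definition kothe_dual ::
  "(real \<Rightarrow> real) set \<Rightarrow> ((real \<Rightarrow> real) \<Rightarrow> real) \<Rightarrow> (real \<Rightarrow> real) set" where
  "kothe_dual E N =
     {x \<in> borel_measurable mes.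
        (\<forall>y\<in>E. integrable mes (\<lambda>t. x t * y t)) \<and>
        bdd_above {(\<integral>t. x t * y t \<partial>mes) | y. y \<in> E \<and> N y \<le> 1}}"

definition kothe_norm ::
  "(real \<Rightarrow> real) set \<Rightarrow> ((real \<Rightarrow> real) \<Rightarrow> real) \<Rightarrow> (real \<Rightarrow> real) \<Rightarrow> real" where
  "kothe_norm E N x = Sup {(\<integral>t. x t * y t \<partial>mes) | y. y \<in> E \<and> N y \<le> 1}"

definition separable_fun_space ::
  "(real \<Rightarrow> real) set \<Rightarrow> ((real \<Rightarrow> real) \<Rightarrow> real) \<Rightarrow> bool" where
  "separable_fun_space E N \<longleftrightarrow>
     (\<exists>D. countable D \<and> D \<subseteq> E \<and> (\<forall>x\<in>E. \<forall>e>0. \<exists>d\<in>D. N (\<lambda>t. x t - d t) < e))"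

definition coincides_with_second_dual ::
  "(real \<Rightarrow> real) set \<Rightarrow> ((real \<Rightarrow> real) \<Rightarrow> real) \<Rightarrow> bool" where
  "coincides_with_second_dual E N \<longleftrightarrow>
     E = kothe_dual (kothe_dual E N) (kothe_norm E N) \<and>
     (\<forall>x\<in>E. N x = kothe_norm (kothe_dual E N) (kothe_norm E N) x)"

text \<open>The last conjunct is the standing convention on rearrangement invariant spaces.\<close>

definition ri_space :: "(real \<Rightarrow> real) set \<Rightarrow> ((real \<Rightarrow> real) \<Rightarrow> real) \<Rightarrow> bool" where
  "ri_space E N \<longleftrightarrow>
     banach_fun_space E N \<and>
     (\<forall>x\<in>borel_measurable mes. \<forall>y\<in>E.
        (AE t in mes. \<bar>x t\<bar> \<le> \<bar>y t\<bar>) \<longrightarrow> x \<in> E \<and> N x \<le> N y) \<and>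
     (\<forall>x\<in>borel_measurable mes. \<forall>y\<in>E. equimeasurable x y \<longrightarrow> x \<in> E \<and> N x = N y) \<and>
     (separable_fun_space E N \<or> coincides_with_second_dual E N)"

definition L_infinity :: "(real \<Rightarrow> real) set" where
  "L_infinity = {x \<in> borel_measurable mes. \<exists>C. AE t in mes. \<bar>x t\<bar> \<le> C}"

definition separable_part ::
  "(real \<Rightarrow> real) set \<Rightarrow> ((real \<Rightarrow> real) \<Rightarrow> real) \<Rightarrow> (real \<Rightarrow> real) set" where
  "separable_part E N = {x \<in> E. \<forall>e>0. \<exists>y \<in> E \<inter> L_infinity. N (\<lambda>t. x t - y t) < e}"

section \<open>The Kruglov property\<close>

text \<open>
  The random variable \<open>\<pi>(f)\<close> is realised on the product of the Poisson distribution with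
  parameter 1 and countably many copies of the unit interval; the coordinates make the \<open>f (\<omega> i)\<close>
  independent copies of \<open>f\<close>, independent of the Poisson variable \<open>n\<close>.
\<close>

definition kruglov_law :: "(real \<Rightarrow> real) \<Rightarrow> real measure" where
  "kruglov_law f =
     distr (measure_pmf (poisson_pmf 1) \<Otimes>\<^sub>M (\<Pi>\<^sub>M i\<in>(UNIV :: nat set). mes)) borel
       (\<lambda>(n, \<omega>). \<Sum>i<n. f (\<omega> i))"

definition kruglov_property :: "(real \<Rightarrow> real) set \<Rightarrow> bool" where
  "kruglov_property E \<longleftrightarrow>
     (\<forall>f\<in>borel_measurable mes. \<forall>g\<in>borel_measurable mes.
        distr mes borel g = kruglov_law f \<longrightarrow> (f \<in> E \<longleftrightarrow> g \<in> E))"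

definition ri_kruglov :: "(real \<Rightarrow> real) set \<Rightarrow> ((real \<Rightarrow> real) \<Rightarrow> real) \<Rightarrow> bool" where
  "ri_kruglov E N \<longleftrightarrow> ri_space E N \<and> kruglov_property E"

section \<open>Marcinkiewicz and Orlicz spaces\<close>

definition marcinkiewicz_enorm :: "(real \<Rightarrow> real) \<Rightarrow> (real \<Rightarrow> real) \<Rightarrow> ennreal" where
  "marcinkiewicz_enorm \<psi> x =
     (SUP t\<in>{0<..1}. (\<integral>\<^sup>+s\<in>{0<..t}. ennreal (rearrangement x s) \<partial>lborel) / ennreal (\<psi> t))"

definition marcinkiewicz :: "(real \<Rightarrow> real) \<Rightarrow> (real \<Rightarrow> real) set" where
  "marcinkiewicz \<psi> = {x \<in> borel_measurable mes. marcinkiewicz_enorm \<psi> x < \<infinity>}"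

definition marcinkiewicz_norm :: "(real \<Rightarrow> real) \<Rightarrow> (real \<Rightarrow> real) \<Rightarrow> real" where
  "marcinkiewicz_norm \<psi> x = enn2real (marcinkiewicz_enorm \<psi> x)"

definition orlicz :: "(real \<Rightarrow> real) \<Rightarrow> (real \<Rightarrow> real) set" where
  "orlicz M = {x \<in> borel_measurable mes. \<exists>l>0. (\<integral>\<^sup>+t. ennreal (M (\<bar>x t\<bar> / l)) \<partial>mes) \<le> 1}"

definition orlicz_norm :: "(real \<Rightarrow> real) \<Rightarrow> (real \<Rightarrow> real) \<Rightarrow> real" where
  "orlicz_norm M x = Inf {l. 0 < l \<and> (\<integral>\<^sup>+t. ennreal (M (\<bar>x t\<bar> / l)) \<partial>mes) \<le> 1}"

definition exp_L1 :: "(real \<Rightarrow> real) set" where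
  "exp_L1 = orlicz (\<lambda>u. exp u - 1)"

definition exp_L1_norm :: "(real \<Rightarrow> real) \<Rightarrow> real" where
  "exp_L1_norm = orlicz_norm (\<lambda>u. exp u - 1)"

end

theory Submission
  imports Defs "HOL-Real_Asymp.Real_Asymp"
begin

text \<open>
  Write \<open>log\<^sub>k\<close> for the \<open>k\<close>-fold iterated logarithm. The \<open>k\<close>-fold iterate of \<open>\<pi>\<close>, applied to the constant
  \<open>1\<close>, has a rearrangement of the order of \<open>\<phi>\<^sub>k(u) = u / log\<^sub>k u\<close> at \<open>t = exp (- u)\<close>: a sum of \<open>n\<close> copies that
  are all at least \<open>\<phi>\<^sub>k(v)\<close> has probability about \<open>exp (- n * (v + ln n))\<close>, and the best choice is \<open>v\<close> of order
  \<open>ln u\<close> and \<open>n\<close> of order \<open>u / v\<close>, which reproduces \<open>\<phi>\<^sub>k\<^sub>+\<^sub>1(u) = u * \<phi>\<^sub>k(ln u) / ln u\<close>. A space with the Kruglov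
  property contains all these functions, with norms that grow at most geometrically in \<open>k\<close>, because
  the map \<open>f \<mapsto> \<pi>(f)\<close> is bounded on nonnegative functions (\<open>kruglov_bounded\<close>). Hence it contains
  \<open>F\<^sub>\<epsilon> = \<Sum>k. \<epsilon>\<^sup>k * \<phi>\<^sub>k\<close> for small \<open>\<epsilon>\<close>, and the family is built from these sums: \<open>\<psi>\<^sub>\<epsilon>(t)\<close> is the integral of
  \<open>F\<^sub>\<epsilon>(- ln s)\<close> over \<open>s \<in> {0<..t}\<close>.

  Two properties of \<open>F\<^sub>\<epsilon>(u) = (1 + u) * R\<^sub>\<epsilon>(u)\<close> carry the argument. It varies slowly, so that \<open>\<psi>\<^sub>\<epsilon>(t)\<close> is
  comparable with \<open>t\<close> times its integrand; the Marcinkiewicz space then consists of the functions whose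
  rearrangement is below a multiple of \<open>F\<^sub>\<epsilon>(- ln t)\<close>, equivalently with tails bounded accordingly
  (\<open>mem_iff_tail\<close>). So the space is contained in every r.i. space that contains \<open>F\<^sub>\<epsilon>(- ln t)\<close>, by the
  ideal property and rearrangement invariance. And \<open>R\<^sub>\<epsilon>\<close> satisfies the functional equation
  \<open>R\<^sub>\<epsilon>(u) = 1 / (1 + u) + \<epsilon> * R\<^sub>\<epsilon>(ln (1 + u))\<close> (\<open>log_series_rec\<close>), which has three consequences.

  \<^item> Chernoff's bound closes up: if the tail of \<open>f\<close> is governed by \<open>F\<^sub>\<epsilon>\<close>, then so is that of \<open>\<pi>(f)\<close>, since
    optimising the exponent replaces \<open>R\<^sub>\<epsilon>(u)\<close> by \<open>R\<^sub>\<epsilon>(ln (1 + u)) \<le> R\<^sub>\<epsilon>(u) / \<epsilon>\<close>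
    (\<open>kruglov_property_profile_integral\<close>).
  \<^item> The quotients \<open>R\<^sub>\<epsilon> / R\<^sub>\<delta>\<close> with \<open>\<epsilon> < \<delta>\<close> contract to \<open>0\<close> (\<open>log_series_ratio_tendsto_0\<close>).
  \<^item> Therefore \<open>R\<^sub>\<epsilon>\<close> itself tends to \<open>0\<close>, all exponential moments are finite, and truncations converge in
    \<open>exp L\<^sub>1\<close>; the inclusion is strict because \<open>F\<^sub>\<delta>\<close> with \<open>\<epsilon> < \<delta> < 1\<close> also has all exponential moments
    (\<open>marcinkiewicz_psubset_separable_part\<close>).

  That a Marcinkiewicz space is rearrangement invariant rests on the Hardy--Littlewood principle: its
  norm is a supremum of the integrals of \<open>\<bar>x\<bar>\<close> over sets, divided by weights
  (\<open>marcinkiewicz_enorm_eq_SUP_sets\<close>). This yields the triangle inequality, completeness and equality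
  with the second Koethe dual.
\<close>

section \<open>Profiles built from iterated logarithms\<close>

text \<open>
  \<open>recip_log k u\<close> behaves like the reciprocal of the \<open>k\<close>-fold iterated logarithm of \<open>u\<close>. Adding \<open>1\<close>
  in every step keeps all arguments nonnegative, so that no domain conditions accumulate with \<open>k\<close>.
\<close>

primrec recip_log :: "nat \<Rightarrow> real \<Rightarrow> real" where
  "recip_log 0 u = 1 / (1 + u)"
| "recip_log (Suc k) u = recip_log k (ln (1 + u))"

lemma recip_log_bounds: "0 \<le> u \<Longrightarrow> 0 < recip_log k u \<and> recip_log k u \<le> 1"
  by (induction k arbitrary: u) auto

lemma recip_log_antimono: "0 \<le> u \<Longrightarrow> u \<le> v \<Longrightarrow> recip_log k v \<le> recip_log k u"
  by (induction k arbitrary: u v) (auto intro: divide_left_mono)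

lemma div_one_plus_ln_mono:
  fixes a b :: real
  assumes "1 \<le> a" "a \<le> b"
  shows "a / (1 + ln a) \<le> b / (1 + ln b)"
proof -
  have "ln b - ln a \<le> b / a - 1"
    using assms ln_le_minus_one[of "b / a"] by (simp add: ln_div)
  then have "a * (ln b - ln a) \<le> b - a"
    using assms by (simp add: field_simps)
  moreover have "0 \<le> (b - a) * ln a"
    using assms by simp
  ultimately have "a * (1 + ln b) \<le> b * (1 + ln a)"
    by (simp add: algebra_simps)
  moreover have "0 < 1 + ln a" "0 < 1 + ln b"
    using assms by (auto intro: add_pos_nonneg)
  ultimately show ?thesis
    by (simp add: divide_simps)
qed

text \<open>
  At \<open>w = 1 + u\<close> the function for \<open>Suc k\<close> is \<open>w / (1 + ln w)\<close> times the function for \<open>k\<close> at \<open>ln w\<close>, and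
  both factors increase.
\<close>

lemma mult_recip_log_mono:
  "0 \<le> u \<Longrightarrow> u \<le> v \<Longrightarrow> (1 + u) * recip_log k u \<le> (1 + v) * recip_log k v"
proof (induction k arbitrary: u v)
  case 0
  then show ?case by simp
next
  case (Suc k)
  let ?l = "\<lambda>u::real. ln (1 + u)"
  have split: "(1 + w) * recip_log (Suc k) w
      = (1 + w) / (1 + ?l w) * ((1 + ?l w) * recip_log k (?l w))" if "0 \<le> w" for w
  proof -
    have "1 + ?l w \<noteq> 0"
      using that ln_ge_zero[of "1 + w"] by linarith
    then show ?thesis by simp
  qed
  have l: "0 \<le> ?l u" "?l u \<le> ?l v"
    using Suc.prems by auto
  have "(1 + u) / (1 + ?l u) * ((1 + ?l u) * recip_log k (?l u))
      \<le> (1 + v) / (1 + ?l v) * ((1 + ?l v) * recip_log k (?l v))"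
    using Suc.prems l recip_log_bounds[of "?l u" k]
    by (intro mult_mono Suc.IH div_one_plus_ln_mono) (auto intro!: divide_nonneg_nonneg mult_nonneg_nonneg)
  then show ?case
    using Suc.prems by (simp only: split)
qed

lemma one_le_mult_recip_log: "0 \<le> u \<Longrightarrow> 1 \<le> (1 + u) * recip_log k u"
proof -
  have "recip_log k 0 = 1"
    by (induction k) auto
  then show "0 \<le> u \<Longrightarrow> 1 \<le> (1 + u) * recip_log k u"
    using mult_recip_log_mono[of 0 u k] by simp
qed

lemma measurable_recip_log[measurable]: "recip_log k \<in> borel_measurable borel"
proof (induction k)
  case 0
  have "recip_log 0 = (\<lambda>u. 1 / (1 + u))"
    by auto
  then show ?case by simp
next
  case (Suc k)
  have "recip_log (Suc k) = (\<lambda>u. recip_log k (ln (1 + u)))"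
    by auto
  then show ?case
    using Suc by simp
qed

text \<open>
  The weights \<open>\<epsilon> ^ k\<close> make passing to the logarithm cost the factor \<open>\<epsilon>\<close> only: this is the functional
  equation \<open>log_series_rec\<close>, on which the Kruglov property and the comparison of parameters rest.
\<close>

definition log_series :: "real \<Rightarrow> real \<Rightarrow> real" where
  "log_series \<epsilon> u = (\<Sum>k. \<epsilon> ^ k * recip_log k u)"

definition growth :: "real \<Rightarrow> real \<Rightarrow> real" where
  "growth \<epsilon> u = (1 + u) * log_series \<epsilon> u"

text \<open>
  The substitution \<open>t = exp (- u)\<close> turns the growth rate on \<open>u \<ge> 0\<close> into a decreasing function on \<open>0 < t \<le> 1\<close>.
\<close>

definition profile :: "real \<Rightarrow> real \<Rightarrow> real" where
  "profile \<epsilon> t = growth \<epsilon> (- ln t)"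

lemma measurable_log_series[measurable]: "log_series \<epsilon> \<in> borel_measurable borel"
  unfolding log_series_def[abs_def] by measurable

lemma measurable_profile[measurable]: "profile \<epsilon> \<in> borel_measurable borel"
  unfolding profile_def[abs_def] growth_def[abs_def] by measurable

context
  fixes \<epsilon> :: real
  assumes eps: "0 < \<epsilon>" "\<epsilon> < 1"
begin

lemma summable_log_series:
  assumes "0 \<le> u"
  shows "summable (\<lambda>k. \<epsilon> ^ k * recip_log k u)"
proof (rule summable_comparison_test')
  show "summable (\<lambda>k. \<epsilon> ^ k)"
    using eps by simp
  show "norm (\<epsilon> ^ k * recip_log k u) \<le> \<epsilon> ^ k" for k
    using eps recip_log_bounds[OF assms, of k] mult_left_le[of "recip_log k u" "\<epsilon> ^ k"]
    by (simp add: abs_mult)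
qed

lemma log_series_rec:
  assumes "0 \<le> u"
  shows "log_series \<epsilon> u = 1 / (1 + u) + \<epsilon> * log_series \<epsilon> (ln (1 + u))"
proof -
  have "log_series \<epsilon> u = (\<Sum>k. \<epsilon> ^ Suc k * recip_log (Suc k) u) + \<epsilon> ^ 0 * recip_log 0 u"
    unfolding log_series_def
    by (subst suminf_split_head[OF summable_log_series[OF assms]]) simp
  also have "(\<Sum>k. \<epsilon> ^ Suc k * recip_log (Suc k) u) = (\<Sum>k. \<epsilon> * (\<epsilon> ^ k * recip_log k (ln (1 + u))))"
    by (simp add: mult.assoc)
  also have "\<dots> = \<epsilon> * log_series \<epsilon> (ln (1 + u))"
    unfolding log_series_def using assms
    by (intro suminf_mult summable_log_series) auto
  finally show ?thesis by simp
qed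

lemma log_series_antimono:
  "0 \<le> u \<Longrightarrow> u \<le> v \<Longrightarrow> log_series \<epsilon> v \<le> log_series \<epsilon> u"
  unfolding log_series_def using eps
  by (intro suminf_le summable_log_series mult_left_mono recip_log_antimono) auto

lemma log_series_nonneg: "0 \<le> u \<Longrightarrow> 0 \<le> log_series \<epsilon> u"
  unfolding log_series_def using eps recip_log_bounds[of u]
  by (intro suminf_nonneg summable_log_series mult_nonneg_nonneg) (auto intro: less_imp_le)

lemma log_series_ge: "0 \<le> u \<Longrightarrow> 1 / (1 + u) \<le> log_series \<epsilon> u"
  using log_series_rec[of u] log_series_nonneg[of "ln (1 + u)"] eps by simp

lemma log_series_pos: "0 \<le> u \<Longrightarrow> 0 < log_series \<epsilon> u"
  using log_series_ge[of u] by (smt (verit) divide_pos_pos)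

lemma log_series_le: "0 \<le> u \<Longrightarrow> log_series \<epsilon> u \<le> 1 / (1 - \<epsilon>)"
  unfolding log_series_def using eps recip_log_bounds[of u]
  by (subst suminf_geometric[symmetric])
     (auto intro!: suminf_le summable_log_series mult_left_le summable_geometric)

lemma log_series_ln_le: "0 \<le> u \<Longrightarrow> \<epsilon> * log_series \<epsilon> (ln (1 + u)) \<le> log_series \<epsilon> u"
  using log_series_rec[of u] by simp

lemma growth_mono:
  assumes "0 \<le> u" "u \<le> v"
  shows "growth \<epsilon> u \<le> growth \<epsilon> v"
proof -
  have *: "growth \<epsilon> w = (\<Sum>k. \<epsilon> ^ k * ((1 + w) * recip_log k w))"
          "summable (\<lambda>k. \<epsilon> ^ k * ((1 + w) * recip_log k w))" if "0 \<le> w" for w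
    unfolding growth_def log_series_def
    using suminf_mult[OF summable_log_series[OF that], of "1 + w"]
      summable_mult[OF summable_log_series[OF that], of "1 + w"]
    by (simp_all add: algebra_simps)
  show ?thesis
    using assms eps by (auto simp: * intro!: suminf_le mult_left_mono mult_recip_log_mono)
qed

lemma growth_ge_1: "0 \<le> u \<Longrightarrow> 1 \<le> growth \<epsilon> u"
  using log_series_ge[of u] by (simp add: growth_def field_simps)

text \<open>
  Slow variation: since \<open>log_series\<close> decreases, only the factor \<open>1 + u\<close> can grow.
\<close>

lemma growth_add_le:
  assumes "0 \<le> u" "0 \<le> w"
  shows "growth \<epsilon> (u + w) \<le> (1 + w) * growth \<epsilon> u"
proof -
  have "growth \<epsilon> (u + w) \<le> ((1 + u) * (1 + w)) * log_series \<epsilon> u"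
    unfolding growth_def using assms log_series_nonneg[of "u + w"]
    by (intro mult_mono log_series_antimono) (auto simp: algebra_simps)
  then show ?thesis
    by (simp add: growth_def mult_ac)
qed

lemma profile_ge_1: "0 < t \<Longrightarrow> t \<le> 1 \<Longrightarrow> 1 \<le> profile \<epsilon> t"
  by (simp add: profile_def growth_ge_1)

lemma profile_antimono: "0 < s \<Longrightarrow> s \<le> t \<Longrightarrow> t \<le> 1 \<Longrightarrow> profile \<epsilon> t \<le> profile \<epsilon> s"
  unfolding profile_def by (intro growth_mono) auto

text \<open>
  Slow variation in multiplicative form. The bound \<open>1 + ln y \<le> 2 * sqrt y\<close> replaces the logarithm by a
  power that can be integrated up to the origin.
\<close>

lemma profile_shrink:
  assumes "0 < s" "s \<le> t" "t \<le> 1"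
  shows "profile \<epsilon> s \<le> 2 * profile \<epsilon> t * (sqrt t * s powr (-1/2))"
proof -
  have "profile \<epsilon> s \<le> (1 + ln (t / s)) * profile \<epsilon> t"
    using growth_add_le[of "- ln t" "ln (t / s)"] assms
    by (simp add: profile_def ln_div)
  also have "ln (t / s) = 2 * ln (sqrt (t / s))"
    using assms by (simp add: ln_sqrt)
  also have "(1 + 2 * ln (sqrt (t / s))) * profile \<epsilon> t \<le> (2 * sqrt (t / s)) * profile \<epsilon> t"
    using assms profile_ge_1[of t] ln_le_minus_one[of "sqrt (t / s)"]
    by (intro mult_right_mono) auto
  also have "sqrt (t / s) = sqrt t * s powr (-1/2)"
    using assms powr_minus_divide[of s "1/2"] by (simp add: real_sqrt_divide powr_half_sqrt)
  finally show ?thesis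
    by (simp add: mult_ac)
qed

end

lemma growth_mono_eps:
  assumes "0 < \<epsilon>" "\<epsilon> \<le> \<delta>" "\<delta> < 1" "0 \<le> u"
  shows "growth \<epsilon> u \<le> growth \<delta> u"
  unfolding growth_def log_series_def using assms recip_log_bounds[of u]
  by (intro mult_left_mono suminf_le summable_log_series mult_right_mono power_mono)
     (auto intro: less_imp_le)

text \<open>
  Dividing the functional equations, the quotient \<open>q\<close> satisfies \<open>q u \<le> \<epsilon> / \<delta> * q (ln (1 + u))\<close> up to a term
  that tends to \<open>0\<close>. Since \<open>\<epsilon> / \<delta> < 1\<close> and \<open>q \<le> 1\<close>, iterating this contraction drives \<open>q\<close> to \<open>0\<close>.
\<close>

lemma log_series_ratio_tendsto_0:
  assumes "0 < \<epsilon>" "\<epsilon> < \<delta>" "\<delta> < 1"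
  shows "((\<lambda>u. log_series \<epsilon> u / log_series \<delta> u) \<longlongrightarrow> 0) at_top"
proof -
  define q where "q u = log_series \<epsilon> u / log_series \<delta> u" for u
  define \<rho> where "\<rho> = \<epsilon> / \<delta>"
  have \<rho>: "0 < \<rho>" "\<rho> < 1"
    using assms by (auto simp: \<rho>_def)
  have q0: "0 \<le> q u" if "0 \<le> u" for u
    using that assms by (auto simp: q_def intro!: divide_nonneg_nonneg log_series_nonneg)
  have step: "q u \<le> (1 + ln (1 + u)) / (\<delta> * (1 + u)) + \<rho> * q (ln (1 + u))" if "0 \<le> u" for u
  proof -
    let ?v = "ln (1 + u)"
    have v: "0 \<le> ?v"
      using that by simp
    have R: "0 < log_series \<delta> u" "0 < log_series \<delta> ?v" "\<delta> * log_series \<delta> ?v \<le> log_series \<delta> u"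
        "1 / (1 + ?v) \<le> log_series \<delta> ?v" "0 \<le> log_series \<epsilon> ?v"
      using v that assms by (auto intro: log_series_pos log_series_ln_le log_series_ge log_series_nonneg)
    have "q u \<le> (1 / (1 + u) + \<epsilon> * log_series \<epsilon> ?v) / (\<delta> * log_series \<delta> ?v)"
      unfolding q_def using assms that R
      by (subst log_series_rec[of \<epsilon>]) (auto intro!: divide_left_mono mult_pos_pos add_nonneg_nonneg)
    also have "\<dots> = (1 / (1 + u)) / (\<delta> * log_series \<delta> ?v) + \<rho> * q ?v"
      by (simp add: q_def \<rho>_def add_divide_distrib)
    also have "(1 / (1 + u)) / (\<delta> * log_series \<delta> ?v) \<le> (1 / (1 + u)) / (\<delta> * (1 / (1 + ?v)))"
      using assms that R v add_pos_nonneg[OF zero_less_one v]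
      by (intro divide_left_mono mult_left_mono) (auto intro!: mult_pos_pos divide_pos_pos)
    also have "\<dots> = (1 + ln (1 + u)) / (\<delta> * (1 + u))"
      by (simp add: field_simps)
    finally show ?thesis by simp
  qed
  have lim_ln: "filterlim (\<lambda>u::real. ln (1 + u)) at_top at_top"
    by real_asymp
  have lim_0: "((\<lambda>u::real. (1 + ln (1 + u)) / (\<delta> * (1 + u))) \<longlongrightarrow> 0) at_top"
    using assms by real_asymp
  have claim: "\<forall>\<eta>>0. \<forall>\<^sub>F u in at_top. q u \<le> \<rho> ^ n + \<eta>" for n
  proof (induction n)
    case 0
    have "q u \<le> 1" if "0 \<le> u" for u
    proof -
      have "log_series \<epsilon> u \<le> log_series \<delta> u"
        using growth_mono_eps[of \<epsilon> \<delta> u] assms that by (simp add: growth_def)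
      then show ?thesis
        using log_series_pos[of \<delta> u] assms that by (simp add: q_def)
    qed
    have "\<forall>\<^sub>F u in at_top. q u \<le> 1"
      using eventually_ge_at_top[of "0::real"] by eventually_elim fact
    then show ?case
      by (auto elim!: eventually_mono)
  next
    case (Suc n)
    show ?case
    proof (intro allI impI)
      fix \<eta> :: real assume "0 < \<eta>"
      have "\<forall>\<^sub>F u in at_top. q (ln (1 + u)) \<le> \<rho> ^ n + \<eta> / 2"
        using Suc[rule_format, of "\<eta> / 2"] \<open>0 < \<eta>\<close> lim_ln by (auto simp: filterlim_iff)
      moreover have "\<forall>\<^sub>F u in at_top. (1 + ln (1 + u)) / (\<delta> * (1 + u)) < \<eta> / 2"
        using \<open>0 < \<eta>\<close> by (intro order_tendstoD(2)[OF lim_0]) auto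
      ultimately show "\<forall>\<^sub>F u in at_top. q u \<le> \<rho> ^ Suc n + \<eta>"
        using eventually_ge_at_top[of "0::real"]
      proof eventually_elim
        case (elim u)
        have "\<rho> * q (ln (1 + u)) \<le> \<rho> * (\<rho> ^ n + \<eta> / 2)"
          using elim \<rho> by (intro mult_left_mono) auto
        also have "\<dots> \<le> \<rho> ^ Suc n + \<eta> / 2"
          using \<rho> \<open>0 < \<eta>\<close> by (simp add: algebra_simps)
        finally show ?case
          using step[of u] elim by linarith
      qed
    qed
  qed
  have "(q \<longlongrightarrow> 0) at_top"
  proof (rule order_tendstoI)
    fix a :: real assume "a < 0"
    show "\<forall>\<^sub>F u in at_top. a < q u"
      using eventually_ge_at_top[of "0::real"]
      by eventually_elim (use q0 \<open>a < 0\<close> in \<open>fastforce intro: less_le_trans\<close>)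
  next
    fix a :: real assume a: "0 < a"
    then obtain n where "\<rho> ^ n < a / 2"
      using real_arch_pow_inv[of "a / 2" \<rho>] \<rho> by auto
    moreover have "\<forall>\<^sub>F u in at_top. q u \<le> \<rho> ^ n + a / 3"
      using claim[of n] a by simp
    ultimately show "\<forall>\<^sub>F u in at_top. q u < a"
      using a by (auto elim!: eventually_mono)
  qed
  then show ?thesis
    by (simp add: q_def[abs_def])
qed

text \<open>
  Compare with a larger parameter \<open>\<delta> < 1\<close>, whose series is still bounded.
\<close>

lemma log_series_tendsto_0:
  assumes "0 < \<epsilon>" "\<epsilon> < 1"
  shows "(log_series \<epsilon> \<longlongrightarrow> 0) at_top"
proof -
  define \<delta> where "\<delta> = (1 + \<epsilon>) / 2"
  have \<delta>: "0 < \<delta>" "\<epsilon> < \<delta>" "\<delta> < 1"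
    using assms by (auto simp: \<delta>_def)
  have "((\<lambda>u. log_series \<epsilon> u / log_series \<delta> u * (1 / (1 - \<delta>))) \<longlongrightarrow> 0 * (1 / (1 - \<delta>))) at_top"
    using assms \<delta> by (intro tendsto_mult log_series_ratio_tendsto_0) auto
  then have lim: "((\<lambda>u. log_series \<epsilon> u / log_series \<delta> u * (1 / (1 - \<delta>))) \<longlongrightarrow> 0) at_top"
    by simp
  show ?thesis
  proof (rule tendsto_sandwich[OF _ _ tendsto_const lim])
    show "\<forall>\<^sub>F u in at_top. 0 \<le> log_series \<epsilon> u"
      using eventually_ge_at_top[of "0::real"]
      by eventually_elim (use assms in \<open>auto intro: log_series_nonneg\<close>)
    show "\<forall>\<^sub>F u in at_top. log_series \<epsilon> u \<le> log_series \<epsilon> u / log_series \<delta> u * (1 / (1 - \<delta>))"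
      using eventually_ge_at_top[of "0::real"]
    proof eventually_elim
      case (elim u)
      have "log_series \<epsilon> u = log_series \<epsilon> u / log_series \<delta> u * log_series \<delta> u"
        using log_series_pos[of \<delta> u] \<delta> elim by simp
      also have "\<dots> \<le> log_series \<epsilon> u / log_series \<delta> u * (1 / (1 - \<delta>))"
        using assms \<delta> elim
        by (intro mult_left_mono log_series_le divide_nonneg_nonneg log_series_nonneg) auto
      finally show ?case .
    qed
  qed
qed

lemma profile_ratio_tendsto_0:
  assumes "0 < \<epsilon>" "\<epsilon> < \<delta>" "\<delta> < 1"
  shows "((\<lambda>t. profile \<epsilon> t / profile \<delta> t) \<longlongrightarrow> 0) (at_right 0)"
proof -
  have lim: "filterlim (\<lambda>t::real. - ln t) at_top (at_right 0)"
    by real_asymp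
  have "((\<lambda>t. log_series \<epsilon> (- ln t) / log_series \<delta> (- ln t)) \<longlongrightarrow> 0) (at_right 0)"
    using filterlim_compose[OF log_series_ratio_tendsto_0[OF assms] lim] .
  moreover have "\<forall>\<^sub>F t::real in at_right 0. 0 < t \<and> t < 1"
    by (auto simp: eventually_at_right[of 0 1] intro!: exI[of _ 1])
  then have "\<forall>\<^sub>F t in at_right 0. log_series \<epsilon> (- ln t) / log_series \<delta> (- ln t) = profile \<epsilon> t / profile \<delta> t"
  proof eventually_elim
    case (elim t)
    then have "1 + - ln t \<noteq> 0"
      using ln_less_zero[of t] by linarith
    then show ?case
      by (simp add: profile_def growth_def)
  qed
  ultimately show ?thesis
    by (rule Lim_transform_eventually)
qed

section \<open>Rearrangements and the Hardy--Littlewood principle\<close>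

lemma space_mes: "space mes = {0..1}"
  by simp

text \<open>
  Rewriting the space of \<open>mes\<close> to an interval would hide the sets \<open>{t \<in> space mes. P t}\<close> from the
  measurability prover.
\<close>

declare space_lebesgue_on[simp del] space_restrict_space2[simp del]

lemma emeasure_mes:
  assumes "A \<in> sets lebesgue" "A \<subseteq> {0..1}"
  shows "emeasure mes A = emeasure lebesgue A"
  using assms by (simp add: emeasure_restrict_space)

interpretation mes: prob_space mes
  by (rule prob_spaceI) (simp add: space_mes emeasure_mes)

lemma nn_integral_mes:
  "(\<integral>\<^sup>+t. f t \<partial>mes) = (\<integral>\<^sup>+t. f t * indicator {0..1} t \<partial>lborel)"
  by (simp add: nn_integral_restrict_space nn_integral_completion)

lemma AE_mes_pos: "AE t in mes. 0 < t"
proof -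
  have "AE t in lebesgue. t \<noteq> (0::real)"
    by (intro AE_completion) (rule AE_lborel_singleton)
  then show ?thesis
    by (subst AE_restrict_space_iff) (auto elim!: eventually_mono)
qed

lemma dist_fun_eq_emeasure: "ennreal (dist_fun x \<tau>) = emeasure mes {t \<in> space mes. \<tau> < \<bar>x t\<bar>}"
  by (simp add: dist_fun_def mes.emeasure_eq_measure)

lemma dist_fun_nonneg[simp]: "0 \<le> dist_fun x \<tau>"
  by (simp add: dist_fun_def)

lemma dist_fun_le_1: "dist_fun x \<tau> \<le> 1"
  unfolding dist_fun_def by (rule mes.prob_le_1)

text \<open>
  Superlevel sets of a rearrangement are intervals whose endpoints may or may not belong to them.
\<close>

lemma interval_up_to_endpoints:
  fixes a b :: real
  assumes "{a<..<b} \<subseteq> S" "S \<subseteq> {a..b}" "a \<le> b"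
  shows "S \<in> sets lebesgue \<and> emeasure lebesgue S = ennreal (b - a)"
proof -
  have S: "S = {a<..<b} \<union> (S \<inter> {a, b})"
    using assms by auto
  have fin: "finite (S \<inter> {a, b})"
    by auto
  then have meas: "S \<inter> {a, b} \<in> sets borel" "S \<inter> {a, b} \<in> null_sets lborel"
    by (auto simp: finite_imp_null_set_lborel borel_closed finite_imp_closed)
  have "S \<in> sets borel"
    by (subst S) (intro sets.Un meas, auto)
  moreover have "emeasure lborel ({a<..<b} \<union> (S \<inter> {a, b})) = emeasure lborel {a<..<b}"
    using meas by (intro emeasure_Un_null_set) auto
  ultimately show ?thesis
    using assms(3) S by auto
qed

context
  fixes x :: "real \<Rightarrow> real"
  assumes x[measurable]: "x \<in> borel_measurable mes"
begin

lemma dist_fun_antimono: "\<tau> \<le> \<sigma> \<Longrightarrow> dist_fun x \<sigma> \<le> dist_fun x \<tau>"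
  unfolding dist_fun_def by (intro mes.finite_measure_mono) auto

lemma dist_fun_small:
  assumes "0 < t"
  shows "\<exists>\<tau>\<ge>0. dist_fun x \<tau> < t"
proof -
  let ?A = "\<lambda>n::nat. {s \<in> space mes. real n < \<bar>x s\<bar>}"
  have "(\<lambda>n. measure mes (?A n)) \<longlonglongrightarrow> measure mes (\<Inter>n. ?A n)"
    by (intro mes.finite_Lim_measure_decseq) (auto simp: decseq_def)
  moreover have "(\<Inter>n. ?A n) = {}"
  proof -
    have "\<exists>n. \<not> real n < \<bar>x s\<bar>" for s
      using reals_Archimedean2[of "\<bar>x s\<bar>"] by (auto intro: less_imp_le simp: not_less)
    then show ?thesis by blast
  qed
  ultimately have "(\<lambda>n. dist_fun x (real n)) \<longlonglongrightarrow> 0"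
    by (simp add: dist_fun_def)
  from order_tendstoD(2)[OF this assms] obtain n where "dist_fun x (real n) < t"
    by (auto simp: eventually_sequentially)
  then show ?thesis
    by (intro exI[of _ "real n"]) simp
qed

lemma dist_fun_right_continuous:
  assumes "s < dist_fun x \<tau>"
  shows "\<exists>\<sigma>>\<tau>. s < dist_fun x \<sigma>"
proof -
  let ?A = "\<lambda>n::nat. {t \<in> space mes. \<tau> + 1 / real (Suc n) < \<bar>x t\<bar>}"
  have "incseq ?A"
  proof (rule incseq_SucI, rule Collect_mono, intro impI)
    fix n t assume "t \<in> space mes \<and> \<tau> + 1 / real (Suc n) < \<bar>x t\<bar>"
    moreover have "1 / real (Suc (Suc n)) \<le> 1 / real (Suc n)"
      by (intro divide_left_mono) auto
    ultimately show "t \<in> space mes \<and> \<tau> + 1 / real (Suc (Suc n)) < \<bar>x t\<bar>"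
      by linarith
  qed
  then have "(\<lambda>n. measure mes (?A n)) \<longlonglongrightarrow> measure mes (\<Union>n. ?A n)"
    by (intro mes.finite_Lim_measure_incseq) auto
  moreover have "(\<Union>n. ?A n) = {t \<in> space mes. \<tau> < \<bar>x t\<bar>}"
  proof -
    have "\<tau> < \<bar>x t\<bar> \<longleftrightarrow> (\<exists>n. \<tau> + 1 / real (Suc n) < \<bar>x t\<bar>)" for t
    proof
      assume "\<tau> < \<bar>x t\<bar>"
      then show "\<exists>n. \<tau> + 1 / real (Suc n) < \<bar>x t\<bar>"
        using reals_Archimedean[of "\<bar>x t\<bar> - \<tau>"] by (auto simp: inverse_eq_divide algebra_simps)
    next
      assume "\<exists>n. \<tau> + 1 / real (Suc n) < \<bar>x t\<bar>"
      then show "\<tau> < \<bar>x t\<bar>"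
        by (smt (verit) divide_pos_pos of_nat_0_less_iff zero_less_Suc)
    qed
    then show ?thesis by auto
  qed
  ultimately have "(\<lambda>n. dist_fun x (\<tau> + 1 / real (Suc n))) \<longlonglongrightarrow> dist_fun x \<tau>"
    by (simp add: dist_fun_def)
  from order_tendstoD(1)[OF this assms] obtain n where "s < dist_fun x (\<tau> + 1 / real (Suc n))"
    by (auto simp: eventually_sequentially)
  then show ?thesis
    by (intro exI[of _ "\<tau> + 1 / real (Suc n)"]) auto
qed

lemma rearrangement_le: "0 \<le> \<tau> \<Longrightarrow> dist_fun x \<tau> < t \<Longrightarrow> rearrangement x t \<le> \<tau>"
  unfolding rearrangement_def by (intro cInf_lower) (auto intro: bdd_belowI[of _ 0])

lemma rearrangement_nonneg: "0 < t \<Longrightarrow> 0 \<le> rearrangement x t"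
  unfolding rearrangement_def using dist_fun_small[of t] by (intro cInf_greatest) auto

lemma dist_fun_less_of_rearrangement_less:
  assumes "0 < t" "rearrangement x t < \<tau>"
  shows "dist_fun x \<tau> < t"
proof -
  have "{\<tau>. 0 \<le> \<tau> \<and> dist_fun x \<tau> < t} \<noteq> {}"
    using dist_fun_small[OF assms(1)] by auto
  from cInf_lessD[OF this] assms(2) obtain \<sigma> where "dist_fun x \<sigma> < t" "\<sigma> < \<tau>"
    unfolding rearrangement_def by auto
  then show ?thesis
    using dist_fun_antimono[of \<sigma> \<tau>] by simp
qed

text \<open>
  The strict inequality survives because the distribution function is continuous from the right.
\<close>

lemma less_rearrangement:
  assumes "0 < t" "t < dist_fun x \<tau>"
  shows "\<tau> < rearrangement x t"
proof (rule ccontr)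
  assume "\<not> ?thesis"
  moreover obtain \<sigma> where "\<tau> < \<sigma>" "t < dist_fun x \<sigma>"
    using dist_fun_right_continuous[OF assms(2)] by auto
  ultimately show False
    using dist_fun_less_of_rearrangement_less[OF assms(1), of \<sigma>] by simp
qed

lemma dist_fun_rearrangement_le: "0 < t \<Longrightarrow> dist_fun x (rearrangement x t) \<le> t"
  using less_rearrangement[of t "rearrangement x t"] by force

lemma rearrangement_antimono:
  assumes "0 < s" "s \<le> t"
  shows "rearrangement x t \<le> rearrangement x s"
  unfolding rearrangement_def using dist_fun_small[OF assms(1)] assms(2)
  by (intro cInf_superset_mono) (auto intro: bdd_belowI[of _ 0])

text \<open>
  The function \<open>y\<close> may take any value at \<open>0\<close>, where the rearrangement is an infimum over the empty set.
\<close>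

lemma superlevel_rearrangement:
  assumes "0 \<le> \<tau>" and y: "\<And>t. 0 < t \<Longrightarrow> t \<le> 1 \<Longrightarrow> y t = rearrangement x t"
  shows "{t \<in> {0..1}. \<tau> < y t} \<in> sets lebesgue"
    and "emeasure lebesgue {t \<in> {0..1}. \<tau> < y t} = ennreal (dist_fun x \<tau>)"
proof -
  have "t \<le> dist_fun x \<tau>" if "0 < t" "t \<le> 1" "\<tau> < y t" for t
    using rearrangement_le[OF assms(1), of t] that y by force
  then have "t \<le> dist_fun x \<tau>" if "0 \<le> t" "t \<le> 1" "\<tau> < y t" for t
    using that dist_fun_nonneg[of x \<tau>] by (cases "t = 0") auto
  then have "{t \<in> {0..1}. \<tau> < y t} \<subseteq> {0..dist_fun x \<tau>}"
    by auto
  moreover have "{0<..<dist_fun x \<tau>} \<subseteq> {t \<in> {0..1}. \<tau> < y t}"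
  proof
    fix t assume "t \<in> {0<..<dist_fun x \<tau>}"
    then show "t \<in> {t \<in> {0..1}. \<tau> < y t}"
      using less_rearrangement[of t \<tau>] dist_fun_le_1[of x \<tau>] y[of t] by simp
  qed
  moreover have "0 \<le> dist_fun x \<tau>"
    by simp
  ultimately have "{t \<in> {0..1}. \<tau> < y t} \<in> sets lebesgue
      \<and> emeasure lebesgue {t \<in> {0..1}. \<tau> < y t} = ennreal (dist_fun x \<tau> - 0)"
    by (intro interval_up_to_endpoints)
  then
  show "{t \<in> {0..1}. \<tau> < y t} \<in> sets lebesgue"
    "emeasure lebesgue {t \<in> {0..1}. \<tau> < y t} = ennreal (dist_fun x \<tau>)"
    by auto
qed

lemma superlevel_rearrangement_neg:
  assumes "\<tau> < 0"
  shows "{t \<in> {0..1}. \<tau> < rearrangement x t} \<in> sets lebesgue"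
proof -
  have "{0<..<1} \<subseteq> {t \<in> {0..1}. \<tau> < rearrangement x t}"
    using rearrangement_nonneg assms by (force intro: less_le_trans)
  moreover have "{t \<in> {0..1}. \<tau> < rearrangement x t} \<subseteq> {0..1}"
    by auto
  ultimately show ?thesis
    using interval_up_to_endpoints[of 0 1] zero_le_one by blast
qed

lemma measurable_rearrangement: "rearrangement x \<in> borel_measurable mes"
proof (subst borel_measurable_iff_greater, intro allI)
  fix \<tau>
  have "{t \<in> {0..1}. \<tau> < rearrangement x t} \<in> sets lebesgue"
    using superlevel_rearrangement(1)[OF _ refl] superlevel_rearrangement_neg
    by (cases "0 \<le> \<tau>") (blast, simp only: not_le)
  then show "{t \<in> space mes. \<tau> < rearrangement x t} \<in> sets mes"
    by (auto simp: sets_restrict_space_iff space_mes)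
qed

lemma equimeasurable_rearrangement: "equimeasurable (rearrangement x) x"
  unfolding equimeasurable_def
proof
  fix \<tau>
  show "dist_fun (rearrangement x) \<tau> = dist_fun x \<tau>"
  proof (cases "0 \<le> \<tau>")
    case True
    have "emeasure mes {t \<in> space mes. \<tau> < \<bar>rearrangement x t\<bar>}
        = emeasure mes {t \<in> space mes. \<tau> < rearrangement x t}"
    proof (rule emeasure_eq_AE)
      show "AE t in mes. t \<in> {t \<in> space mes. \<tau> < \<bar>rearrangement x t\<bar>}
          \<longleftrightarrow> t \<in> {t \<in> space mes. \<tau> < rearrangement x t}"
        using AE_mes_pos by eventually_elim (simp add: rearrangement_nonneg)
    qed (use measurable_rearrangement in measurable)
    also have "\<dots> = dist_fun x \<tau>"
      using superlevel_rearrangement[OF True refl]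
      by (simp only: space_mes emeasure_mes Collect_subset)
    finally show ?thesis
      by (simp flip: dist_fun_eq_emeasure)
  next
    case False
    then have "{t \<in> space mes. \<tau> < \<bar>y t\<bar>} = space mes" for y :: "real \<Rightarrow> real"
      by force
    then show ?thesis
      by (simp add: dist_fun_def)
  qed
qed

end

text \<open>
  The distribution function is one minus the cumulative distribution function of \<open>\<bar>x\<bar>\<close>.
\<close>

lemma equimeasurable_distr:
  assumes [measurable]: "x \<in> borel_measurable mes" "y \<in> borel_measurable mes"
    and eq: "equimeasurable x y"
  shows "distr mes borel (\<lambda>t. \<bar>x t\<bar>) = distr mes borel (\<lambda>t. \<bar>y t\<bar>)"
proof (rule cdf_unique)
  show "real_distribution (distr mes borel (\<lambda>t. \<bar>x t\<bar>))"
    "real_distribution (distr mes borel (\<lambda>t. \<bar>y t\<bar>))"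
    by auto
  have *: "cdf (distr mes borel (\<lambda>t. \<bar>z t\<bar>)) a = 1 - dist_fun z a"
    if [measurable]: "z \<in> borel_measurable mes" for z a
  proof -
    have "cdf (distr mes borel (\<lambda>t. \<bar>z t\<bar>)) a = measure mes (space mes - {t \<in> space mes. a < \<bar>z t\<bar>})"
      by (auto simp: cdf_def measure_distr not_less intro!: arg_cong[where f = "measure mes"])
    also have "\<dots> = 1 - dist_fun z a"
      unfolding dist_fun_def by (intro mes.prob_compl) auto
    finally show ?thesis .
  qed
  show "cdf (distr mes borel (\<lambda>t. \<bar>x t\<bar>)) = cdf (distr mes borel (\<lambda>t. \<bar>y t\<bar>))"
    using eq by (auto simp: * equimeasurable_def)
qed

lemma equimeasurable_nn_integral:
  assumes [measurable]: "x \<in> borel_measurable mes" "y \<in> borel_measurable mes" "\<phi> \<in> borel_measurable borel"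
    and eq: "equimeasurable x y"
  shows "(\<integral>\<^sup>+t. \<phi> \<bar>x t\<bar> \<partial>mes) = (\<integral>\<^sup>+t. \<phi> \<bar>y t\<bar> \<partial>mes)"
proof -
  have "(\<integral>\<^sup>+t. \<phi> \<bar>x t\<bar> \<partial>mes) = (\<integral>\<^sup>+s. \<phi> s \<partial>distr mes borel (\<lambda>t. \<bar>x t\<bar>))"
    by (simp add: nn_integral_distr)
  also have "\<dots> = (\<integral>\<^sup>+t. \<phi> \<bar>y t\<bar> \<partial>mes)"
    by (simp add: equimeasurable_distr[OF _ _ eq] nn_integral_distr)
  finally show ?thesis .
qed

lemma rearrangement_cong: "equimeasurable x y \<Longrightarrow> rearrangement x = rearrangement y"
  by (simp add: fun_eq_iff rearrangement_def equimeasurable_def)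

text \<open>
  On \<open>{0<..t}\<close> the rearrangement is the truncation level \<open>rearrangement x t\<close> plus the part above that
  level, and the part above a level has the same integral for equimeasurable functions.
\<close>

lemma integral_rearrangement:
  assumes x[measurable]: "x \<in> borel_measurable mes" and t: "0 < t" "t \<le> 1"
  shows "(\<integral>\<^sup>+s\<in>{0<..t}. ennreal (rearrangement x s) \<partial>lborel)
    = (\<integral>\<^sup>+s. ennreal (max 0 (\<bar>x s\<bar> - rearrangement x t)) \<partial>mes) + ennreal (rearrangement x t * t)"
proof -
  note [measurable] = measurable_rearrangement[OF x]
  let ?\<tau> = "rearrangement x t"
  have pos: "0 \<le> ?\<tau>"
    using rearrangement_nonneg[OF x t(1)] .
  have "(\<integral>\<^sup>+s\<in>{0<..t}. ennreal (rearrangement x s) \<partial>lborel)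
      = (\<integral>\<^sup>+s\<in>{0<..t}. ennreal (rearrangement x s) \<partial>mes)"
    unfolding nn_integral_mes using t by (intro nn_integral_cong) (auto simp: indicator_def)
  also have "\<dots> = (\<integral>\<^sup>+s. ennreal (max 0 (\<bar>rearrangement x s\<bar> - ?\<tau>)) + ennreal ?\<tau> * indicator {0<..t} s \<partial>mes)"
  proof (rule nn_integral_cong_AE)
    show "AE s in mes. ennreal (rearrangement x s) * indicator {0<..t} s
        = ennreal (max 0 (\<bar>rearrangement x s\<bar> - ?\<tau>)) + ennreal ?\<tau> * indicator {0<..t} s"
      using AE_mes_pos
    proof eventually_elim
      case (elim s)
      then have s: "0 \<le> rearrangement x s"
        using rearrangement_nonneg[OF x] by simp
      show ?case
      proof (cases "s \<le> t")
        case True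
        then have "?\<tau> \<le> rearrangement x s"
          using rearrangement_antimono[OF x] elim by simp
        then show ?thesis
          using True elim s pos by (simp add: ennreal_plus[symmetric] max_def del: ennreal_plus)
      next
        case False
        then have "rearrangement x s \<le> ?\<tau>"
          using rearrangement_antimono[OF x t(1)] by simp
        then show ?thesis
          using False s by simp
      qed
    qed
  qed
  also have "\<dots> = (\<integral>\<^sup>+s. ennreal (max 0 (\<bar>rearrangement x s\<bar> - ?\<tau>)) \<partial>mes)
      + (\<integral>\<^sup>+s. ennreal ?\<tau> * indicator {0<..t} s \<partial>mes)"
  proof (rule nn_integral_add)
    have "{0<..t} \<in> sets mes"
      using t by (auto simp: sets_restrict_space_iff)
    then show "(\<lambda>s. ennreal ?\<tau> * indicator {0<..t} s) \<in> borel_measurable mes"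
      by measurable
  qed measurable
  also have "(\<integral>\<^sup>+s. ennreal (max 0 (\<bar>rearrangement x s\<bar> - ?\<tau>)) \<partial>mes)
      = (\<integral>\<^sup>+s. ennreal (max 0 (\<bar>x s\<bar> - ?\<tau>)) \<partial>mes)"
    by (rule equimeasurable_nn_integral[where \<phi> = "\<lambda>v. ennreal (max 0 (v - ?\<tau>))"])
       (auto intro: equimeasurable_rearrangement)
  also have "(\<integral>\<^sup>+s. ennreal ?\<tau> * indicator {0<..t} s \<partial>mes) = ennreal (?\<tau> * t)"
  proof -
    have "{0<..t} \<in> sets mes"
      using t by (auto simp: sets_restrict_space_iff)
    then have "(\<integral>\<^sup>+s. ennreal ?\<tau> * indicator {0<..t} s \<partial>mes) = ennreal ?\<tau> * emeasure mes {0<..t}"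
      by (rule nn_integral_cmult_indicator)
    also have "emeasure mes {0<..t} = ennreal t"
      using t by (subst emeasure_mes) auto
    finally show ?thesis
      using t pos by (simp add: ennreal_mult)
  qed
  finally show ?thesis .
qed

text \<open>
  Split \<open>\<bar>x\<bar>\<close> at the level \<open>rearrangement x t\<close>, where \<open>t\<close> is the measure of \<open>A\<close>: below the level \<open>A\<close> contributes
  at most its measure times the level.
\<close>

lemma hardy_littlewood_upper:
  assumes x[measurable]: "x \<in> borel_measurable mes" and A[measurable]: "A \<in> sets mes"
    and pos: "0 < measure mes A"
  shows "(\<integral>\<^sup>+s\<in>A. ennreal \<bar>x s\<bar> \<partial>mes)
    \<le> (\<integral>\<^sup>+s\<in>{0<..measure mes A}. ennreal (rearrangement x s) \<partial>lborel)"
proof -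
  let ?t = "measure mes A"
  let ?\<tau> = "rearrangement x ?t"
  have \<tau>: "0 \<le> ?\<tau>"
    using rearrangement_nonneg[OF x pos] .
  have "(\<integral>\<^sup>+s\<in>A. ennreal \<bar>x s\<bar> \<partial>mes)
      \<le> (\<integral>\<^sup>+s. ennreal (max 0 (\<bar>x s\<bar> - ?\<tau>)) + ennreal ?\<tau> * indicator A s \<partial>mes)"
    using \<tau> by (intro nn_integral_mono) (auto simp: indicator_def max_def ennreal_plus[symmetric] simp del: ennreal_plus intro!: ennreal_leI)
  also have "\<dots> = (\<integral>\<^sup>+s. ennreal (max 0 (\<bar>x s\<bar> - ?\<tau>)) \<partial>mes) + ennreal ?\<tau> * emeasure mes A"
    by (subst nn_integral_add) (auto simp: nn_integral_cmult_indicator)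
  also have "ennreal ?\<tau> * emeasure mes A = ennreal (?\<tau> * ?t)"
    using \<tau> by (simp add: mes.emeasure_eq_measure ennreal_mult)
  finally show ?thesis
    by (simp add: integral_rearrangement[OF x pos])
qed

lemma measure_level_ge:
  assumes x[measurable]: "x \<in> borel_measurable mes" and t: "0 < t" "t \<le> 1"
  shows "t \<le> measure mes {s \<in> space mes. rearrangement x t \<le> \<bar>x s\<bar>}"
proof (cases "rearrangement x t = 0")
  case True
  then show ?thesis
    using t mes.prob_space by simp
next
  case False
  let ?\<tau> = "rearrangement x t"
  have \<tau>: "0 < ?\<tau>"
    using False rearrangement_nonneg[OF x t(1)] by simp
  let ?\<sigma> = "\<lambda>n. ?\<tau> - ?\<tau> / real (Suc n)"
  let ?A = "\<lambda>n. {s \<in> space mes. ?\<sigma> n < \<bar>x s\<bar>}"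
  have "decseq ?A"
  proof (rule decseq_SucI, rule Collect_mono, intro impI)
    fix n s assume "s \<in> space mes \<and> ?\<sigma> (Suc n) < \<bar>x s\<bar>"
    moreover have "?\<tau> / real (Suc (Suc n)) \<le> ?\<tau> / real (Suc n)"
      using \<tau> by (intro divide_left_mono) auto
    ultimately show "s \<in> space mes \<and> ?\<sigma> n < \<bar>x s\<bar>"
      by linarith
  qed
  then have "(\<lambda>n. measure mes (?A n)) \<longlonglongrightarrow> measure mes (\<Inter>n. ?A n)"
    by (intro mes.finite_Lim_measure_decseq) auto
  moreover have "t \<le> measure mes (?A n)" for n
  proof -
    have "0 \<le> ?\<sigma> n" "?\<sigma> n < ?\<tau>"
      using \<tau> by (auto simp: field_simps)
    then show ?thesis
      using rearrangement_le[OF x, of "?\<sigma> n" t] by (force simp: dist_fun_def)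
  qed
  ultimately have "t \<le> measure mes (\<Inter>n. ?A n)"
    by (intro LIMSEQ_le_const) auto
  also have "(\<Inter>n. ?A n) \<subseteq> {s \<in> space mes. ?\<tau> \<le> \<bar>x s\<bar>}"
  proof
    fix s assume s: "s \<in> (\<Inter>n. ?A n)"
    have "?\<sigma> \<longlonglongrightarrow> ?\<tau> - 0"
      by (intro tendsto_diff tendsto_const lim_const_over_n[THEN LIMSEQ_Suc])
    then have "?\<tau> \<le> \<bar>x s\<bar>"
      using s by (intro LIMSEQ_le_const2[of ?\<sigma>]) (auto intro: less_imp_le)
    then show "s \<in> {s \<in> space mes. ?\<tau> \<le> \<bar>x s\<bar>}"
      using s by auto
  qed
  then have "measure mes (\<Inter>n. ?A n) \<le> measure mes {s \<in> space mes. ?\<tau> \<le> \<bar>x s\<bar>}"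
    by (intro mes.finite_measure_mono) auto
  finally show ?thesis .
qed

text \<open>
  The measure of \<open>B \<inter> {0..c}\<close> is a Lipschitz function of \<open>c\<close>, so it takes every intermediate value.
\<close>

lemma mes_nonatomic:
  assumes B[measurable]: "B \<in> sets mes" and m: "0 \<le> m" "m \<le> measure mes B"
  shows "\<exists>C\<in>sets mes. C \<subseteq> B \<and> measure mes C = m"
proof -
  let ?h = "\<lambda>c. measure mes (B \<inter> {0..c})"
  have I: "{0..c} \<inter> {0..1} \<in> sets mes" for c :: real
    by (auto simp: sets_restrict_space_iff)
  have Bsub: "B \<subseteq> {0..1}"
    using sets.sets_into_space[OF B] by (simp add: space_mes)
  have meas: "B \<inter> {0..c} \<in> sets mes" for c
  proof -
    have "B \<inter> {0..c} = B \<inter> ({0..c} \<inter> {0..1})"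
      using Bsub by auto
    then show ?thesis
      using I[of c] B by auto
  qed
  have lip: "?h d - ?h c \<le> d - c" "0 \<le> ?h d - ?h c" if "0 \<le> c" "c \<le> d" "d \<le> 1" for c d
  proof -
    have J: "{c<..d} \<in> sets mes"
      using that by (auto simp: sets_restrict_space_iff)
    have "B \<inter> {0..d} = (B \<inter> {0..c}) \<union> (B \<inter> {c<..d})"
      using that by auto
    then have "?h d = ?h c + measure mes (B \<inter> {c<..d})"
      using meas[of c] J by (auto intro!: mes.finite_measure_Union)
    moreover have "measure mes (B \<inter> {c<..d}) \<le> measure mes {c<..d}"
      using J by (intro mes.finite_measure_mono) auto
    moreover have "measure mes {c<..d} = d - c"
      using that by (subst measure_def, subst emeasure_mes) auto
    moreover have "0 \<le> measure mes (B \<inter> {c<..d})"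
      by simp
    ultimately show "?h d - ?h c \<le> d - c" "0 \<le> ?h d - ?h c"
      by linarith+
  qed
  have "\<bar>?h c - ?h d\<bar> \<le> \<bar>c - d\<bar>" if "c \<in> {0..1}" "d \<in> {0..1}" for c d
    using lip[of c d] lip[of d c] that by (cases "c \<le> d") auto
  then have "1-lipschitz_on {0..1} ?h"
    by (intro lipschitz_onI) (auto simp: dist_real_def)
  then have cont: "continuous_on {0..1} ?h"
    by (rule lipschitz_on_continuous_on)
  have "?h 0 = 0"
  proof -
    have "?h 0 \<le> measure mes {0}"
      by (intro mes.finite_measure_mono) (auto simp: sets_restrict_space_iff)
    also have "\<dots> = 0"
      by (simp add: measure_def emeasure_mes)
    finally show ?thesis
      using measure_nonneg[of mes "B \<inter> {0..0}"] by linarith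
  qed
  moreover have "B \<inter> {0..1} = B"
    using Bsub by auto
  ultimately obtain c where "0 \<le> c" "c \<le> 1" "?h c = m"
    using IVT'[of ?h 0 m 1] m cont by auto
  then show ?thesis
    using meas[of c] by auto
qed

text \<open>
  The extremal set consists of the points where \<open>\<bar>x\<bar>\<close> exceeds the level \<open>rearrangement x t\<close> and of a part of
  the level set that fills the measure up to \<open>t\<close>.
\<close>

lemma hardy_littlewood_attained:
  assumes x[measurable]: "x \<in> borel_measurable mes" and t: "0 < t" "t \<le> 1"
  shows "\<exists>A\<in>sets mes. measure mes A = t \<and>
    (\<integral>\<^sup>+s\<in>A. ennreal \<bar>x s\<bar> \<partial>mes) = (\<integral>\<^sup>+s\<in>{0<..t}. ennreal (rearrangement x s) \<partial>lborel)"
proof -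
  let ?\<tau> = "rearrangement x t"
  have \<tau>: "0 \<le> ?\<tau>"
    using rearrangement_nonneg[OF x t(1)] .
  let ?U = "{s \<in> space mes. ?\<tau> < \<bar>x s\<bar>}" and ?E = "{s \<in> space mes. \<bar>x s\<bar> = ?\<tau>}"
  have "{s \<in> space mes. ?\<tau> \<le> \<bar>x s\<bar>} = ?U \<union> ?E"
    by auto
  moreover have "measure mes (?U \<union> ?E) = measure mes ?U + measure mes ?E"
    by (intro mes.finite_measure_Union) auto
  ultimately have "t - measure mes ?U \<le> measure mes ?E"
    using measure_level_ge[OF x t] by simp
  moreover have "0 \<le> t - measure mes ?U"
    using dist_fun_rearrangement_le[OF x t(1)] by (simp add: dist_fun_def)
  ultimately obtain C where C[measurable]: "C \<in> sets mes" "C \<subseteq> ?E" "measure mes C = t - measure mes ?U"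
    using mes_nonatomic[of ?E "t - measure mes ?U"] by auto
  have m: "measure mes (?U \<union> C) = t"
    using C by (subst mes.finite_measure_Union) auto
  have "(\<integral>\<^sup>+s\<in>?U \<union> C. ennreal \<bar>x s\<bar> \<partial>mes)
      = (\<integral>\<^sup>+s. ennreal (max 0 (\<bar>x s\<bar> - ?\<tau>)) + ennreal ?\<tau> * indicator (?U \<union> C) s \<partial>mes)"
    using \<tau> C(2)
    by (intro nn_integral_cong)
       (auto simp: indicator_def max_def ennreal_plus[symmetric] simp del: ennreal_plus)
  also have "\<dots> = (\<integral>\<^sup>+s. ennreal (max 0 (\<bar>x s\<bar> - ?\<tau>)) \<partial>mes) + ennreal ?\<tau> * emeasure mes (?U \<union> C)"
    by (subst nn_integral_add) (auto simp: nn_integral_cmult_indicator)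
  also have "ennreal ?\<tau> * emeasure mes (?U \<union> C) = ennreal (?\<tau> * t)"
    using \<tau> t m by (simp add: mes.emeasure_eq_measure ennreal_mult)
  finally show ?thesis
    using m integral_rearrangement[OF x t] by (intro bexI[of _ "?U \<union> C"]) auto
qed

text \<open>
  In this form the norm is a supremum of weighted integrals of \<open>\<bar>x\<bar>\<close> itself. Subadditivity, the Fatou
  property and the identification with the second dual can be read off; none of them is visible from
  the rearrangement, which is not additive.
\<close>

lemma marcinkiewicz_enorm_eq_SUP_sets:
  assumes x: "x \<in> borel_measurable mes"
  shows "marcinkiewicz_enorm \<psi> x
    = (SUP A\<in>{A \<in> sets mes. 0 < measure mes A}. (\<integral>\<^sup>+s\<in>A. ennreal \<bar>x s\<bar> \<partial>mes) / ennreal (\<psi> (measure mes A)))"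
proof (rule antisym)
  show "marcinkiewicz_enorm \<psi> x
    \<le> (SUP A\<in>{A \<in> sets mes. 0 < measure mes A}. (\<integral>\<^sup>+s\<in>A. ennreal \<bar>x s\<bar> \<partial>mes) / ennreal (\<psi> (measure mes A)))"
    unfolding marcinkiewicz_enorm_def
  proof (rule SUP_least)
    fix t :: real assume "t \<in> {0<..1}"
    then obtain A where "A \<in> sets mes" "measure mes A = t" "0 < t"
      "(\<integral>\<^sup>+s\<in>A. ennreal \<bar>x s\<bar> \<partial>mes) = (\<integral>\<^sup>+s\<in>{0<..t}. ennreal (rearrangement x s) \<partial>lborel)"
      using hardy_littlewood_attained[OF x, of t] by auto
    then show "(\<integral>\<^sup>+s\<in>{0<..t}. ennreal (rearrangement x s) \<partial>lborel) / ennreal (\<psi> t)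
      \<le> (SUP A\<in>{A \<in> sets mes. 0 < measure mes A}. (\<integral>\<^sup>+s\<in>A. ennreal \<bar>x s\<bar> \<partial>mes) / ennreal (\<psi> (measure mes A)))"
      by (intro SUP_upper2[of A]) auto
  qed
  show "(SUP A\<in>{A \<in> sets mes. 0 < measure mes A}. (\<integral>\<^sup>+s\<in>A. ennreal \<bar>x s\<bar> \<partial>mes) / ennreal (\<psi> (measure mes A)))
    \<le> marcinkiewicz_enorm \<psi> x"
    unfolding marcinkiewicz_enorm_def
  proof (rule SUP_least)
    fix A assume "A \<in> {A \<in> sets mes. 0 < measure mes A}"
    then show "(\<integral>\<^sup>+s\<in>A. ennreal \<bar>x s\<bar> \<partial>mes) / ennreal (\<psi> (measure mes A))
      \<le> (SUP t\<in>{0<..1}. (\<integral>\<^sup>+s\<in>{0<..t}. ennreal (rearrangement x s) \<partial>lborel) / ennreal (\<psi> t))"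
      using hardy_littlewood_upper[OF x, of A] mes.prob_le_1[of A]
      by (intro SUP_upper2[of "measure mes A"] divide_right_mono_ennreal) auto
  qed
qed

section \<open>Marcinkiewicz spaces are rearrangement invariant\<close>

lemma ennreal_divide_le_iff_mult:
  fixes a e :: ennreal
  assumes "0 < b"
  shows "a / ennreal b \<le> e \<longleftrightarrow> a \<le> ennreal b * e"
proof
  assume "a / ennreal b \<le> e"
  then have "ennreal b * (a / ennreal b) \<le> ennreal b * e"
    by (rule mult_left_mono) simp
  moreover have "ennreal b * (a / ennreal b) = a"
    using assms by (simp add: ennreal_times_divide mult.commute[of _ a] mult_divide_eq_ennreal)
  ultimately show "a \<le> ennreal b * e"
    by simp
next
  assume "a \<le> ennreal b * e"
  then show "a / ennreal b \<le> e"
    using assms by (intro divide_le_posI_ennreal) auto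
qed

text \<open>
  A concave function with \<open>\<psi> 0 = 0\<close> lies above a line through the origin. This bound makes the weights
  positive and puts the constants into the space.
\<close>

context
  fixes \<psi> :: "real \<Rightarrow> real" and c :: real
  assumes c: "0 < c" and \<psi>: "\<And>t. 0 < t \<Longrightarrow> t \<le> 1 \<Longrightarrow> c * t \<le> \<psi> t"
begin

lemma weight_pos: "0 < t \<Longrightarrow> t \<le> 1 \<Longrightarrow> 0 < \<psi> t"
  using \<psi>[of t] c by (smt (verit) mult_pos_pos)

lemma enorm_le_iff:
  assumes "x \<in> borel_measurable mes"
  shows "marcinkiewicz_enorm \<psi> x \<le> B \<longleftrightarrow>
    (\<forall>A\<in>sets mes. 0 < measure mes A \<longrightarrow>
      (\<integral>\<^sup>+s\<in>A. ennreal \<bar>x s\<bar> \<partial>mes) \<le> ennreal (\<psi> (measure mes A)) * B)"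
proof -
  have "(\<integral>\<^sup>+s\<in>A. ennreal \<bar>x s\<bar> \<partial>mes) / ennreal (\<psi> (measure mes A)) \<le> B \<longleftrightarrow>
      (\<integral>\<^sup>+s\<in>A. ennreal \<bar>x s\<bar> \<partial>mes) \<le> ennreal (\<psi> (measure mes A)) * B"
    if "0 < measure mes A" for A
    using weight_pos[OF that mes.prob_le_1] by (rule ennreal_divide_le_iff_mult)
  then show ?thesis
    unfolding marcinkiewicz_enorm_eq_SUP_sets[OF assms] by (auto simp: SUP_le_iff)
qed

lemma integral_le_enorm:
  assumes "x \<in> borel_measurable mes" "A \<in> sets mes" "0 < measure mes A"
  shows "(\<integral>\<^sup>+s\<in>A. ennreal \<bar>x s\<bar> \<partial>mes) \<le> ennreal (\<psi> (measure mes A)) * marcinkiewicz_enorm \<psi> x"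
  using enorm_le_iff[OF assms(1), of "marcinkiewicz_enorm \<psi> x"] assms by auto

lemma L1_le_enorm:
  assumes "x \<in> borel_measurable mes"
  shows "(\<integral>\<^sup>+s. ennreal \<bar>x s\<bar> \<partial>mes) \<le> ennreal (\<psi> 1) * marcinkiewicz_enorm \<psi> x"
proof -
  have "(\<integral>\<^sup>+s. ennreal \<bar>x s\<bar> \<partial>mes) = (\<integral>\<^sup>+s\<in>space mes. ennreal \<bar>x s\<bar> \<partial>mes)"
    by (intro nn_integral_cong) simp
  also have "\<dots> \<le> ennreal (\<psi> 1) * marcinkiewicz_enorm \<psi> x"
    using integral_le_enorm[OF assms sets.top] by (simp add: mes.prob_space)
  finally show ?thesis .
qed

lemma enorm_mono:
  assumes "x \<in> borel_measurable mes" "y \<in> borel_measurable mes" "AE t in mes. \<bar>x t\<bar> \<le> \<bar>y t\<bar>"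
  shows "marcinkiewicz_enorm \<psi> x \<le> marcinkiewicz_enorm \<psi> y"
  unfolding enorm_le_iff[OF assms(1)]
proof (intro ballI impI)
  fix A assume A: "A \<in> sets mes" "0 < measure mes A"
  have "(\<integral>\<^sup>+s\<in>A. ennreal \<bar>x s\<bar> \<partial>mes) \<le> (\<integral>\<^sup>+s\<in>A. ennreal \<bar>y s\<bar> \<partial>mes)"
    using assms(3) by (intro nn_integral_mono_AE) (auto elim!: eventually_mono intro!: mult_right_mono)
  also have "\<dots> \<le> ennreal (\<psi> (measure mes A)) * marcinkiewicz_enorm \<psi> y"
    using A assms by (intro integral_le_enorm)
  finally show "(\<integral>\<^sup>+s\<in>A. ennreal \<bar>x s\<bar> \<partial>mes) \<le> ennreal (\<psi> (measure mes A)) * marcinkiewicz_enorm \<psi> y" .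
qed

lemma enorm_add:
  assumes [measurable]: "x \<in> borel_measurable mes" "y \<in> borel_measurable mes"
  shows "marcinkiewicz_enorm \<psi> (\<lambda>t. x t + y t) \<le> marcinkiewicz_enorm \<psi> x + marcinkiewicz_enorm \<psi> y"
proof -
  have "(\<integral>\<^sup>+s\<in>A. ennreal \<bar>x s + y s\<bar> \<partial>mes)
      \<le> ennreal (\<psi> (measure mes A)) * (marcinkiewicz_enorm \<psi> x + marcinkiewicz_enorm \<psi> y)"
    if A[measurable]: "A \<in> sets mes" and "0 < measure mes A" for A
  proof -
    have "(\<integral>\<^sup>+s\<in>A. ennreal \<bar>x s + y s\<bar> \<partial>mes)
        \<le> (\<integral>\<^sup>+s. ennreal \<bar>x s\<bar> * indicator A s + ennreal \<bar>y s\<bar> * indicator A s \<partial>mes)"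
      by (intro nn_integral_mono)
         (auto simp: indicator_def ennreal_plus[symmetric] simp del: ennreal_plus intro!: ennreal_leI)
    also have "\<dots> = (\<integral>\<^sup>+s\<in>A. ennreal \<bar>x s\<bar> \<partial>mes) + (\<integral>\<^sup>+s\<in>A. ennreal \<bar>y s\<bar> \<partial>mes)"
      by (intro nn_integral_add) measurable
    also have "\<dots> \<le> ennreal (\<psi> (measure mes A)) * marcinkiewicz_enorm \<psi> x
        + ennreal (\<psi> (measure mes A)) * marcinkiewicz_enorm \<psi> y"
      using that by (intro add_mono integral_le_enorm) measurable
    finally show ?thesis
      by (simp add: distrib_left)
  qed
  then show ?thesis
    by (subst enorm_le_iff) (auto, measurable)
qed

lemma enorm_cmult_le:
  assumes [measurable]: "x \<in> borel_measurable mes"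
  shows "marcinkiewicz_enorm \<psi> (\<lambda>t. a * x t) \<le> ennreal \<bar>a\<bar> * marcinkiewicz_enorm \<psi> x"
proof -
  have "(\<integral>\<^sup>+s\<in>A. ennreal \<bar>a * x s\<bar> \<partial>mes)
      \<le> ennreal (\<psi> (measure mes A)) * (ennreal \<bar>a\<bar> * marcinkiewicz_enorm \<psi> x)"
    if A[measurable]: "A \<in> sets mes" and "0 < measure mes A" for A
  proof -
    have "(\<integral>\<^sup>+s\<in>A. ennreal \<bar>a * x s\<bar> \<partial>mes) = (\<integral>\<^sup>+s. ennreal \<bar>a\<bar> * (ennreal \<bar>x s\<bar> * indicator A s) \<partial>mes)"
      by (intro nn_integral_cong) (simp add: abs_mult ennreal_mult mult.assoc)
    also have "\<dots> = ennreal \<bar>a\<bar> * (\<integral>\<^sup>+s\<in>A. ennreal \<bar>x s\<bar> \<partial>mes)"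
      by (intro nn_integral_cmult) measurable
    also have "\<dots> \<le> ennreal \<bar>a\<bar> * (ennreal (\<psi> (measure mes A)) * marcinkiewicz_enorm \<psi> x)"
      using that by (intro mult_left_mono integral_le_enorm) auto
    finally show ?thesis
      by (simp add: mult_ac)
  qed
  then show ?thesis
    by (subst enorm_le_iff) (auto, measurable)
qed

lemma enorm_cmult:
  assumes [measurable]: "x \<in> borel_measurable mes"
  shows "marcinkiewicz_enorm \<psi> (\<lambda>t. a * x t) = ennreal \<bar>a\<bar> * marcinkiewicz_enorm \<psi> x"
proof (cases "a = 0")
  case True
  then show ?thesis
    using enorm_cmult_le[OF assms, of a] by simp
next
  case False
  have "marcinkiewicz_enorm \<psi> (\<lambda>t. inverse a * (a * x t))
      \<le> ennreal \<bar>inverse a\<bar> * marcinkiewicz_enorm \<psi> (\<lambda>t. a * x t)"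
    by (rule enorm_cmult_le) measurable
  moreover have "(\<lambda>t. inverse a * (a * x t)) = x"
    using False by auto
  ultimately have "ennreal \<bar>a\<bar> * marcinkiewicz_enorm \<psi> x
      \<le> ennreal \<bar>a\<bar> * (ennreal \<bar>inverse a\<bar> * marcinkiewicz_enorm \<psi> (\<lambda>t. a * x t))"
    by (intro mult_left_mono) auto
  also have "\<dots> = ennreal (\<bar>a\<bar> * \<bar>inverse a\<bar>) * marcinkiewicz_enorm \<psi> (\<lambda>t. a * x t)"
    by (simp add: ennreal_mult mult.assoc)
  also have "\<bar>a\<bar> * \<bar>inverse a\<bar> = 1"
    using False by (simp flip: abs_mult)
  finally show ?thesis
    using enorm_cmult_le[OF assms, of a] by (intro antisym) auto
qed

lemma enorm_eq_0_iff:
  assumes [measurable]: "x \<in> borel_measurable mes"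
  shows "marcinkiewicz_enorm \<psi> x = 0 \<longleftrightarrow> (AE t in mes. x t = 0)"
proof
  assume "marcinkiewicz_enorm \<psi> x = 0"
  then have "(\<integral>\<^sup>+s. ennreal \<bar>x s\<bar> \<partial>mes) = 0"
    using L1_le_enorm[OF assms] by simp
  then show "AE t in mes. x t = 0"
    by (subst (asm) nn_integral_0_iff_AE) (auto elim!: eventually_mono, measurable)
next
  assume "AE t in mes. x t = 0"
  then have "marcinkiewicz_enorm \<psi> x \<le> marcinkiewicz_enorm \<psi> (\<lambda>t. 0 * x t)"
    by (intro enorm_mono) (auto, measurable)
  also have "\<dots> = 0"
    by (subst enorm_cmult) auto
  finally show "marcinkiewicz_enorm \<psi> x = 0"
    by simp
qed

lemma marcinkiewicz_enorm_eq_norm: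
  "x \<in> marcinkiewicz \<psi> \<Longrightarrow> marcinkiewicz_enorm \<psi> x = ennreal (marcinkiewicz_norm \<psi> x)"
  by (simp add: marcinkiewicz_def marcinkiewicz_norm_def)

lemma marcinkiewicz_norm_nonneg: "0 \<le> marcinkiewicz_norm \<psi> x"
  by (simp add: marcinkiewicz_norm_def)

lemma marcinkiewicz_measurable: "x \<in> marcinkiewicz \<psi> \<Longrightarrow> x \<in> borel_measurable mes"
  by (simp add: marcinkiewicz_def)

lemma marcinkiewiczI:
  assumes "x \<in> borel_measurable mes" "marcinkiewicz_enorm \<psi> x \<le> ennreal B" "0 \<le> B"
  shows "x \<in> marcinkiewicz \<psi>" "marcinkiewicz_norm \<psi> x \<le> B"
proof -
  show x: "x \<in> marcinkiewicz \<psi>"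
    using assms by (auto simp: marcinkiewicz_def intro: le_less_trans)
  show "marcinkiewicz_norm \<psi> x \<le> B"
    using assms by (simp add: marcinkiewicz_enorm_eq_norm[OF x])
qed

lemma marcinkiewicz_add:
  assumes "x \<in> marcinkiewicz \<psi>" "y \<in> marcinkiewicz \<psi>"
  shows "(\<lambda>t. x t + y t) \<in> marcinkiewicz \<psi>"
    "marcinkiewicz_norm \<psi> (\<lambda>t. x t + y t) \<le> marcinkiewicz_norm \<psi> x + marcinkiewicz_norm \<psi> y"
proof -
  note [measurable] = assms[THEN marcinkiewicz_measurable]
  have "(\<lambda>t. x t + y t) \<in> borel_measurable mes"
    by measurable
  moreover have "marcinkiewicz_enorm \<psi> (\<lambda>t. x t + y t)
      \<le> ennreal (marcinkiewicz_norm \<psi> x + marcinkiewicz_norm \<psi> y)"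
    using enorm_add[of x y] assms
    by (simp add: marcinkiewicz_enorm_eq_norm marcinkiewicz_norm_nonneg marcinkiewicz_measurable)
  ultimately show "(\<lambda>t. x t + y t) \<in> marcinkiewicz \<psi>"
    "marcinkiewicz_norm \<psi> (\<lambda>t. x t + y t) \<le> marcinkiewicz_norm \<psi> x + marcinkiewicz_norm \<psi> y"
    by (auto intro!: marcinkiewiczI(1)[of _ "marcinkiewicz_norm \<psi> x + marcinkiewicz_norm \<psi> y"]
      marcinkiewiczI(2) simp: marcinkiewicz_norm_nonneg simp del: ennreal_plus)
qed

lemma marcinkiewicz_cmult:
  assumes "x \<in> marcinkiewicz \<psi>"
  shows "(\<lambda>t. a * x t) \<in> marcinkiewicz \<psi>"
    "marcinkiewicz_norm \<psi> (\<lambda>t. a * x t) = \<bar>a\<bar> * marcinkiewicz_norm \<psi> x"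
proof -
  note [measurable] = assms[THEN marcinkiewicz_measurable]
  have eq: "marcinkiewicz_enorm \<psi> (\<lambda>t. a * x t) = ennreal (\<bar>a\<bar> * marcinkiewicz_norm \<psi> x)"
    using enorm_cmult[of x a] assms
    by (simp add: marcinkiewicz_enorm_eq_norm marcinkiewicz_measurable ennreal_mult marcinkiewicz_norm_nonneg)
  then show "(\<lambda>t. a * x t) \<in> marcinkiewicz \<psi>"
    by (auto simp: marcinkiewicz_def)
  show "marcinkiewicz_norm \<psi> (\<lambda>t. a * x t) = \<bar>a\<bar> * marcinkiewicz_norm \<psi> x"
    unfolding marcinkiewicz_norm_def[of _ "\<lambda>t. a * x t"] eq
    by (simp add: marcinkiewicz_norm_nonneg)
qed

lemma marcinkiewicz_diff:
  assumes "x \<in> marcinkiewicz \<psi>" "y \<in> marcinkiewicz \<psi>"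
  shows "(\<lambda>t. x t - y t) \<in> marcinkiewicz \<psi>"
  using marcinkiewicz_add(1)[OF assms(1) marcinkiewicz_cmult(1)[OF assms(2), of "-1"]] by simp

lemma marcinkiewicz_integrable:
  assumes "x \<in> marcinkiewicz \<psi>"
  shows "integrable mes x"
proof (rule integrableI_bounded)
  have "(\<integral>\<^sup>+s. ennreal \<bar>x s\<bar> \<partial>mes) \<le> ennreal (\<psi> 1) * ennreal (marcinkiewicz_norm \<psi> x)"
    using L1_le_enorm[of x] assms by (simp add: marcinkiewicz_enorm_eq_norm marcinkiewicz_measurable)
  also have "\<dots> < \<infinity>"
    by (simp add: ennreal_mult_less_top)
  finally show "(\<integral>\<^sup>+s. ennreal (norm (x s)) \<partial>mes) < \<infinity>"
    by simp
qed (rule marcinkiewicz_measurable[OF assms])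

lemma marcinkiewicz_integral_abs_le:
  assumes "x \<in> marcinkiewicz \<psi>"
  shows "(\<integral>s. \<bar>x s\<bar> \<partial>mes) \<le> \<psi> 1 * marcinkiewicz_norm \<psi> x"
proof -
  have "ennreal (\<integral>s. \<bar>x s\<bar> \<partial>mes) = (\<integral>\<^sup>+s. ennreal \<bar>x s\<bar> \<partial>mes)"
    using marcinkiewicz_integrable[OF assms] by (intro nn_integral_eq_integral[symmetric]) auto
  also have "\<dots> \<le> ennreal (\<psi> 1 * marcinkiewicz_norm \<psi> x)"
    using L1_le_enorm[of x] assms weight_pos[of 1] marcinkiewicz_norm_nonneg
    by (simp add: marcinkiewicz_enorm_eq_norm marcinkiewicz_measurable ennreal_mult)
  finally show ?thesis
    using weight_pos[of 1] marcinkiewicz_norm_nonneg by (subst (asm) ennreal_le_iff) auto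
qed

lemma one_in_marcinkiewicz: "(\<lambda>t. 1) \<in> marcinkiewicz \<psi>"
proof -
  have "marcinkiewicz_enorm \<psi> (\<lambda>t. 1) \<le> ennreal (1 / c)"
  proof (subst enorm_le_iff, simp, intro ballI impI)
    fix A assume A: "A \<in> sets mes" "0 < measure mes A"
    have "(\<integral>\<^sup>+s\<in>A. ennreal \<bar>1\<bar> \<partial>mes) = ennreal (measure mes A)"
      using A by (simp add: mes.emeasure_eq_measure)
    also have "\<dots> \<le> ennreal (\<psi> (measure mes A) * (1 / c))"
      using \<psi>[OF A(2) mes.prob_le_1] c by (intro ennreal_leI) (simp add: field_simps)
    also have "\<dots> = ennreal (\<psi> (measure mes A)) * ennreal (1 / c)"
      using weight_pos[OF A(2) mes.prob_le_1] c by (intro ennreal_mult) auto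
    finally show "(\<integral>\<^sup>+s\<in>A. ennreal \<bar>1\<bar> \<partial>mes) \<le> ennreal (\<psi> (measure mes A)) * ennreal (1 / c)" .
  qed
  then show ?thesis
    using c by (intro marcinkiewiczI) auto
qed

lemma marcinkiewicz_fatou:
  assumes Y: "\<And>i. Y i \<in> marcinkiewicz \<psi>" "\<And>i. marcinkiewicz_norm \<psi> (Y i) \<le> B"
    and y: "y \<in> borel_measurable mes" and lim: "AE t in mes. (\<lambda>i. Y i t) \<longlonglongrightarrow> y t"
  shows "y \<in> marcinkiewicz \<psi>" "marcinkiewicz_norm \<psi> y \<le> B"
proof -
  note [measurable] = Y(1)[THEN marcinkiewicz_measurable] y
  have B: "0 \<le> B"
    using Y(2)[of 0] marcinkiewicz_norm_nonneg[of "Y 0"] by simp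
  have "(\<integral>\<^sup>+s\<in>A. ennreal \<bar>y s\<bar> \<partial>mes) \<le> ennreal (\<psi> (measure mes A)) * ennreal B"
    if A[measurable]: "A \<in> sets mes" and pos: "0 < measure mes A" for A
  proof -
    have "(\<integral>\<^sup>+s\<in>A. ennreal \<bar>y s\<bar> \<partial>mes) \<le> (\<integral>\<^sup>+s. liminf (\<lambda>i. ennreal \<bar>Y i s\<bar> * indicator A s) \<partial>mes)"
    proof (rule nn_integral_mono_AE)
      show "AE s in mes. ennreal \<bar>y s\<bar> * indicator A s \<le> liminf (\<lambda>i. ennreal \<bar>Y i s\<bar> * indicator A s)"
        using lim
      proof eventually_elim
        case (elim s)
        have "(\<lambda>i. ennreal (\<bar>Y i s\<bar> * indicator A s)) \<longlonglongrightarrow> ennreal (\<bar>y s\<bar> * indicator A s)"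
          using elim by (intro tendsto_ennrealI tendsto_mult tendsto_rabs tendsto_const)
        then have "liminf (\<lambda>i. ennreal (\<bar>Y i s\<bar> * indicator A s)) = ennreal (\<bar>y s\<bar> * indicator A s)"
          by (intro lim_imp_Liminf) auto
        then show ?case
          by (simp add: ennreal_mult ennreal_indicator)
      qed
    qed
    also have "\<dots> \<le> liminf (\<lambda>i. \<integral>\<^sup>+s\<in>A. ennreal \<bar>Y i s\<bar> \<partial>mes)"
      by (intro nn_integral_liminf) measurable
    also have "\<dots> \<le> liminf (\<lambda>i::nat. ennreal (\<psi> (measure mes A)) * ennreal B)"
    proof (intro Liminf_mono always_eventually allI)
      fix i
      have "(\<integral>\<^sup>+s\<in>A. ennreal \<bar>Y i s\<bar> \<partial>mes) \<le> ennreal (\<psi> (measure mes A)) * marcinkiewicz_enorm \<psi> (Y i)"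
        using that by (intro integral_le_enorm) measurable
      also have "\<dots> \<le> ennreal (\<psi> (measure mes A)) * ennreal B"
        using Y by (intro mult_left_mono) (auto simp: marcinkiewicz_enorm_eq_norm intro!: ennreal_leI)
      finally show "(\<integral>\<^sup>+s\<in>A. ennreal \<bar>Y i s\<bar> \<partial>mes) \<le> ennreal (\<psi> (measure mes A)) * ennreal B" .
    qed
    also have "\<dots> = ennreal (\<psi> (measure mes A)) * ennreal B"
      by (simp add: Liminf_const)
    finally show ?thesis .
  qed
  then have "marcinkiewicz_enorm \<psi> y \<le> ennreal B"
    by (subst enorm_le_iff) (auto, measurable)
  then show "y \<in> marcinkiewicz \<psi>" "marcinkiewicz_norm \<psi> y \<le> B"
    using marcinkiewiczI y B by auto
qed

text \<open>
  A Cauchy sequence is Cauchy in \<open>L\<^sub>1\<close>, so a subsequence converges almost everywhere; the Fatou property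
  carries the Cauchy estimate over to the limit.
\<close>

lemma marcinkiewicz_complete:
  assumes X: "\<And>n. X n \<in> marcinkiewicz \<psi>"
    and cauchy: "\<And>e. 0 < e \<Longrightarrow> \<exists>K. \<forall>m\<ge>K. \<forall>n\<ge>K. marcinkiewicz_norm \<psi> (\<lambda>t. X m t - X n t) < e"
  shows "\<exists>x\<in>marcinkiewicz \<psi>. (\<lambda>n::nat. marcinkiewicz_norm \<psi> (\<lambda>t. X n t - x t)) \<longlonglongrightarrow> 0"
proof -
  note [measurable] = X[THEN marcinkiewicz_measurable]
  obtain r where r: "strict_mono r" "AE t in mes. Cauchy (\<lambda>i. X (r i) t)"
  proof (rule cauchy_L1_AE_cauchy_subseq[of mes X])
    show "integrable mes (X n)" for n
      using X by (rule marcinkiewicz_integrable)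
    fix e :: real assume "0 < e"
    then obtain K where K: "\<forall>m\<ge>K. \<forall>n\<ge>K. marcinkiewicz_norm \<psi> (\<lambda>t. X m t - X n t) < e / \<psi> 1"
      using cauchy[of "e / \<psi> 1"] weight_pos[of 1] by auto
    have "(\<integral>t. norm (X m t - X n t) \<partial>mes) < e" if "K \<le> m" "K \<le> n" for m n
    proof -
      have "(\<integral>t. norm (X m t - X n t) \<partial>mes) \<le> \<psi> 1 * marcinkiewicz_norm \<psi> (\<lambda>t. X m t - X n t)"
        using marcinkiewicz_integral_abs_le[OF marcinkiewicz_diff[OF X X]] by simp
      also have "\<dots> < e"
        using K that weight_pos[of 1] by (simp add: field_simps)
      finally show ?thesis .
    qed
    then show "\<exists>N. \<forall>i\<ge>N. \<forall>j\<ge>N. (\<integral>t. norm (X i t - X j t) \<partial>mes) < e"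
      by blast
  qed auto
  define x where "x t = lim (\<lambda>i. X (r i) t)" for t
  have x[measurable]: "x \<in> borel_measurable mes"
    unfolding x_def[abs_def] by (intro borel_measurable_lim_metric) measurable
  have lim: "AE t in mes. (\<lambda>i. X (r i) t) \<longlonglongrightarrow> x t"
    using r(2) by eventually_elim (simp add: x_def convergent_LIMSEQ_iff[symmetric] Cauchy_convergent_iff)
  have close: "\<exists>K. \<forall>n\<ge>K. (\<lambda>t. X n t - x t) \<in> marcinkiewicz \<psi> \<and> marcinkiewicz_norm \<psi> (\<lambda>t. X n t - x t) \<le> e"
    if "0 < e" for e
  proof -
    obtain K where K: "\<forall>m\<ge>K. \<forall>n\<ge>K. marcinkiewicz_norm \<psi> (\<lambda>t. X m t - X n t) < e"
      using cauchy[OF \<open>0 < e\<close>] by auto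
    have "(\<lambda>t. X n t - x t) \<in> marcinkiewicz \<psi> \<and> marcinkiewicz_norm \<psi> (\<lambda>t. X n t - x t) \<le> e" if "K \<le> n" for n
    proof -
      \<comment> \<open>The shift by \<open>K\<close> makes every member of the sequence satisfy the Cauchy estimate.\<close>
      let ?Y = "\<lambda>i t. X n t - X (r (i + K)) t"
      have "?Y i \<in> marcinkiewicz \<psi>" for i
        by (intro marcinkiewicz_diff X)
      moreover have "marcinkiewicz_norm \<psi> (?Y i) \<le> e" for i
        using K that seq_suble[OF r(1), of "i + K"] by (auto intro: less_imp_le)
      moreover have "(\<lambda>t. X n t - x t) \<in> borel_measurable mes"
        by measurable
      moreover have "AE t in mes. (\<lambda>i. ?Y i t) \<longlonglongrightarrow> X n t - x t"
        using lim by eventually_elim (intro tendsto_diff tendsto_const LIMSEQ_ignore_initial_segment)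
      ultimately show ?thesis
        using marcinkiewicz_fatou[of ?Y e "\<lambda>t. X n t - x t"] by auto
    qed
    then show ?thesis by blast
  qed
  obtain K where "(\<lambda>t. X K t - x t) \<in> marcinkiewicz \<psi>"
    using close[of 1] by auto
  from marcinkiewicz_diff[OF X[of K] this] have "x \<in> marcinkiewicz \<psi>"
    by simp
  moreover have "(\<lambda>n. marcinkiewicz_norm \<psi> (\<lambda>t. X n t - x t)) \<longlonglongrightarrow> 0"
  proof (rule LIMSEQ_I)
    fix e :: real assume "0 < e"
    then obtain K where "\<forall>n\<ge>K. marcinkiewicz_norm \<psi> (\<lambda>t. X n t - x t) \<le> e / 2"
      using close[of "e / 2"] by auto
    then show "\<exists>K. \<forall>n\<ge>K. norm (marcinkiewicz_norm \<psi> (\<lambda>t. X n t - x t) - 0) < e"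
      using \<open>0 < e\<close> marcinkiewicz_norm_nonneg by (intro exI[of _ K]) force
  qed
  ultimately show ?thesis
    by blast
qed

lemma banach_fun_space_marcinkiewicz:
  "banach_fun_space (marcinkiewicz \<psi>) (marcinkiewicz_norm \<psi>)"
  unfolding banach_fun_space_def
proof (intro conjI ballI allI impI)
  show "marcinkiewicz \<psi> \<subseteq> borel_measurable mes"
    using marcinkiewicz_measurable by auto
  show "\<exists>x\<in>marcinkiewicz \<psi>. \<not> (AE t in mes. x t = 0)"
    using one_in_marcinkiewicz by (intro bexI[of _ "\<lambda>t. 1"]) auto
  show "marcinkiewicz_norm \<psi> x = 0 \<longleftrightarrow> (AE t in mes. x t = 0)" if "x \<in> marcinkiewicz \<psi>" for x
    using enorm_eq_0_iff[OF marcinkiewicz_measurable[OF that]] that marcinkiewicz_norm_nonneg[of x]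
    by (simp add: marcinkiewicz_enorm_eq_norm)
qed (use marcinkiewicz_add marcinkiewicz_cmult marcinkiewicz_complete in blast)+

abbreviation (input) "dual \<equiv> kothe_dual (marcinkiewicz \<psi>) (marcinkiewicz_norm \<psi>)"
abbreviation (input) "dual_norm \<equiv> kothe_norm (marcinkiewicz \<psi>) (marcinkiewicz_norm \<psi>)"

lemma zero_in_dual: "(\<lambda>t. 0) \<in> dual" "dual_norm (\<lambda>t. 0) = 0"
proof -
  have "{(\<integral>t. 0 * y t \<partial>mes) | y. y \<in> marcinkiewicz \<psi> \<and> marcinkiewicz_norm \<psi> y \<le> 1} = {0}"
    using marcinkiewicz_cmult[OF one_in_marcinkiewicz, of 0] by (auto intro!: exI[of _ "\<lambda>t. 0"])
  then show "(\<lambda>t. 0) \<in> dual" "dual_norm (\<lambda>t. 0) = 0"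
    by (simp_all add: kothe_dual_def kothe_norm_def)
qed

lemma dual_pairing_le:
  assumes "y \<in> dual" "dual_norm y \<le> 1" "x \<in> marcinkiewicz \<psi>"
  shows "integrable mes (\<lambda>t. x t * y t)" "(\<integral>t. x t * y t \<partial>mes) \<le> marcinkiewicz_norm \<psi> x"
proof -
  have "integrable mes (\<lambda>t. y t * x t)"
    using assms by (auto simp: kothe_dual_def)
  then show "integrable mes (\<lambda>t. x t * y t)"
    by (simp add: mult.commute)
  let ?n = "marcinkiewicz_norm \<psi> x"
  show "(\<integral>t. x t * y t \<partial>mes) \<le> ?n"
  proof (cases "?n = 0")
    case True
    then have "AE t in mes. x t = 0"
      using banach_fun_space_marcinkiewicz assms(3) by (auto simp: banach_fun_space_def)
    then have "AE t in mes. x t * y t = 0"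
      by eventually_elim simp
    then have "(\<integral>t. x t * y t \<partial>mes) = 0"
      by (rule integral_eq_zero_AE)
    then show ?thesis
      using True by simp
  next
    case False
    then have pos: "0 < ?n"
      using marcinkiewicz_norm_nonneg[of x] by simp
    let ?z = "\<lambda>t. (1 / ?n) * x t"
    have "?z \<in> marcinkiewicz \<psi>" "marcinkiewicz_norm \<psi> ?z \<le> 1"
      using marcinkiewicz_cmult[OF assms(3), of "1 / ?n"] pos by auto
    then have mem: "(\<integral>t. y t * ?z t \<partial>mes)
        \<in> {(\<integral>t. y t * z t \<partial>mes) | z. z \<in> marcinkiewicz \<psi> \<and> marcinkiewicz_norm \<psi> z \<le> 1}"
      by (intro CollectI exI[of _ ?z] conjI refl)
    have "bdd_above {(\<integral>t. y t * z t \<partial>mes) | z. z \<in> marcinkiewicz \<psi> \<and> marcinkiewicz_norm \<psi> z \<le> 1}"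
      using assms(1) by (simp add: kothe_dual_def)
    with mem have "(\<integral>t. y t * ?z t \<partial>mes) \<le> dual_norm y"
      unfolding kothe_norm_def by (rule cSup_upper)
    also have "(\<lambda>t. y t * ?z t) = (\<lambda>t. (1 / ?n) * (x t * y t))"
      by (simp add: fun_eq_iff)
    finally have "(1 / ?n) * (\<integral>t. x t * y t \<partial>mes) \<le> 1"
      using assms(2) by simp
    then show ?thesis
      using pos by (simp add: field_simps)
  qed
qed

text \<open>
  Signed indicators, divided by the weight of their support, are the functionals that define the norm;
  the sign turns \<open>x\<close> into \<open>\<bar>x\<bar>\<close> under the pairing.
\<close>

lemma normalised_indicator_in_dual:
  assumes A[measurable]: "A \<in> sets mes" and pos: "0 < measure mes A" and x[measurable]: "x \<in> borel_measurable mes"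
  defines "y \<equiv> (\<lambda>t. indicator A t * sgn (x t) / \<psi> (measure mes A))"
  shows "y \<in> dual" "dual_norm y \<le> 1"
proof -
  have p: "0 < \<psi> (measure mes A)"
    using weight_pos[OF pos mes.prob_le_1] .
  have y[measurable]: "y \<in> borel_measurable mes"
    unfolding y_def by measurable
  have bnd: "\<bar>y t * z t\<bar> \<le> \<bar>z t\<bar> * indicator A t / \<psi> (measure mes A)" for z t
    using p by (auto simp: y_def abs_mult sgn_if indicator_def divide_simps)
  have int: "integrable mes (\<lambda>t. y t * z t)" "(\<integral>t. y t * z t \<partial>mes) \<le> marcinkiewicz_norm \<psi> z"
    if z: "z \<in> marcinkiewicz \<psi>" for z
  proof -
    note [measurable] = marcinkiewicz_measurable[OF z]
    have i: "integrable mes (\<lambda>t. \<bar>z t\<bar> * indicator A t / \<psi> (measure mes A))"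
      using marcinkiewicz_integrable[OF z] by (intro integrable_divide integrable_real_mult_indicator) auto
    show i2: "integrable mes (\<lambda>t. y t * z t)"
      by (rule Bochner_Integration.integrable_bound[OF i]) (measurable, use p bnd[of _ z] in auto)
    have "(\<integral>t. y t * z t \<partial>mes) \<le> (\<integral>t. \<bar>z t\<bar> * indicator A t / \<psi> (measure mes A) \<partial>mes)"
      using bnd[of _ z] by (intro integral_mono i i2) (simp add: abs_le_iff)
    also have "\<dots> = (\<integral>t. \<bar>z t\<bar> * indicator A t \<partial>mes) / \<psi> (measure mes A)"
      by simp
    also have "\<dots> \<le> marcinkiewicz_norm \<psi> z"
    proof -
      have "ennreal (\<integral>t. \<bar>z t\<bar> * indicator A t \<partial>mes) = (\<integral>\<^sup>+t\<in>A. ennreal \<bar>z t\<bar> \<partial>mes)"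
      proof (subst nn_integral_eq_integral[symmetric])
        show "integrable mes (\<lambda>t. \<bar>z t\<bar> * indicator A t)"
          using marcinkiewicz_integrable[OF z] by (intro integrable_real_mult_indicator) auto
      qed (auto intro!: nn_integral_cong simp: indicator_def)
      also have "\<dots> \<le> ennreal (\<psi> (measure mes A) * marcinkiewicz_norm \<psi> z)"
        using integral_le_enorm[of z, OF _ A pos] p z marcinkiewicz_norm_nonneg
        by (simp add: marcinkiewicz_enorm_eq_norm ennreal_mult marcinkiewicz_measurable)
      finally have "(\<integral>t. \<bar>z t\<bar> * indicator A t \<partial>mes) \<le> \<psi> (measure mes A) * marcinkiewicz_norm \<psi> z"
        using p marcinkiewicz_norm_nonneg by (subst (asm) ennreal_le_iff) auto
      then show ?thesis
        using p by (simp add: field_simps)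
    qed
    finally show "(\<integral>t. y t * z t \<partial>mes) \<le> marcinkiewicz_norm \<psi> z" .
  qed
  have le1: "\<forall>v\<in>{(\<integral>t. y t * z t \<partial>mes) | z. z \<in> marcinkiewicz \<psi> \<and> marcinkiewicz_norm \<psi> z \<le> 1}. v \<le> 1"
    using int(2) by force
  then show "y \<in> dual"
    unfolding kothe_dual_def using int(1) y by (auto intro!: bdd_aboveI[of _ 1])
  show "dual_norm y \<le> 1"
    unfolding kothe_norm_def
  proof (rule cSup_least)
    show "{(\<integral>t. y t * z t \<partial>mes) | z. z \<in> marcinkiewicz \<psi> \<and> marcinkiewicz_norm \<psi> z \<le> 1} \<noteq> {}"
      using marcinkiewicz_cmult[OF one_in_marcinkiewicz, of 0] by auto
  qed (use le1 in blast)
qed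

text \<open>
  Every element of the second dual pairs with normalised signed indicators, and these pairings have the
  Marcinkiewicz norm as their supremum. The other inclusion is the inequality between the pairing and
  the dual norm.
\<close>

lemma marcinkiewicz_second_dual: "coincides_with_second_dual (marcinkiewicz \<psi>) (marcinkiewicz_norm \<psi>)"
proof -
  let ?S = "\<lambda>x. {(\<integral>t. x t * y t \<partial>mes) | y. y \<in> dual \<and> dual_norm y \<le> 1}"
  have ne: "?S x \<noteq> {}" for x
    using zero_in_dual by auto
  have fwd: "x \<in> kothe_dual dual dual_norm" "kothe_norm dual dual_norm x \<le> marcinkiewicz_norm \<psi> x"
    if x: "x \<in> marcinkiewicz \<psi>" for x
  proof -
    have le: "v \<le> marcinkiewicz_norm \<psi> x" if "v \<in> ?S x" for v
      using that dual_pairing_le(2)[OF _ _ x] by auto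
    have "integrable mes (\<lambda>t. x t * y t)" if "y \<in> dual" for y
    proof -
      have "integrable mes (\<lambda>t. y t * x t)"
        using that x by (simp add: kothe_dual_def)
      then show ?thesis
        by (simp add: mult.commute)
    qed
    moreover have "bdd_above (?S x)"
      by (rule bdd_aboveI[of _ "marcinkiewicz_norm \<psi> x"]) (erule le)
    ultimately show "x \<in> kothe_dual dual dual_norm"
      unfolding kothe_dual_def[of dual] using marcinkiewicz_measurable[OF x]
      by (intro CollectI conjI ballI)
    show "kothe_norm dual dual_norm x \<le> marcinkiewicz_norm \<psi> x"
      using cSup_least[OF ne le] by (subst kothe_norm_def) blast
  qed
  have bwd: "x \<in> marcinkiewicz \<psi>" "marcinkiewicz_norm \<psi> x \<le> kothe_norm dual dual_norm x"
    if x: "x \<in> kothe_dual dual dual_norm" for x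
  proof -
    let ?B = "kothe_norm dual dual_norm x"
    have x': "x \<in> borel_measurable mes \<and> (\<forall>y\<in>dual. integrable mes (\<lambda>t. x t * y t)) \<and> bdd_above (?S x)"
      using x unfolding kothe_dual_def[of dual] by (rule CollectD)
    then have [measurable]: "x \<in> borel_measurable mes" and bdd: "bdd_above (?S x)"
      and int: "\<And>y. y \<in> dual \<Longrightarrow> integrable mes (\<lambda>t. x t * y t)"
      by auto
    have up: "(\<integral>t. x t * y t \<partial>mes) \<le> ?B" if "y \<in> dual" "dual_norm y \<le> 1" for y
      using that by (subst kothe_norm_def, intro cSup_upper bdd) blast
    have B: "0 \<le> ?B"
      using up[of "\<lambda>t. 0"] zero_in_dual by simp
    have "(\<integral>\<^sup>+s\<in>A. ennreal \<bar>x s\<bar> \<partial>mes) \<le> ennreal (\<psi> (measure mes A)) * ennreal ?B"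
      if A[measurable]: "A \<in> sets mes" and pos: "0 < measure mes A" for A
    proof -
      let ?p = "\<psi> (measure mes A)"
      have p: "0 < ?p"
        using weight_pos[OF pos mes.prob_le_1] .
      let ?y = "\<lambda>t. indicator A t * sgn (x t) / ?p"
      note y = normalised_indicator_in_dual[OF A pos, of x]
      have i: "integrable mes (\<lambda>t. ?p * (x t * ?y t))"
        using int[OF y(1)] by (intro integrable_mult_right) auto
      have eq: "\<bar>x t\<bar> * indicator A t = ?p * (x t * ?y t)" for t
        using p by (auto simp: sgn_if)
      have "(\<integral>\<^sup>+s\<in>A. ennreal \<bar>x s\<bar> \<partial>mes) = (\<integral>\<^sup>+s. ennreal (?p * (x s * ?y s)) \<partial>mes)"
        unfolding eq[symmetric] by (intro nn_integral_cong) (simp add: indicator_def)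
      also have "\<dots> = ennreal (\<integral>s. ?p * (x s * ?y s) \<partial>mes)"
      proof (rule nn_integral_eq_integral[OF i])
        show "AE s in mes. 0 \<le> ?p * (x s * ?y s)"
          unfolding eq[symmetric] by simp
      qed
      also have "(\<integral>s. ?p * (x s * ?y s) \<partial>mes) = ?p * (\<integral>s. x s * ?y s \<partial>mes)"
        by (rule integral_mult_right_zero)
      also have "ennreal \<dots> \<le> ennreal (?p * ?B)"
        using up[OF y] p by (intro ennreal_leI mult_left_mono) auto
      finally show ?thesis
        using p B by (simp add: ennreal_mult)
    qed
    then have "marcinkiewicz_enorm \<psi> x \<le> ennreal ?B"
      by (subst enorm_le_iff) auto
    then show "x \<in> marcinkiewicz \<psi>" "marcinkiewicz_norm \<psi> x \<le> ?B"
      using B by (auto intro!: marcinkiewiczI)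
  qed
  show ?thesis
    unfolding coincides_with_second_dual_def
    using fwd bwd by (intro conjI equalityI subsetI ballI antisym) blast+
qed

lemma ri_space_marcinkiewicz: "ri_space (marcinkiewicz \<psi>) (marcinkiewicz_norm \<psi>)"
  unfolding ri_space_def
proof (intro conjI ballI impI)
  fix x y assume x: "x \<in> borel_measurable mes" and y: "y \<in> marcinkiewicz \<psi>"
    and le: "AE t in mes. \<bar>x t\<bar> \<le> \<bar>y t\<bar>"
  have "marcinkiewicz_enorm \<psi> x \<le> ennreal (marcinkiewicz_norm \<psi> y)"
    using enorm_mono[OF x marcinkiewicz_measurable[OF y] le] y by (simp add: marcinkiewicz_enorm_eq_norm)
  then show "x \<in> marcinkiewicz \<psi>" "marcinkiewicz_norm \<psi> x \<le> marcinkiewicz_norm \<psi> y"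
    using x marcinkiewicz_norm_nonneg by (auto intro!: marcinkiewiczI)
next
  fix x y assume x: "x \<in> borel_measurable mes" and y: "y \<in> marcinkiewicz \<psi>"
    and "equimeasurable x y"
  then have "marcinkiewicz_enorm \<psi> x = marcinkiewicz_enorm \<psi> y"
    by (simp add: marcinkiewicz_enorm_def rearrangement_cong)
  then show "x \<in> marcinkiewicz \<psi>" "marcinkiewicz_norm \<psi> x = marcinkiewicz_norm \<psi> y"
    using x y by (auto simp: marcinkiewicz_def marcinkiewicz_norm_def)
qed (use banach_fun_space_marcinkiewicz marcinkiewicz_second_dual in auto)

end

section \<open>The Marcinkiewicz spaces of the profiles\<close>

definition profile_integral :: "real \<Rightarrow> real \<Rightarrow> real" where
  "profile_integral \<epsilon> t = (LINT s:{0<..t}|lborel. profile \<epsilon> s)"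

lemma profile_integral_0[simp]: "profile_integral \<epsilon> 0 = 0"
  by (simp add: profile_integral_def set_lebesgue_integral_def)

lemma set_integrable_const_interval: "set_integrable lborel {s<..t::real} (\<lambda>_. c::real)"
  by (cases "s \<le> t") (auto simp: set_integrable_def)

lemma nn_integral_powr_neg_half:
  assumes "0 \<le> t"
  shows "(\<integral>\<^sup>+s\<in>{0..t}. ennreal (s powr (-1/2)) \<partial>lborel) = ennreal (2 * sqrt t)"
proof -
  have "((\<lambda>s. s powr (-1/2)) has_integral (t powr (-1/2 + 1) / (-1/2 + 1))) {0..t}"
    using assms by (intro has_integral_powr_from_0) auto
  moreover have "t powr (-1/2 + 1) / (-1/2 + 1) = 2 * sqrt t"
    using assms by (simp add: powr_half_sqrt)
  ultimately have "((\<lambda>s. s powr (-1/2)) has_integral (2 * sqrt t)) {0..t}"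
    by (simp only:)
  then show ?thesis
    by (intro nn_integral_has_integral_lebesgue') auto
qed

context
  fixes \<epsilon> :: real
  assumes eps: "0 < \<epsilon>" "\<epsilon> < 1"
begin

text \<open>
  A slowly varying function is of the size of its own averages. Together with monotonicity this makes
  \<open>profile_integral \<epsilon> t\<close> comparable with \<open>t * profile \<epsilon> t\<close>, and the Marcinkiewicz norm comparable with the
  smallest \<open>C\<close> such that the rearrangement is below \<open>C * profile \<epsilon>\<close>.
\<close>

lemma nn_integral_profile_le:
  assumes t: "0 < t" "t \<le> 1"
  shows "(\<integral>\<^sup>+s\<in>{0<..t}. ennreal (profile \<epsilon> s) \<partial>lborel) \<le> ennreal (4 * t * profile \<epsilon> t)"
proof -
  let ?c = "2 * profile \<epsilon> t * sqrt t"
  have c: "0 \<le> ?c"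
    using profile_ge_1[OF eps t] t by simp
  have "(\<integral>\<^sup>+s\<in>{0<..t}. ennreal (profile \<epsilon> s) \<partial>lborel)
      \<le> (\<integral>\<^sup>+s. ennreal ?c * (ennreal (s powr (-1/2)) * indicator {0..t} s) \<partial>lborel)"
  proof (rule nn_integral_mono)
    fix s
    show "ennreal (profile \<epsilon> s) * indicator {0<..t} s \<le> ennreal ?c * (ennreal (s powr (-1/2)) * indicator {0..t} s)"
    proof (cases "s \<in> {0<..t}")
      case True
      then have "profile \<epsilon> s \<le> ?c * s powr (-1/2)"
        using profile_shrink[OF eps, of s t] t by (simp add: mult_ac)
      then have "ennreal (profile \<epsilon> s) \<le> ennreal ?c * ennreal (s powr (-1/2))"
        using c by (subst ennreal_mult[symmetric]) (auto intro: ennreal_leI)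
      then show ?thesis
        using True by simp
    qed auto
  qed
  also have "\<dots> = ennreal ?c * ennreal (2 * sqrt t)"
    using t nn_integral_powr_neg_half[of t] by (subst nn_integral_cmult) auto
  also have "\<dots> = ennreal (?c * (2 * sqrt t))"
    using c t by (intro ennreal_mult[symmetric]) auto
  also have "?c * (2 * sqrt t) = 4 * (sqrt t * sqrt t) * profile \<epsilon> t"
    by simp
  finally show ?thesis
    using t by simp
qed

lemma profile_set_integrable:
  assumes "A \<in> sets lborel" "A \<subseteq> {0<..1}"
  shows "set_integrable lborel A (profile \<epsilon>)"
proof -
  have "set_integrable lborel {0<..1} (profile \<epsilon>)"
    unfolding set_integrable_def
  proof (rule integrableI_bounded)
    have "(\<integral>\<^sup>+s. ennreal (norm (indicator {0<..1} s *\<^sub>R profile \<epsilon> s)) \<partial>lborel)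
        = (\<integral>\<^sup>+s\<in>{0<..1}. ennreal (profile \<epsilon> s) \<partial>lborel)"
      using profile_ge_1[OF eps] by (intro nn_integral_cong) (force simp: indicator_def)
    also have "\<dots> < \<infinity>"
      using nn_integral_profile_le[of 1] by (auto intro: le_less_trans)
    finally show "(\<integral>\<^sup>+s. ennreal (norm (indicator {0<..1} s *\<^sub>R profile \<epsilon> s)) \<partial>lborel) < \<infinity>" .
  qed measurable
  then show ?thesis
    using assms by (rule set_integrable_subset)
qed

lemma profile_integral_diff:
  assumes "0 \<le> s" "s \<le> t" "t \<le> 1"
  shows "profile_integral \<epsilon> t - profile_integral \<epsilon> s = (LINT r:{s<..t}|lborel. profile \<epsilon> r)"
proof -
  have "{0<..t} = {0<..s} \<union> {s<..t}"
    using assms by auto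
  then have "profile_integral \<epsilon> t = profile_integral \<epsilon> s + (LINT r:{s<..t}|lborel. profile \<epsilon> r)"
    unfolding profile_integral_def using assms
    by (auto intro!: set_integral_Un profile_set_integrable)
  then show ?thesis by simp
qed

lemma profile_integral_diff_ge:
  assumes "0 \<le> s" "s \<le> t" "t \<le> 1"
  shows "profile \<epsilon> t * (t - s) \<le> profile_integral \<epsilon> t - profile_integral \<epsilon> s"
proof -
  have "(LINT r:{s<..t}|lborel. profile \<epsilon> t) \<le> (LINT r:{s<..t}|lborel. profile \<epsilon> r)"
    using assms by (intro set_integral_mono set_integrable_const_interval profile_set_integrable profile_antimono[OF eps]) auto
  moreover have "(LINT r:{s<..t}|lborel. profile \<epsilon> t) = (t - s) * profile \<epsilon> t"
    using assms by (subst set_integral_const) auto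
  ultimately show ?thesis
    using profile_integral_diff[OF assms] by (simp add: mult.commute)
qed

lemma profile_integral_diff_le:
  assumes "0 < s" "s \<le> t" "t \<le> 1"
  shows "profile_integral \<epsilon> t - profile_integral \<epsilon> s \<le> profile \<epsilon> s * (t - s)"
proof -
  have "(LINT r:{s<..t}|lborel. profile \<epsilon> r) \<le> (LINT r:{s<..t}|lborel. profile \<epsilon> s)"
    using assms by (intro set_integral_mono set_integrable_const_interval profile_set_integrable profile_antimono[OF eps]) auto
  moreover have "(LINT r:{s<..t}|lborel. profile \<epsilon> s) = (t - s) * profile \<epsilon> s"
    using assms by (subst set_integral_const) auto
  ultimately show ?thesis
    using profile_integral_diff[of s t] assms by (simp add: mult.commute)
qed

lemma profile_integral_ge: "0 < t \<Longrightarrow> t \<le> 1 \<Longrightarrow> t * profile \<epsilon> t \<le> profile_integral \<epsilon> t"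
  using profile_integral_diff_ge[of 0 t] by (simp add: mult.commute)

text \<open>
  The factor \<open>1\<close> is the slope of the line below \<open>\<psi>\<close> that the results on general weights ask for.
\<close>

lemma profile_integral_ge_id: "0 < t \<Longrightarrow> t \<le> 1 \<Longrightarrow> 1 * t \<le> profile_integral \<epsilon> t"
  using profile_integral_ge[of t] profile_ge_1[OF eps, of t] mult_left_mono[of 1 "profile \<epsilon> t" t] by linarith

lemma ennreal_profile_integral:
  assumes "0 \<le> t" "t \<le> 1"
  shows "ennreal (profile_integral \<epsilon> t) = (\<integral>\<^sup>+s\<in>{0<..t}. ennreal (profile \<epsilon> s) \<partial>lborel)"
proof -
  have nonneg: "0 \<le> indicator {0<..t} s *\<^sub>R profile \<epsilon> s" for s
    using profile_ge_1[OF eps, of s] assms by (auto simp: indicator_def)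
  have "(\<integral>\<^sup>+s\<in>{0<..t}. ennreal (profile \<epsilon> s) \<partial>lborel) = (\<integral>\<^sup>+s. ennreal (indicator {0<..t} s *\<^sub>R profile \<epsilon> s) \<partial>lborel)"
    by (intro nn_integral_cong) (simp add: indicator_def)
  also have "\<dots> = ennreal (profile_integral \<epsilon> t)"
    unfolding profile_integral_def set_lebesgue_integral_def
  proof (rule nn_integral_eq_integral)
    have "{0<..t} \<subseteq> {0<..1}"
      using assms by auto
    then show "integrable lborel (\<lambda>s. indicator {0<..t} s *\<^sub>R profile \<epsilon> s)"
      using profile_set_integrable[of "{0<..t}"] by (simp add: set_integrable_def)
  qed (use nonneg in blast)
  finally show ?thesis ..
qed

lemma profile_integral_le:
  assumes "0 < t" "t \<le> 1"
  shows "profile_integral \<epsilon> t \<le> 4 * t * profile \<epsilon> t"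
proof -
  have "ennreal (profile_integral \<epsilon> t) \<le> ennreal (4 * t * profile \<epsilon> t)"
    using ennreal_profile_integral[of t] nn_integral_profile_le[OF assms] assms by simp
  moreover have "0 \<le> 4 * t * profile \<epsilon> t"
    using profile_ge_1[OF eps assms] assms by simp
  ultimately show ?thesis
    by (simp only: ennreal_le_iff)
qed

lemma profile_integral_strict_mono: "strict_mono_on {0..1} (profile_integral \<epsilon>)"
proof (rule strict_mono_onI)
  fix s t :: real assume "s \<in> {0..1}" "t \<in> {0..1}" "s < t"
  moreover from this have "0 < profile \<epsilon> t * (t - s)"
    using profile_ge_1[OF eps, of t] by simp
  ultimately show "profile_integral \<epsilon> s < profile_integral \<epsilon> t"
    using profile_integral_diff_ge[of s t] by simp
qed

text \<open>
  The derivative of the integral is the decreasing function \<open>profile \<epsilon>\<close>, whose values are therefore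
  slopes of supporting lines; lying below all these lines is concavity.
\<close>

lemma profile_integral_le_tangent:
  assumes "0 < s" "s \<le> 1" "0 \<le> t" "t \<le> 1"
  shows "profile_integral \<epsilon> t \<le> profile_integral \<epsilon> s + profile \<epsilon> s * (t - s)"
proof (cases "s \<le> t")
  case True
  then show ?thesis
    using profile_integral_diff_le[of s t] assms by simp
next
  case False
  then show ?thesis
    using profile_integral_diff_ge[of t s] assms by (simp add: algebra_simps)
qed

lemma profile_integral_concave: "concave_on {0..1} (profile_integral \<epsilon>)"
  unfolding concave_on_iff
proof (intro conjI ballI allI impI)
  fix x y u v :: real
  assume xy: "x \<in> {0..1}" "y \<in> {0..1}" and uv: "0 \<le> u" "0 \<le> v" "u + v = 1"
  let ?z = "u * x + v * y"
  have z: "0 \<le> ?z" "?z \<le> 1"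
    using xy uv convex_bound_le[of x 1 y u v] by auto
  show "u * profile_integral \<epsilon> x + v * profile_integral \<epsilon> y \<le> profile_integral \<epsilon> (u *\<^sub>R x + v *\<^sub>R y)"
  proof (cases "?z = 0")
    case True
    moreover have "0 \<le> u * x" "0 \<le> v * y"
      using xy uv by auto
    ultimately have "u * x = 0" "v * y = 0"
      by linarith+
    \<comment> \<open>Here there is no supporting line, but each summand has a vanishing weight or sits at the origin.\<close>
    then have "u * profile_integral \<epsilon> x = 0" "v * profile_integral \<epsilon> y = 0"
      by auto
    then show ?thesis
      using True by (simp only: real_scaleR_def profile_integral_0)
  next
    case False
    then have "0 < ?z"
      using z by simp
    then have "u * profile_integral \<epsilon> x + v * profile_integral \<epsilon> y
        \<le> u * (profile_integral \<epsilon> ?z + profile \<epsilon> ?z * (x - ?z)) + v * (profile_integral \<epsilon> ?z + profile \<epsilon> ?z * (y - ?z))"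
      using xy uv z by (intro add_mono mult_left_mono profile_integral_le_tangent) auto
    also have "\<dots> = (u + v) * profile_integral \<epsilon> ?z + profile \<epsilon> ?z * (?z - (u + v) * ?z)"
      by (simp add: algebra_simps)
    also have "\<dots> = profile_integral \<epsilon> ?z"
      using uv by simp
    finally show ?thesis by simp
  qed
qed auto

lemmas ri_space_profile_integral = ri_space_marcinkiewicz[OF zero_less_one profile_integral_ge_id]

lemma rearrangement_le_of_mem:
  assumes x: "x \<in> marcinkiewicz (profile_integral \<epsilon>)"
  obtains C where "0 \<le> C" "\<And>t. 0 < t \<Longrightarrow> t \<le> 1 \<Longrightarrow> rearrangement x t \<le> C * profile \<epsilon> t"
proof -
  let ?N = "marcinkiewicz_norm (profile_integral \<epsilon>) x"
  have N: "marcinkiewicz_enorm (profile_integral \<epsilon>) x = ennreal ?N" "0 \<le> ?N"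
    using x by (simp_all add: marcinkiewicz_def marcinkiewicz_norm_def)
  have xm: "x \<in> borel_measurable mes"
    using x by (simp add: marcinkiewicz_def)
  have "rearrangement x t \<le> (4 * ?N) * profile \<epsilon> t" if t: "0 < t" "t \<le> 1" for t
  proof -
    have pos: "0 < profile_integral \<epsilon> t"
      using profile_integral_ge_id[OF t] t by simp
    have "ennreal (t * rearrangement x t) = (\<integral>\<^sup>+s\<in>{0<..t}. ennreal (rearrangement x t) \<partial>lborel)"
      using t rearrangement_nonneg[OF xm t(1)]
      by (simp add: nn_integral_cmult_indicator ennreal_mult mult.commute)
    also have "\<dots> \<le> (\<integral>\<^sup>+s\<in>{0<..t}. ennreal (rearrangement x s) \<partial>lborel)"
      using rearrangement_antimono[OF xm]
      by (intro nn_integral_mono) (auto simp: indicator_def intro!: ennreal_leI)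
    also have "\<dots> \<le> ennreal (profile_integral \<epsilon> t) * ennreal ?N"
      unfolding N(1)[symmetric] ennreal_divide_le_iff_mult[OF pos, symmetric] marcinkiewicz_enorm_def
      using t by (intro SUP_upper) auto
    also have "\<dots> = ennreal (profile_integral \<epsilon> t * ?N)"
      using pos N by (intro ennreal_mult[symmetric]) auto
    finally have "t * rearrangement x t \<le> profile_integral \<epsilon> t * ?N"
      using pos N by (subst (asm) ennreal_le_iff) auto
    also have "\<dots> \<le> (4 * t * profile \<epsilon> t) * ?N"
      using profile_integral_le[OF t] N by (intro mult_right_mono) auto
    finally have "t * rearrangement x t \<le> t * ((4 * ?N) * profile \<epsilon> t)"
      by (simp add: mult_ac)
    then show ?thesis
      using t by simp
  qed
  then show ?thesis
    using that[of "4 * ?N"] N(2) by auto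
qed

lemma mem_of_rearrangement_le:
  assumes x: "x \<in> borel_measurable mes"
    and C: "0 \<le> C" "\<And>t. 0 < t \<Longrightarrow> t \<le> 1 \<Longrightarrow> rearrangement x t \<le> C * profile \<epsilon> t"
  shows "x \<in> marcinkiewicz (profile_integral \<epsilon>)"
proof -
  have "marcinkiewicz_enorm (profile_integral \<epsilon>) x \<le> ennreal C"
    unfolding marcinkiewicz_enorm_def
  proof (rule SUP_least)
    fix t :: real assume "t \<in> {0<..1}"
    then have t: "0 < t" "t \<le> 1" by auto
    have pos: "0 < profile_integral \<epsilon> t"
      using profile_integral_ge_id[OF t] t by simp
    have "(\<integral>\<^sup>+s\<in>{0<..t}. ennreal (rearrangement x s) \<partial>lborel)
        \<le> (\<integral>\<^sup>+s. ennreal C * (ennreal (profile \<epsilon> s) * indicator {0<..t} s) \<partial>lborel)"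
    proof (rule nn_integral_mono)
      fix s
      show "ennreal (rearrangement x s) * indicator {0<..t} s \<le> ennreal C * (ennreal (profile \<epsilon> s) * indicator {0<..t} s)"
        using C(2)[of s] C(1) t profile_ge_1[OF eps, of s]
        by (auto simp: indicator_def ennreal_mult[symmetric] intro!: ennreal_leI)
    qed
    also have "\<dots> = ennreal C * ennreal (profile_integral \<epsilon> t)"
      using t by (subst nn_integral_cmult) (auto simp: ennreal_profile_integral)
    finally show "(\<integral>\<^sup>+s\<in>{0<..t}. ennreal (rearrangement x s) \<partial>lborel) / ennreal (profile_integral \<epsilon> t) \<le> ennreal C"
      by (subst ennreal_divide_le_iff_mult[OF pos]) (simp add: mult.commute)
  qed
  then show ?thesis
    using x by (auto simp: marcinkiewicz_def intro: le_less_trans)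
qed

text \<open>
  Inverting the inequality between rearrangement and profile. Strict and weak inequalities are
  exchanged by enlarging \<open>C\<close>: by \<open>1\<close> in one direction, and in the other by the factor \<open>2\<close> that a shift of
  \<open>u\<close> by \<open>1\<close> costs.
\<close>

lemma mem_iff_tail:
  assumes x: "x \<in> borel_measurable mes"
  shows "x \<in> marcinkiewicz (profile_integral \<epsilon>) \<longleftrightarrow> (\<exists>C>0. \<forall>u\<ge>0. dist_fun x (C * growth \<epsilon> u) \<le> exp (- u))"
proof
  assume "x \<in> marcinkiewicz (profile_integral \<epsilon>)"
  then obtain C where C: "0 \<le> C" "\<And>t. 0 < t \<Longrightarrow> t \<le> 1 \<Longrightarrow> rearrangement x t \<le> C * profile \<epsilon> t"
    using rearrangement_le_of_mem by blast
  have "dist_fun x ((C + 1) * growth \<epsilon> u) \<le> exp (- u)" if "0 \<le> u" for u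
  proof -
    have "rearrangement x (exp (- u)) \<le> C * growth \<epsilon> u"
      using C(2)[of "exp (- u)"] that by (simp add: profile_def)
    also have "\<dots> < (C + 1) * growth \<epsilon> u"
      using growth_ge_1[OF eps that] by (simp add: algebra_simps)
    finally show ?thesis
      using dist_fun_less_of_rearrangement_less[OF x, of "exp (- u)"] by (simp add: less_imp_le)
  qed
  then show "\<exists>C>0. \<forall>u\<ge>0. dist_fun x (C * growth \<epsilon> u) \<le> exp (- u)"
    using C(1) by (intro exI[of _ "C + 1"]) auto
next
  assume "\<exists>C>0. \<forall>u\<ge>0. dist_fun x (C * growth \<epsilon> u) \<le> exp (- u)"
  then obtain C where C: "0 < C" "\<And>u. 0 \<le> u \<Longrightarrow> dist_fun x (C * growth \<epsilon> u) \<le> exp (- u)"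
    by auto
  show "x \<in> marcinkiewicz (profile_integral \<epsilon>)"
  proof (rule mem_of_rearrangement_le[OF x, of "2 * C"])
    fix t :: real assume t: "0 < t" "t \<le> 1"
    let ?u = "- ln t"
    have u: "0 \<le> ?u"
      using t by simp
    have "dist_fun x (C * growth \<epsilon> (?u + 1)) \<le> exp (- (?u + 1))"
      using u by (intro C) auto
    also have "\<dots> < exp (- ?u)"
      by simp
    also have "\<dots> = t"
      using t by simp
    finally have "rearrangement x t \<le> C * growth \<epsilon> (?u + 1)"
      using u C(1) growth_ge_1[OF eps, of "?u + 1"] by (intro rearrangement_le[OF x]) auto
    also have "\<dots> \<le> C * ((1 + 1) * growth \<epsilon> ?u)"
      using u C(1) by (intro mult_left_mono growth_add_le[OF eps]) auto
    finally show "rearrangement x t \<le> 2 * C * profile \<epsilon> t"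
      by (simp add: profile_def)
  qed (use C in auto)
qed

text \<open>
  Put \<open>t = exp (- u)\<close>. If \<open>l * C * log_series \<epsilon> u0 \<le> 1 / 2\<close>, then \<open>l * C * growth \<epsilon> u\<close> is at most
  \<open>(1 + max u0 u) / 2\<close>, so the exponential of \<open>l\<close> times the rearrangement is bounded by a multiple of
  \<open>exp (u0 / 2) + t powr (-1/2)\<close>, which is integrable.
\<close>

lemma exp_moment_le:
  assumes x[measurable]: "x \<in> borel_measurable mes"
    and C: "0 \<le> C" "\<And>t. 0 < t \<Longrightarrow> t \<le> 1 \<Longrightarrow> rearrangement x t \<le> C * profile \<epsilon> t"
    and u0: "0 \<le> u0" "0 \<le> l" "l * C * log_series \<epsilon> u0 \<le> 1 / 2"
  shows "(\<integral>\<^sup>+t. ennreal (exp (l * \<bar>x t\<bar>)) \<partial>mes) \<le> ennreal (6 * exp (u0 / 2))"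
proof -
  note [measurable] = measurable_rearrangement[OF x]
  have "(\<integral>\<^sup>+t. ennreal (exp (l * \<bar>x t\<bar>)) \<partial>mes) = (\<integral>\<^sup>+t. ennreal (exp (l * \<bar>rearrangement x t\<bar>)) \<partial>mes)"
    by (intro equimeasurable_nn_integral[where \<phi> = "\<lambda>v. ennreal (exp (l * v))", symmetric]
        equimeasurable_rearrangement[OF x]) measurable
  also have "\<dots> \<le> (\<integral>\<^sup>+t. ennreal (2 * exp (u0 / 2)) + ennreal 2 * ennreal (t powr (-1/2)) \<partial>mes)"
  proof (rule nn_integral_mono_AE)
    have "AE t in mes. 0 < t \<and> t \<le> 1"
      using AE_mes_pos AE_space by eventually_elim (simp add: space_mes)
    then show "AE t in mes. ennreal (exp (l * \<bar>rearrangement x t\<bar>))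
        \<le> ennreal (2 * exp (u0 / 2)) + ennreal 2 * ennreal (t powr (-1/2))"
    proof eventually_elim
      case (elim t)
      let ?u = "- ln t"
      have u: "0 \<le> ?u"
        using elim by simp
      have "l * \<bar>rearrangement x t\<bar> \<le> l * (C * growth \<epsilon> ?u)"
        using C(2)[of t] elim rearrangement_nonneg[OF x, of t] u0
        by (intro mult_left_mono) (auto simp: profile_def)
      also have "\<dots> \<le> (1 + max u0 ?u) / 2"
      proof -
        have "l * (C * growth \<epsilon> ?u) \<le> l * (C * growth \<epsilon> (max u0 ?u))"
          using u u0 C(1) by (intro mult_left_mono growth_mono[OF eps]) auto
        also have "\<dots> = (1 + max u0 ?u) * (l * C * log_series \<epsilon> (max u0 ?u))"
          by (simp add: growth_def mult_ac)
        also have "\<dots> \<le> (1 + max u0 ?u) * (l * C * log_series \<epsilon> u0)"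
          using u u0 C(1) by (intro mult_left_mono log_series_antimono[OF eps]) auto
        also have "\<dots> \<le> (1 + max u0 ?u) * (1 / 2)"
          using u0 by (intro mult_left_mono) auto
        finally show ?thesis by simp
      qed
      finally have "exp (l * \<bar>rearrangement x t\<bar>) \<le> exp ((1 + max u0 ?u) / 2)"
        by simp
      also have "\<dots> = exp (1 / 2) * exp (max u0 ?u / 2)"
        by (simp only: add_divide_distrib exp_add)
      also have "\<dots> \<le> 2 * (exp (u0 / 2) + exp (?u / 2))"
        using exp_half_le2 by (intro mult_mono) (auto simp: max_def)
      also have "exp (?u / 2) = t powr (-1/2)"
        using elim by (simp add: powr_def)
      finally have "ennreal (exp (l * \<bar>rearrangement x t\<bar>)) \<le> ennreal (2 * exp (u0 / 2) + 2 * t powr (-1/2))"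
        by (intro ennreal_leI) (simp add: algebra_simps)
      also have "\<dots> = ennreal (2 * exp (u0 / 2)) + ennreal 2 * ennreal (t powr (-1/2))"
        by (subst ennreal_plus) (auto simp: ennreal_mult)
      finally show ?case .
    qed
  qed
  also have "\<dots> = ennreal (2 * exp (u0 / 2)) + ennreal 2 * (\<integral>\<^sup>+t. ennreal (t powr (-1/2)) \<partial>mes)"
  proof -
    have "(\<lambda>t. t powr (-1/2)) \<in> borel_measurable mes"
      by (intro measurable_restrict_space1 measurable_completion) simp
    then have m: "(\<lambda>t. ennreal (t powr (-1/2))) \<in> borel_measurable mes"
      by (rule measurable_compose[OF _ measurable_ennreal])
    then have "(\<integral>\<^sup>+t. ennreal 2 * ennreal (t powr (-1/2)) \<partial>mes) = ennreal 2 * (\<integral>\<^sup>+t. ennreal (t powr (-1/2)) \<partial>mes)"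
      by (rule nn_integral_cmult)
    moreover have "(\<integral>\<^sup>+t. ennreal (2 * exp (u0 / 2)) + ennreal 2 * ennreal (t powr (-1/2)) \<partial>mes)
        = (\<integral>\<^sup>+t. ennreal (2 * exp (u0 / 2)) \<partial>mes) + (\<integral>\<^sup>+t. ennreal 2 * ennreal (t powr (-1/2)) \<partial>mes)"
      by (rule nn_integral_add[OF _ borel_measurable_times_ennreal[OF _ m]]) simp_all
    ultimately show ?thesis
      by (simp only: nn_integral_const mes.emeasure_space_1 mult_1_right)
  qed
  also have "(\<integral>\<^sup>+t. ennreal (t powr (-1/2)) \<partial>mes) = ennreal 2"
    using nn_integral_powr_neg_half[of 1] by (simp add: nn_integral_mes)
  also have "ennreal (2 * exp (u0 / 2)) + ennreal 2 * ennreal 2 = ennreal (2 * exp (u0 / 2) + 4)"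
    by (simp add: ennreal_mult[symmetric] ennreal_plus[symmetric] del: ennreal_plus ennreal_numeral)
  also have "\<dots> \<le> ennreal (6 * exp (u0 / 2))"
    using u0 by (intro ennreal_leI) simp
  finally show ?thesis .
qed

text \<open>
  As \<open>log_series \<epsilon>\<close> tends to \<open>0\<close>, the preceding bound applies to every \<open>l\<close> once \<open>u0\<close> is large.
\<close>

lemma exp_moment_finite:
  assumes x: "x \<in> marcinkiewicz (profile_integral \<epsilon>)"
  shows "(\<integral>\<^sup>+t. ennreal (exp (l * \<bar>x t\<bar>)) \<partial>mes) < \<infinity>"
proof -
  obtain C where C: "0 \<le> C" "\<And>t. 0 < t \<Longrightarrow> t \<le> 1 \<Longrightarrow> rearrangement x t \<le> C * profile \<epsilon> t"
    using rearrangement_le_of_mem[OF x] by blast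
  let ?l = "\<bar>l\<bar>"
  have "((\<lambda>u. ?l * C * log_series \<epsilon> u) \<longlongrightarrow> ?l * C * 0) at_top"
    by (intro tendsto_mult tendsto_const log_series_tendsto_0 eps)
  then have "\<forall>\<^sub>F u in at_top. ?l * C * log_series \<epsilon> u < 1 / 2"
    by (intro order_tendstoD(2)) auto
  with eventually_ge_at_top[of 0] have "\<forall>\<^sub>F u in at_top. 0 \<le> u \<and> ?l * C * log_series \<epsilon> u < 1 / 2"
    by eventually_elim simp
  then obtain u0 where u0: "0 \<le> u0" "?l * C * log_series \<epsilon> u0 < 1 / 2"
    by (auto simp: eventually_at_top_linorder)
  have "(\<integral>\<^sup>+t. ennreal (exp (l * \<bar>x t\<bar>)) \<partial>mes) \<le> (\<integral>\<^sup>+t. ennreal (exp (?l * \<bar>x t\<bar>)) \<partial>mes)"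
    by (intro nn_integral_mono ennreal_leI) (simp add: mult_right_mono)
  also have "\<dots> \<le> ennreal (6 * exp (u0 / 2))"
    using x C u0 by (intro exp_moment_le[where C = C]) (auto simp: marcinkiewicz_def)
  also have "\<dots> < \<infinity>"
    by simp
  finally show ?thesis .
qed

text \<open>
  The profile essentially is its own rearrangement; passing from \<open>t\<close> to \<open>t / 2\<close>, at the cost of a factor \<open>2\<close>,
  provides the strict inequality that the definition of the rearrangement asks for.
\<close>

lemma profile_mem: "profile \<epsilon> \<in> marcinkiewicz (profile_integral \<epsilon>)"
proof (rule mem_of_rearrangement_le[of _ 2])
  show m: "profile \<epsilon> \<in> borel_measurable mes"
    by (intro measurable_restrict_space1 measurable_completion) simp
  fix t :: real assume t: "0 < t" "t \<le> 1"
  have "{s \<in> space mes. profile \<epsilon> (t/2) < \<bar>profile \<epsilon> s\<bar>} \<subseteq> {0..t/2}"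
  proof safe
    fix s assume s: "s \<in> space mes" "profile \<epsilon> (t/2) < \<bar>profile \<epsilon> s\<bar>"
    show "s \<in> {0..t/2}"
    proof (rule ccontr)
      assume "s \<notin> {0..t/2}"
      then have "t/2 < s" "s \<le> 1"
        using s by (auto simp: space_mes)
      then show False
        using profile_antimono[OF eps, of "t/2" s] profile_ge_1[OF eps, of s] s t by auto
    qed
  qed
  then have "dist_fun (profile \<epsilon>) (profile \<epsilon> (t/2)) \<le> measure mes {0..t/2}"
    unfolding dist_fun_def using t by (intro mes.finite_measure_mono) (auto simp: sets_restrict_space_iff)
  also have "\<dots> = t / 2"
    using t by (subst measure_def, subst emeasure_mes) auto
  also have "\<dots> < t"
    using t by simp
  finally have "rearrangement (profile \<epsilon>) t \<le> profile \<epsilon> (t/2)"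
    using t profile_ge_1[OF eps, of "t/2"] by (intro rearrangement_le[OF m]) auto
  also have "\<dots> \<le> (1 + ln 2) * profile \<epsilon> t"
    using growth_add_le[OF eps, of "- ln t" "ln 2"] t by (simp add: profile_def ln_div)
  also have "\<dots> \<le> 2 * profile \<epsilon> t"
    using ln_2_less_1 profile_ge_1[OF eps t] by (intro mult_right_mono) auto
  finally show "rearrangement (profile \<epsilon>) t \<le> 2 * profile \<epsilon> t" .
qed auto

end

lemma profile_mono_eps:
  assumes "0 < \<epsilon>" "\<epsilon> \<le> \<delta>" "\<delta> < 1" "0 < t" "t \<le> 1"
  shows "profile \<epsilon> t \<le> profile \<delta> t"
  unfolding profile_def using assms by (intro growth_mono_eps) auto

lemma marcinkiewicz_profile_integral_mono:
  assumes "0 < \<epsilon>" "\<epsilon> \<le> \<delta>" "\<delta> < 1"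
  shows "marcinkiewicz (profile_integral \<epsilon>) \<subseteq> marcinkiewicz (profile_integral \<delta>)"
proof
  fix x assume x: "x \<in> marcinkiewicz (profile_integral \<epsilon>)"
  have eps: "0 < \<epsilon>" "\<epsilon> < 1"
    using assms by auto
  obtain C where C: "0 \<le> C" "\<And>t. 0 < t \<Longrightarrow> t \<le> 1 \<Longrightarrow> rearrangement x t \<le> C * profile \<epsilon> t"
    using rearrangement_le_of_mem[OF eps x] by blast
  show "x \<in> marcinkiewicz (profile_integral \<delta>)"
  proof (rule mem_of_rearrangement_le[of \<delta>])
    fix t :: real assume t: "0 < t" "t \<le> 1"
    have "rearrangement x t \<le> C * profile \<epsilon> t"
      using C t by auto
    also have "\<dots> \<le> C * profile \<delta> t"
      using C t assms by (intro mult_left_mono profile_mono_eps) auto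
    finally show "rearrangement x t \<le> C * profile \<delta> t" .
  qed (use assms C x in \<open>auto simp: marcinkiewicz_def\<close>)
qed

lemma profile_integral_ratio_tendsto_0:
  assumes "0 < \<epsilon>" "\<epsilon> < \<delta>" "\<delta> < 1"
  shows "((\<lambda>t. profile_integral \<epsilon> t / profile_integral \<delta> t) \<longlongrightarrow> 0) (at_right 0)"
proof -
  have "((\<lambda>t. 4 * (profile \<epsilon> t / profile \<delta> t)) \<longlongrightarrow> 4 * 0) (at_right 0)"
    by (intro tendsto_mult tendsto_const profile_ratio_tendsto_0 assms)
  then have lim: "((\<lambda>t. 4 * (profile \<epsilon> t / profile \<delta> t)) \<longlongrightarrow> 0) (at_right 0)"
    by simp
  have ev: "\<forall>\<^sub>F t::real in at_right 0. 0 < t \<and> t < 1"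
    by (auto simp: eventually_at_right[of 0 1] intro!: exI[of _ 1])
  have pos: "0 < profile_integral \<eta> t" if "0 < t \<and> t < 1" "0 < \<eta>" "\<eta> < 1" for t \<eta>
    using profile_integral_ge_id[of \<eta> t] that by simp
  show ?thesis
  proof (rule tendsto_sandwich[OF _ _ tendsto_const lim])
    show "\<forall>\<^sub>F t in at_right 0. 0 \<le> profile_integral \<epsilon> t / profile_integral \<delta> t"
      using ev by eventually_elim (use pos assms in \<open>auto intro!: divide_nonneg_nonneg less_imp_le\<close>)
    show "\<forall>\<^sub>F t in at_right 0. profile_integral \<epsilon> t / profile_integral \<delta> t \<le> 4 * (profile \<epsilon> t / profile \<delta> t)"
      using ev
    proof eventually_elim
      case (elim t)
      have "profile_integral \<epsilon> t / profile_integral \<delta> t \<le> (4 * t * profile \<epsilon> t) / (t * profile \<delta> t)"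
        using elim assms pos[of t \<epsilon>] profile_ge_1[of \<delta> t] profile_ge_1[of \<epsilon> t]
        by (intro frac_le profile_integral_le profile_integral_ge) auto
      also have "\<dots> = 4 * (profile \<epsilon> t / profile \<delta> t)"
        using elim by simp
      finally show ?case .
    qed
  qed
qed

lemma profile_not_mem:
  assumes "0 < \<epsilon>" "\<epsilon> < \<delta>" "\<delta> < 1"
  shows "profile \<delta> \<notin> marcinkiewicz (profile_integral \<epsilon>)"
proof
  assume mem: "profile \<delta> \<in> marcinkiewicz (profile_integral \<epsilon>)"
  then have m[measurable]: "profile \<delta> \<in> borel_measurable mes"
    by (simp add: marcinkiewicz_def)
  have eps: "0 < \<epsilon>" "\<epsilon> < 1"
    using assms by auto
  obtain C where C: "0 \<le> C" "\<And>t. 0 < t \<Longrightarrow> t \<le> 1 \<Longrightarrow> rearrangement (profile \<delta>) t \<le> C * profile \<epsilon> t"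
    using rearrangement_le_of_mem[OF eps mem] by blast
  have "\<forall>\<^sub>F t in at_right 0. profile \<epsilon> t / profile \<delta> t < 1 / (2 * C + 1)"
    using C(1) by (intro order_tendstoD(2)[OF profile_ratio_tendsto_0[OF assms]]) auto
  moreover have "\<forall>\<^sub>F t::real in at_right 0. 0 < t \<and> t < 1"
    by (auto simp: eventually_at_right[of 0 1] intro!: exI[of _ 1])
  ultimately have "\<forall>\<^sub>F t in at_right (0::real). False"
  proof eventually_elim
    case (elim t)
    have p: "1 \<le> profile \<delta> t" "1 \<le> profile \<epsilon> t"
      using elim assms by (auto intro!: profile_ge_1)
    have "profile \<delta> t \<le> rearrangement (profile \<delta>) (t/2)"
    proof (rule ccontr)
      assume "\<not> ?thesis"
      then obtain a where a: "rearrangement (profile \<delta>) (t/2) < a" "a < profile \<delta> t"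
        using dense[of "rearrangement (profile \<delta>) (t/2)" "profile \<delta> t"] by auto
      have "{0<..t} \<subseteq> {s \<in> space mes. a < \<bar>profile \<delta> s\<bar>}"
        using profile_antimono[of \<delta> _ t] assms elim a(2) by (force simp: space_mes)
      then have "measure mes {0<..t} \<le> dist_fun (profile \<delta>) a"
        unfolding dist_fun_def by (intro mes.finite_measure_mono) measurable
      moreover have "measure mes {0<..t} = t"
        using elim by (subst measure_def, subst emeasure_mes) auto
      ultimately show False
        using dist_fun_less_of_rearrangement_less[OF m _ a(1)] elim by simp
    qed
    also have "\<dots> \<le> C * profile \<epsilon> (t/2)"
      using elim by (intro C) auto
    also have "\<dots> \<le> C * ((1 + ln 2) * profile \<epsilon> t)"
      using growth_add_le[of \<epsilon> "- ln t" "ln 2"] assms elim C(1)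
      by (intro mult_left_mono) (auto simp: profile_def ln_div)
    also have "\<dots> \<le> C * (2 * profile \<epsilon> t)"
      using ln_2_less_1 p C(1) by (intro mult_left_mono mult_right_mono) auto
    finally have "profile \<delta> t \<le> 2 * C * profile \<epsilon> t"
      by simp
    moreover have "(2 * C + 1) * profile \<epsilon> t < profile \<delta> t"
      using elim(1) p C(1) by (simp add: field_simps)
    ultimately show False
      using p by (simp add: algebra_simps)
  qed
  then show False
    by simp
qed

section \<open>Compound Poisson laws\<close>

abbreviation "mes_seq \<equiv> \<Pi>\<^sub>M i\<in>(UNIV :: nat set). mes"

interpretation mes_seq: product_prob_space "\<lambda>i::nat. mes" UNIV
  by unfold_locales

lemma measurable_random_sum:
  fixes f :: "real \<Rightarrow> real"
  assumes [measurable]: "f \<in> borel_measurable mes"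
  shows "(\<lambda>(n, \<omega>). \<Sum>i<n. f (\<omega> i)) \<in> borel_measurable (measure_pmf (poisson_pmf 1) \<Otimes>\<^sub>M mes_seq)"
proof -
  have "(\<lambda>(n, \<omega>). \<Sum>i<n. f (\<omega> i)) \<in> borel_measurable (count_space (UNIV :: nat set) \<Otimes>\<^sub>M mes_seq)"
  proof (rule measurable_pair_measure_countable1)
    fix n
    have "(\<lambda>\<omega>. \<Sum>i<n. f (\<omega> i)) \<in> borel_measurable mes_seq"
      by measurable
    then show "(\<lambda>\<omega>. case (n, \<omega>) of (n, \<omega>) \<Rightarrow> \<Sum>i<n. f (\<omega> i)) \<in> borel_measurable mes_seq"
      by simp
  qed simp
  moreover have "sets (measure_pmf (poisson_pmf 1) \<Otimes>\<^sub>M mes_seq) = sets (count_space (UNIV :: nat set) \<Otimes>\<^sub>M mes_seq)"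
    by (intro sets_pair_measure_cong) auto
  ultimately show ?thesis
    by (simp cong: measurable_cong_sets)
qed

lemma real_distribution_kruglov_law:
  assumes "f \<in> borel_measurable mes"
  shows "real_distribution (kruglov_law f)"
proof -
  interpret N: prob_space "measure_pmf (poisson_pmf 1)"
    by (rule prob_space_measure_pmf)
  interpret pair_prob_space "measure_pmf (poisson_pmf 1)" mes_seq ..
  show ?thesis
    unfolding kruglov_law_def using measurable_random_sum[OF assms] by (rule real_distribution_distr)
qed

text \<open>
  Condition on the Poisson variable.
\<close>

lemma nn_integral_kruglov_law:
  assumes f[measurable]: "f \<in> borel_measurable mes" and h[measurable]: "h \<in> borel_measurable borel"
  shows "(\<integral>\<^sup>+s. h s \<partial>kruglov_law f)
    = (\<Sum>n. ennreal (pmf (poisson_pmf 1) n) * (\<integral>\<^sup>+\<omega>. h (\<Sum>i<n. f (\<omega> i)) \<partial>mes_seq))"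
proof -
  note m = measurable_random_sum[OF f]
  have "(\<integral>\<^sup>+s. h s \<partial>kruglov_law f)
      = (\<integral>\<^sup>+z. h (case z of (n, \<omega>) \<Rightarrow> \<Sum>i<n. f (\<omega> i)) \<partial>(measure_pmf (poisson_pmf 1) \<Otimes>\<^sub>M mes_seq))"
    unfolding kruglov_law_def using m by (intro nn_integral_distr) auto
  also have "\<dots> = (\<integral>\<^sup>+n. \<integral>\<^sup>+\<omega>. h (\<Sum>i<n. f (\<omega> i)) \<partial>mes_seq \<partial>measure_pmf (poisson_pmf 1))"
    using mes_seq.P.nn_integral_fst[OF measurable_compose[OF m h]] by simp
  also have "\<dots> = (\<integral>\<^sup>+n. ennreal (pmf (poisson_pmf 1) n) * (\<integral>\<^sup>+\<omega>. h (\<Sum>i<n. f (\<omega> i)) \<partial>mes_seq) \<partial>count_space UNIV)"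
    by (rule nn_integral_measure_pmf)
  finally show ?thesis
    by (simp add: nn_integral_count_space_nat)
qed

lemma emeasure_kruglov_law:
  assumes f[measurable]: "f \<in> borel_measurable mes" and B[measurable]: "B \<in> sets borel"
  shows "emeasure (kruglov_law f) B
    = (\<Sum>n. ennreal (pmf (poisson_pmf 1) n) * emeasure mes_seq {\<omega> \<in> space mes_seq. (\<Sum>i<n. f (\<omega> i)) \<in> B})"
proof -
  have *: "(\<integral>\<^sup>+\<omega>. indicator B (\<Sum>i<n. f (\<omega> i)) \<partial>mes_seq)
      = emeasure mes_seq {\<omega> \<in> space mes_seq. (\<Sum>i<n. f (\<omega> i)) \<in> B}" for n
  proof -
    have "(\<integral>\<^sup>+\<omega>. indicator B (\<Sum>i<n. f (\<omega> i)) \<partial>mes_seq)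
        = (\<integral>\<^sup>+\<omega>. indicator {\<omega> \<in> space mes_seq. (\<Sum>i<n. f (\<omega> i)) \<in> B} \<omega> \<partial>mes_seq)"
      by (intro nn_integral_cong) (auto simp: indicator_def)
    also have "\<dots> = emeasure mes_seq {\<omega> \<in> space mes_seq. (\<Sum>i<n. f (\<omega> i)) \<in> B}"
      by (rule nn_integral_indicator) measurable
    finally show ?thesis .
  qed
  have "emeasure (kruglov_law f) B = (\<integral>\<^sup>+s. indicator B s \<partial>kruglov_law f)"
    by (rule nn_integral_indicator[symmetric]) (simp add: kruglov_law_def)
  also have "\<dots> = (\<Sum>n. ennreal (pmf (poisson_pmf 1) n) * (\<integral>\<^sup>+\<omega>. indicator B (\<Sum>i<n. f (\<omega> i)) \<partial>mes_seq))"
    by (rule nn_integral_kruglov_law[OF f]) measurable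
  finally show ?thesis
    by (simp only: *)
qed

text \<open>
  Only finitely many coordinates occur, so the infinite product may be replaced by a finite one.
\<close>

lemma nn_integral_mes_seq_prod:
  assumes h[measurable]: "h \<in> borel_measurable mes"
  shows "(\<integral>\<^sup>+\<omega>. (\<Prod>i<n. h (\<omega> i)) \<partial>mes_seq) = (\<integral>\<^sup>+t. h t \<partial>mes) ^ n"
proof -
  have "(\<integral>\<^sup>+\<omega>. (\<Prod>i<n. h (\<omega> i)) \<partial>(\<Pi>\<^sub>M i\<in>{..<n}. mes))
      = (\<integral>\<^sup>+\<omega>. (\<Prod>i<n. h (\<omega> i)) \<partial>distr mes_seq (\<Pi>\<^sub>M i\<in>{..<n}. mes) (\<lambda>\<omega>. restrict \<omega> {..<n}))"
    by (subst mes_seq.distr_PiM_restrict_finite) auto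
  also have "\<dots> = (\<integral>\<^sup>+\<omega>. (\<Prod>i<n. h (restrict \<omega> {..<n} i)) \<partial>mes_seq)"
    by (intro nn_integral_distr) (auto intro!: measurable_restrict_subset)
  also have "\<dots> = (\<integral>\<^sup>+\<omega>. (\<Prod>i<n. h (\<omega> i)) \<partial>mes_seq)"
    by (intro nn_integral_cong prod.cong) auto
  moreover have "(\<integral>\<^sup>+\<omega>. (\<Prod>i<n. h (\<omega> i)) \<partial>(\<Pi>\<^sub>M i\<in>{..<n}. mes)) = (\<Prod>i<n. \<integral>\<^sup>+t. h t \<partial>mes)"
    by (rule mes_seq.product_nn_integral_prod) auto
  ultimately show ?thesis
    by simp
qed

text \<open>
  By independence the sum of \<open>n\<close> copies has exponential moment at most \<open>m ^ n\<close>, and averaging over the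
  Poisson weights \<open>exp (-1) / fact n\<close> gives \<open>exp (m - 1) \<le> exp m\<close>.
\<close>

lemma kruglov_exp_moment_le:
  assumes f[measurable]: "f \<in> borel_measurable mes" and l: "0 \<le> l" and m: "0 \<le> m"
    and moment: "(\<integral>\<^sup>+t. ennreal (exp (l * \<bar>f t\<bar>)) \<partial>mes) \<le> ennreal m"
  shows "(\<integral>\<^sup>+s. ennreal (exp (l * \<bar>s\<bar>)) \<partial>kruglov_law f) \<le> ennreal (exp m)"
proof -
  have term_le: "(\<integral>\<^sup>+\<omega>. ennreal (exp (l * \<bar>\<Sum>i<n. f (\<omega> i)\<bar>)) \<partial>mes_seq) \<le> ennreal (m ^ n)" for n
  proof -
    have "(\<integral>\<^sup>+\<omega>. ennreal (exp (l * \<bar>\<Sum>i<n. f (\<omega> i)\<bar>)) \<partial>mes_seq)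
        \<le> (\<integral>\<^sup>+\<omega>. (\<Prod>i<n. ennreal (exp (l * \<bar>f (\<omega> i)\<bar>))) \<partial>mes_seq)"
    proof (rule nn_integral_mono)
      fix \<omega>
      have "exp (l * \<bar>\<Sum>i<n. f (\<omega> i)\<bar>) \<le> exp (\<Sum>i<n. l * \<bar>f (\<omega> i)\<bar>)"
        using l by (auto simp: sum_distrib_left[symmetric] intro!: mult_left_mono sum_abs)
      also have "\<dots> = (\<Prod>i<n. exp (l * \<bar>f (\<omega> i)\<bar>))"
        by (simp add: exp_sum)
      finally show "ennreal (exp (l * \<bar>\<Sum>i<n. f (\<omega> i)\<bar>)) \<le> (\<Prod>i<n. ennreal (exp (l * \<bar>f (\<omega> i)\<bar>)))"
        by (simp add: prod_ennreal ennreal_leI)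
    qed
    also have "\<dots> = (\<integral>\<^sup>+t. ennreal (exp (l * \<bar>f t\<bar>)) \<partial>mes) ^ n"
      by (rule nn_integral_mes_seq_prod) measurable
    also have "\<dots> \<le> ennreal m ^ n"
      by (intro power_mono moment) simp
    finally show ?thesis
      using m by (simp add: ennreal_power)
  qed
  have "(\<integral>\<^sup>+s. ennreal (exp (l * \<bar>s\<bar>)) \<partial>kruglov_law f)
      = (\<Sum>n. ennreal (pmf (poisson_pmf 1) n) * (\<integral>\<^sup>+\<omega>. ennreal (exp (l * \<bar>\<Sum>i<n. f (\<omega> i)\<bar>)) \<partial>mes_seq))"
    by (rule nn_integral_kruglov_law[OF f]) measurable
  also have "\<dots> \<le> (\<Sum>n. ennreal (pmf (poisson_pmf 1) n) * ennreal (m ^ n))"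
    by (intro suminf_le mult_left_mono term_le summableI) auto
  also have "\<dots> = (\<Sum>n. ennreal (exp (-1) * (m ^ n /\<^sub>R fact n)))"
    using m by (intro suminf_cong) (simp add: ennreal_mult[symmetric] divide_inverse mult_ac)
  also have "\<dots> = ennreal (exp (-1) * exp m)"
    using m by (intro suminf_ennreal_eq sums_mult exp_converges) auto
  also have "\<dots> \<le> ennreal (exp m)"
    by (intro ennreal_leI) simp
  finally show ?thesis .
qed

context
  fixes f g :: "real \<Rightarrow> real"
  assumes f[measurable]: "f \<in> borel_measurable mes" and g[measurable]: "g \<in> borel_measurable mes"
    and law: "distr mes borel g = kruglov_law f"
begin

lemma dist_fun_kruglov:
  "ennreal (dist_fun g \<tau>) = emeasure (kruglov_law f) {s. \<tau> < \<bar>s\<bar>}"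
proof -
  have "emeasure (kruglov_law f) {s. \<tau> < \<bar>s\<bar>} = emeasure mes (g -` {s. \<tau> < \<bar>s\<bar>} \<inter> space mes)"
    unfolding law[symmetric] by (intro emeasure_distr) measurable
  also have "g -` {s. \<tau> < \<bar>s\<bar>} \<inter> space mes = {t \<in> space mes. \<tau> < \<bar>g t\<bar>}"
    by auto
  finally show ?thesis
    by (simp add: dist_fun_eq_emeasure)
qed

text \<open>
  Chernoff's bound.
\<close>

lemma dist_fun_le_of_exp_moment:
  assumes l: "0 \<le> l" and m: "0 \<le> m"
    and moment: "(\<integral>\<^sup>+t. ennreal (exp (l * \<bar>f t\<bar>)) \<partial>mes) \<le> ennreal m"
  shows "dist_fun g a \<le> exp (m - l * a)"
proof -
  have "ennreal (exp (l * a) * dist_fun g a) = ennreal (exp (l * a)) * emeasure mes {t \<in> space mes. a < \<bar>g t\<bar>}"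
    by (simp add: ennreal_mult dist_fun_eq_emeasure)
  also have "\<dots> = (\<integral>\<^sup>+t. ennreal (exp (l * a)) * indicator {t \<in> space mes. a < \<bar>g t\<bar>} t \<partial>mes)"
    by (rule nn_integral_cmult_indicator[symmetric]) measurable
  also have "\<dots> \<le> (\<integral>\<^sup>+t. ennreal (exp (l * \<bar>g t\<bar>)) \<partial>mes)"
    using l by (intro nn_integral_mono) (auto simp: indicator_def intro!: ennreal_leI mult_left_mono)
  also have "\<dots> = (\<integral>\<^sup>+s. ennreal (exp (l * \<bar>s\<bar>)) \<partial>kruglov_law f)"
    unfolding law[symmetric] by (rule nn_integral_distr[symmetric]) measurable
  also have "\<dots> \<le> ennreal (exp m)"
    by (rule kruglov_exp_moment_le[OF f l m moment])
  finally have "exp (l * a) * dist_fun g a \<le> exp m"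
    by simp
  then show ?thesis
    by (simp add: exp_diff field_simps)
qed

text \<open>
  The event that the Poisson variable equals \<open>1\<close> has probability \<open>exp (-1)\<close>, and there the random sum is a
  copy of \<open>f\<close>.
\<close>

lemma dist_fun_le_dist_fun_kruglov: "dist_fun f \<tau> \<le> exp 1 * dist_fun g \<tau>"
proof -
  have "ennreal (exp (-1) * dist_fun f \<tau>)
      = ennreal (pmf (poisson_pmf 1) 1) * emeasure mes_seq {\<omega> \<in> space mes_seq. \<omega> 0 \<in> {t \<in> space mes. \<tau> < \<bar>f t\<bar>}}"
    by (subst mes_seq.emeasure_PiM_Collect_single) (auto simp: ennreal_mult dist_fun_eq_emeasure, measurable)
  also have "{\<omega> \<in> space mes_seq. \<omega> 0 \<in> {t \<in> space mes. \<tau> < \<bar>f t\<bar>}}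
      = {\<omega> \<in> space mes_seq. (\<Sum>i<1. f (\<omega> i)) \<in> {s. \<tau> < \<bar>s\<bar>}}"
    by (auto simp: space_PiM)
  also have "ennreal (pmf (poisson_pmf 1) 1) * emeasure mes_seq {\<omega> \<in> space mes_seq. (\<Sum>i<1. f (\<omega> i)) \<in> {s. \<tau> < \<bar>s\<bar>}}
      \<le> emeasure (kruglov_law f) {s. \<tau> < \<bar>s\<bar>}"
    using sum_le_suminf[of "\<lambda>n. ennreal (pmf (poisson_pmf 1) n) *
      emeasure mes_seq {\<omega> \<in> space mes_seq. (\<Sum>i<n. f (\<omega> i)) \<in> {s. \<tau> < \<bar>s\<bar>}}" "{1}"]
    by (subst emeasure_kruglov_law[OF f]) (auto intro: summableI)
  finally have "exp (-1) * dist_fun f \<tau> \<le> dist_fun g \<tau>"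
    by (simp flip: dist_fun_kruglov)
  then have "exp 1 * (exp (-1) * dist_fun f \<tau>) \<le> exp 1 * dist_fun g \<tau>"
    by (intro mult_left_mono) auto
  then show ?thesis
    by (simp add: mult.assoc[symmetric] exp_add[symmetric])
qed

text \<open>
  The left side is the probability that the Poisson variable equals \<open>n\<close> and all \<open>n\<close> summands are at
  least \<open>v\<close>.
\<close>

lemma kruglov_tail_ge:
  assumes "0 < v" "\<sigma> < real n * v"
  shows "exp (-1) / fact n * measure mes {t \<in> space mes. v \<le> f t} ^ n \<le> dist_fun g \<sigma>"
proof -
  have "ennreal (exp (-1) / fact n * measure mes {t \<in> space mes. v \<le> f t} ^ n)
      = ennreal (pmf (poisson_pmf 1) n) * (\<Prod>i<n. emeasure mes {t \<in> space mes. v \<le> f t})"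
    by (simp add: mes.emeasure_eq_measure ennreal_mult[symmetric] ennreal_power mult.commute divide_inverse)
  also have "(\<Prod>i<n. emeasure mes {t \<in> space mes. v \<le> f t})
      = emeasure mes_seq {\<omega> \<in> space mes_seq. \<forall>i\<in>{..<n}. \<omega> i \<in> {t \<in> space mes. v \<le> f t}}"
    by (rule mes_seq.emeasure_PiM_Collect[symmetric]) (auto, measurable)
  also have "\<dots> \<le> emeasure mes_seq {\<omega> \<in> space mes_seq. (\<Sum>i<n. f (\<omega> i)) \<in> {s. \<sigma> < \<bar>s\<bar>}}"
  proof (rule emeasure_mono)
    show "{\<omega> \<in> space mes_seq. \<forall>i\<in>{..<n}. \<omega> i \<in> {t \<in> space mes. v \<le> f t}}
        \<subseteq> {\<omega> \<in> space mes_seq. (\<Sum>i<n. f (\<omega> i)) \<in> {s. \<sigma> < \<bar>s\<bar>}}"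
    proof safe
      fix \<omega> assume "\<forall>i\<in>{..<n}. \<omega> i \<in> {t \<in> space mes. v \<le> f t}"
      then have "real n * v \<le> (\<Sum>i<n. f (\<omega> i))"
        using sum_mono[of "{..<n}" "\<lambda>_. v" "\<lambda>i. f (\<omega> i)"] by simp
      then show "\<sigma> < \<bar>\<Sum>i<n. f (\<omega> i)\<bar>"
        using assms by linarith
    qed
  qed measurable
  then have "ennreal (pmf (poisson_pmf 1) n) * emeasure mes_seq {\<omega> \<in> space mes_seq. \<forall>i\<in>{..<n}. \<omega> i \<in> {t \<in> space mes. v \<le> f t}}
      \<le> ennreal (pmf (poisson_pmf 1) n) * emeasure mes_seq {\<omega> \<in> space mes_seq. (\<Sum>i<n. f (\<omega> i)) \<in> {s. \<sigma> < \<bar>s\<bar>}}"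
    by (intro mult_left_mono) auto
  also have "\<dots> \<le> emeasure (kruglov_law f) {s. \<sigma> < \<bar>s\<bar>}"
    using sum_le_suminf[of "\<lambda>n. ennreal (pmf (poisson_pmf 1) n) *
      emeasure mes_seq {\<omega> \<in> space mes_seq. (\<Sum>i<n. f (\<omega> i)) \<in> {s. \<sigma> < \<bar>s\<bar>}}" "{n}"]
    by (subst emeasure_kruglov_law[OF f]) (auto intro: summableI)
  finally show ?thesis
    by (simp flip: dist_fun_kruglov)
qed

end

lemma dist_fun_kruglov_mono:
  assumes f[measurable]: "f \<in> borel_measurable mes" and h[measurable]: "h \<in> borel_measurable mes"
    and le: "AE t in mes. 0 \<le> f t \<and> f t \<le> h t"
    and g: "g \<in> borel_measurable mes" "distr mes borel g = kruglov_law f"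
    and k: "k \<in> borel_measurable mes" "distr mes borel k = kruglov_law h"
  shows "dist_fun g \<tau> \<le> dist_fun k \<tau>"
proof -
  have ae: "AE \<omega> in mes_seq. \<forall>i. 0 \<le> f (\<omega> i) \<and> f (\<omega> i) \<le> h (\<omega> i)"
    unfolding AE_all_countable using le mes_seq.AE_component[of _ "\<lambda>t. 0 \<le> f t \<and> f t \<le> h t"] by auto
  have "emeasure mes_seq {\<omega> \<in> space mes_seq. (\<Sum>i<n. f (\<omega> i)) \<in> {s. \<tau> < \<bar>s\<bar>}}
      \<le> emeasure mes_seq {\<omega> \<in> space mes_seq. (\<Sum>i<n. h (\<omega> i)) \<in> {s. \<tau> < \<bar>s\<bar>}}" for n
  proof (rule emeasure_mono_AE)
    show "AE \<omega> in mes_seq. \<omega> \<in> {\<omega> \<in> space mes_seq. (\<Sum>i<n. f (\<omega> i)) \<in> {s. \<tau> < \<bar>s\<bar>}}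
        \<longrightarrow> \<omega> \<in> {\<omega> \<in> space mes_seq. (\<Sum>i<n. h (\<omega> i)) \<in> {s. \<tau> < \<bar>s\<bar>}}"
      using ae
    proof eventually_elim
      case (elim \<omega>)
      then have "0 \<le> (\<Sum>i<n. f (\<omega> i))" "(\<Sum>i<n. f (\<omega> i)) \<le> (\<Sum>i<n. h (\<omega> i))"
        by (auto intro!: sum_nonneg sum_mono)
      then show ?case by auto
    qed
  qed measurable
  then have "emeasure (kruglov_law f) {s. \<tau> < \<bar>s\<bar>} \<le> emeasure (kruglov_law h) {s. \<tau> < \<bar>s\<bar>}"
    by (subst (1 2) emeasure_kruglov_law) (auto intro!: suminf_le mult_left_mono summableI)
  then show ?thesis
    unfolding dist_fun_kruglov[OF f g, symmetric] dist_fun_kruglov[OF h k, symmetric] by simp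
qed

text \<open>
  The quantile function of the distribution, extended by \<open>0\<close> outside the open unit interval.
\<close>

lemma real_distribution_realised_on_mes:
  assumes "real_distribution M"
  shows "\<exists>g\<in>borel_measurable mes. distr mes borel g = M"
proof -
  interpret cdf_distribution M
    using assms by (simp add: cdf_distribution_def)
  define g where "g t = (if t \<in> {0<..<1} then I t else 0)" for t
  have g_borel: "g \<in> borel_measurable borel"
    unfolding g_def[abs_def]
    by (subst measurable_restrict_space_iff[symmetric]) (use measurable_CI in simp_all)
  then have g[measurable]: "g \<in> borel_measurable mes"
    by (intro measurable_restrict_space1 measurable_completion) simp
  have "distr mes borel g = distr (restrict_space lborel {0<..<1}) borel I"
  proof (rule measure_eqI)
    fix B assume "B \<in> sets (distr mes borel g)"
    then have B[measurable]: "B \<in> sets borel" by simp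
    have I[measurable]: "I \<in> borel_measurable (restrict_space lborel {0<..<1})"
      using measurable_CI by (simp cong: measurable_cong_sets add: sets_restrict_space)
    have "emeasure (distr mes borel g) B = (\<integral>\<^sup>+s. indicator B s \<partial>distr mes borel g)"
      by simp
    also have "\<dots> = (\<integral>\<^sup>+t. indicator B (g t) \<partial>mes)"
      by (intro nn_integral_distr) measurable
    also have "\<dots> = (\<integral>\<^sup>+t. indicator B (g t) * indicator {0..1} t \<partial>lborel)"
      by (rule nn_integral_mes)
    also have "\<dots> = (\<integral>\<^sup>+t. indicator B (I t) * indicator {0<..<1} t \<partial>lborel)"
    proof (rule nn_integral_cong_AE)
      show "AE t in lborel. (indicator B (g t) * indicator {0..1} t :: ennreal) = indicator B (I t) * indicator {0<..<1} t"
        using AE_lborel_singleton[of 0] AE_lborel_singleton[of 1]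
        by eventually_elim (auto simp: g_def indicator_def)
    qed
    also have "\<dots> = (\<integral>\<^sup>+t. indicator B (I t) \<partial>restrict_space lborel {0<..<1})"
      by (rule nn_integral_restrict_space[symmetric]) simp
    also have "\<dots> = (\<integral>\<^sup>+s. indicator B s \<partial>distr (restrict_space lborel {0<..<1}) borel I)"
      by (intro nn_integral_distr[symmetric]) measurable
    also have "\<dots> = emeasure (distr (restrict_space lborel {0<..<1}) borel I) B"
      by simp
    finally show "emeasure (distr mes borel g) B = emeasure (distr (restrict_space lborel {0<..<1}) borel I) B" .
  qed simp
  then show ?thesis
    using g distr_I_eq_M by (intro bexI[of _ g]) auto
qed

lemma kruglov_realised:
  assumes "f \<in> borel_measurable mes"
  obtains g where "g \<in> borel_measurable mes" "distr mes borel g = kruglov_law f"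
  using real_distribution_realised_on_mes[OF real_distribution_kruglov_law[OF assms]] by blast

section \<open>The Kruglov property of the Marcinkiewicz spaces\<close>

text \<open>
  Passing from \<open>g\<close> to \<open>f\<close> costs a factor \<open>exp 1\<close> in the tail, which slow variation absorbs. For the
  converse take Chernoff's bound with \<open>l\<close> chosen such that \<open>l * C * log_series \<epsilon> v = 1 / 2\<close> at \<open>v = ln (1 + u)\<close>.
  Then the exponential moment of \<open>f\<close> is only of order \<open>exp (v / 2) = sqrt (1 + u)\<close>, whereas
  \<open>l * growth \<epsilon> u\<close> is of order \<open>1 + u\<close> because \<open>log_series \<epsilon> v\<close> exceeds \<open>log_series \<epsilon> u\<close> at most by the factor \<open>1 / \<epsilon>\<close>.
\<close>

lemma kruglov_property_profile_integral:
  assumes eps: "0 < \<epsilon>" "\<epsilon> < 1"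
  shows "kruglov_property (marcinkiewicz (profile_integral \<epsilon>))"
  unfolding kruglov_property_def
proof (intro ballI impI iffI)
  fix f g assume f: "f \<in> borel_measurable mes" and g: "g \<in> borel_measurable mes"
    and law: "distr mes borel g = kruglov_law f" and mem: "g \<in> marcinkiewicz (profile_integral \<epsilon>)"
  obtain C where C: "0 < C" "\<And>u. 0 \<le> u \<Longrightarrow> dist_fun g (C * growth \<epsilon> u) \<le> exp (- u)"
    using mem mem_iff_tail[OF eps g] by auto
  have "dist_fun f (2 * C * growth \<epsilon> u) \<le> exp (- u)" if u: "0 \<le> u" for u
  proof -
    have "C * growth \<epsilon> (u + 1) \<le> C * (2 * growth \<epsilon> u)"
      using growth_add_le[OF eps u, of 1] C(1) by (intro mult_left_mono) auto
    then have "dist_fun f (2 * C * growth \<epsilon> u) \<le> dist_fun f (C * growth \<epsilon> (u + 1))"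
      by (intro dist_fun_antimono[OF f]) simp
    also have "\<dots> \<le> exp 1 * dist_fun g (C * growth \<epsilon> (u + 1))"
      by (rule dist_fun_le_dist_fun_kruglov[OF f g law])
    also have "\<dots> \<le> exp 1 * exp (- (u + 1))"
      using u by (intro mult_left_mono C) auto
    also have "\<dots> = exp (- u)"
      by (simp flip: exp_add)
    finally show ?thesis .
  qed
  then show "f \<in> marcinkiewicz (profile_integral \<epsilon>)"
    unfolding mem_iff_tail[OF eps f] using C(1) by (intro exI[of _ "2 * C"]) auto
next
  fix f g assume f: "f \<in> borel_measurable mes" and g: "g \<in> borel_measurable mes"
    and law: "distr mes borel g = kruglov_law f" and mem: "f \<in> marcinkiewicz (profile_integral \<epsilon>)"
  obtain C0 where C0: "0 \<le> C0" "\<And>t. 0 < t \<Longrightarrow> t \<le> 1 \<Longrightarrow> rearrangement f t \<le> C0 * profile \<epsilon> t"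
    using rearrangement_le_of_mem[OF eps mem] by blast
  define C where "C = C0 + 1"
  have C: "0 < C" "rearrangement f t \<le> C * profile \<epsilon> t" if "0 < t" "t \<le> 1" for t
    using C0(1) C0(2)[OF that] profile_ge_1[OF eps that] by (auto simp: C_def algebra_simps)
  have C_pos: "0 < C"
    using C0(1) by (simp add: C_def)
  \<comment> \<open>With this constant \<open>l * (D * growth \<epsilon> u)\<close> is at least \<open>7 * (1 + u)\<close>, of which \<open>6 * (1 + u)\<close> pays for the moment.\<close>
  define D where "D = 14 * C / \<epsilon>"
  have "dist_fun g (D * growth \<epsilon> u) \<le> exp (- u)" if u: "0 \<le> u" for u
  proof -
    let ?v = "ln (1 + u)"
    have v: "0 \<le> ?v"
      using u by simp
    let ?l = "1 / (2 * C * log_series \<epsilon> ?v)"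
    have R: "0 < log_series \<epsilon> ?v"
      using log_series_pos[OF eps v] .
    have "(\<integral>\<^sup>+t. ennreal (exp (?l * \<bar>f t\<bar>)) \<partial>mes) \<le> ennreal (6 * exp (?v / 2))"
      using C_pos R v C(2) by (intro exp_moment_le[OF eps f, of C]) auto
    then have "dist_fun g (D * growth \<epsilon> u) \<le> exp (6 * exp (?v / 2) - ?l * (D * growth \<epsilon> u))"
      using C_pos R by (intro dist_fun_le_of_exp_moment[OF f g law]) auto
    also have "\<dots> \<le> exp (- u)"
    proof -
      have "exp (?v / 2) \<le> 1 + u"
        using u v by (subst ln_ge_iff[symmetric]) auto
      moreover have "7 * (1 + u) \<le> ?l * (D * growth \<epsilon> u)"
      proof -
        have "7 * (1 + u) = (1 + u) * (7 * (\<epsilon> * log_series \<epsilon> ?v)) / (\<epsilon> * log_series \<epsilon> ?v)"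
          using eps R by simp
        also have "\<dots> \<le> (1 + u) * (7 * log_series \<epsilon> u) / (\<epsilon> * log_series \<epsilon> ?v)"
          using log_series_ln_le[OF eps u] eps R u by (intro divide_right_mono mult_left_mono) auto
        also have "\<dots> = ?l * (D * growth \<epsilon> u)"
          using C_pos eps R by (simp add: D_def growth_def field_simps)
        finally show ?thesis .
      qed
      ultimately show ?thesis
        by simp
    qed
    finally show ?thesis .
  qed
  moreover have "0 < D"
    using C_pos eps by (simp add: D_def)
  ultimately show "g \<in> marcinkiewicz (profile_integral \<epsilon>)"
    unfolding mem_iff_tail[OF eps g] by blast
qed

section \<open>Rearrangement invariant spaces with the Kruglov property\<close>

lemma kruglov_law_scale:
  fixes f g :: "real \<Rightarrow> real"
  assumes f[measurable]: "f \<in> borel_measurable mes" and g[measurable]: "g \<in> borel_measurable mes"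
    and law: "distr mes borel g = kruglov_law f"
  shows "distr mes borel (\<lambda>t. s * g t) = kruglov_law (\<lambda>t. s * f t)"
proof -
  note m = measurable_random_sum[OF f]
  have "distr mes borel (\<lambda>t. s * g t) = distr (distr mes borel g) borel (\<lambda>r. s * r)"
    by (subst distr_distr) (auto simp: comp_def)
  also have "\<dots> = distr (measure_pmf (poisson_pmf 1) \<Otimes>\<^sub>M mes_seq) borel ((\<lambda>r. s * r) \<circ> (\<lambda>(n, \<omega>). \<Sum>i<n. f (\<omega> i)))"
    unfolding law kruglov_law_def using m by (subst distr_distr) auto
  also have "((\<lambda>r. s * r) \<circ> (\<lambda>(n, \<omega>). \<Sum>i<n. f (\<omega> i))) = (\<lambda>(n, \<omega>). \<Sum>i<n. s * f (\<omega> i))"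
    by (auto simp: fun_eq_iff sum_distrib_left)
  finally show ?thesis
    by (simp add: kruglov_law_def)
qed

lemma interval_in_sets_mes: "A \<in> sets borel \<Longrightarrow> A \<inter> {0..1} \<in> sets mes"
  by (auto simp: sets_restrict_space_iff)

text \<open>
  The summands of the profile: \<open>profile \<epsilon> t\<close> is the sum of \<open>\<epsilon> ^ k * profile_term k t\<close> over all \<open>k\<close>.
\<close>

definition profile_term :: "nat \<Rightarrow> real \<Rightarrow> real" where
  "profile_term k t = (1 + - ln t) * recip_log k (- ln t)"

lemma measurable_profile_term: "profile_term k \<in> borel_measurable mes"
  unfolding profile_term_def[abs_def]
  by (intro measurable_restrict_space1 measurable_completion) measurable

lemma profile_term_nonneg: "AE t in mes. 0 \<le> profile_term k t"
  using AE_mes_pos AE_space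
proof eventually_elim
  case (elim t)
  then have "0 \<le> - ln t"
    by (simp add: space_mes)
  then show ?case
    using one_le_mult_recip_log[of "- ln t" k] by (simp add: profile_term_def)
qed

lemma profile_term_tail:
  assumes "0 \<le> v"
  shows "exp (- v) \<le> measure mes {t \<in> space mes. (1 + v) * recip_log k v \<le> profile_term k t}"
proof -
  note [measurable] = measurable_profile_term
  have "{0<..exp (- v)} \<subseteq> {t \<in> space mes. (1 + v) * recip_log k v \<le> profile_term k t}"
  proof
    fix t assume t: "t \<in> {0<..exp (- v)}"
    then have "ln t \<le> - v"
      using ln_le_cancel_iff[of t "exp (- v)"] by simp
    moreover have "t \<le> 1"
      using t order_trans[of t "exp (- v)" 1] exp_le_one_iff[of "- v"] assms by simp
    ultimately show "t \<in> {t \<in> space mes. (1 + v) * recip_log k v \<le> profile_term k t}"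
      using t assms mult_recip_log_mono[of v "- ln t" k] by (auto simp: space_mes profile_term_def simp del: exp_le_one_iff)
  qed
  then have "measure mes {0<..exp (- v)} \<le> measure mes {t \<in> space mes. (1 + v) * recip_log k v \<le> profile_term k t}"
    by (intro mes.finite_measure_mono) measurable
  moreover have "measure mes {0<..exp (- v)} = exp (- v)"
  proof -
    have le: "exp (- v) \<le> 1"
      using assms by simp
    have sub: "{0<..exp (- v)} \<subseteq> {0..1}"
    proof
      fix x assume "x \<in> {0<..exp (- v)}"
      then have "0 < x" "x \<le> exp (- v)"
        by auto
      then show "x \<in> {0..1}"
        using order_trans[OF _ le] by simp
    qed
    show ?thesis
      unfolding measure_def by (subst emeasure_mes[OF _ sub]) auto
  qed
  ultimately show ?thesis by simp
qed

text \<open>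
  With \<open>u = - ln t\<close>, \<open>v = ln (1 + u)\<close> and \<open>z = (1 + u) / (1 + v)\<close>, the left side is \<open>z\<close> times the value of
  \<open>profile_term k\<close> at \<open>exp (- v)\<close>. For large \<open>z\<close> a sum of about \<open>z / 2\<close> independent copies that are all at least
  this value accounts for it: since \<open>fact n \<le> exp (n * v)\<close>, this has probability at least
  \<open>exp (-1 - 2 * n * v) \<ge> t\<close>. For \<open>z < 2\<close> the first term on the right suffices.
\<close>

lemma profile_term_Suc_le:
  assumes g: "g \<in> borel_measurable mes" "distr mes borel g = kruglov_law (profile_term k)"
    and t: "0 < t" "t \<le> 1"
  shows "profile_term (Suc k) t \<le> 2 * profile_term k t + 4 * rearrangement g t"
proof -
  let ?u = "- ln t" and ?\<phi> = "\<lambda>k u. (1 + u) * recip_log k u"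
  let ?v = "ln (1 + ?u)"
  let ?z = "(1 + ?u) / (1 + ?v)"
  have u: "0 \<le> ?u"
    using t by simp
  have v: "0 \<le> ?v" "?v \<le> ?u"
    using u ln_le_minus_one[of "1 + ?u"] by auto
  have eq: "profile_term (Suc k) t = ?z * ?\<phi> k ?v"
    using v by (simp add: profile_term_def)
  have \<phi>: "1 \<le> ?\<phi> k ?v" "?\<phi> k ?v \<le> profile_term k t"
    using one_le_mult_recip_log[OF v(1)] mult_recip_log_mono[OF v] by (auto simp: profile_term_def)
  have g0: "0 \<le> rearrangement g t"
    using rearrangement_nonneg[OF g(1) t(1)] .
  show ?thesis
  proof (cases "?z < 2")
    case True
    then have "?z * ?\<phi> k ?v \<le> 2 * profile_term k t"
      using \<phi> by (intro mult_mono) auto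
    then show ?thesis
      using eq g0 by simp
  next
    case False
    have floor_half: "1 \<le> nat \<lfloor>z / 2\<rfloor> \<and> 2 * real (nat \<lfloor>z / 2\<rfloor>) \<le> z \<and> z \<le> 4 * real (nat \<lfloor>z / 2\<rfloor>)"
      if "2 \<le> z" for z :: real
    proof -
      have "1 \<le> \<lfloor>z / 2\<rfloor>"
        using that by simp
      then show ?thesis
        by linarith
    qed
    obtain n where n: "1 \<le> n" "2 * real n \<le> ?z" "?z \<le> 4 * real n"
      using floor_half[of ?z] False by (meson not_less)
    have "real n * ?\<phi> k ?v \<le> rearrangement g t"
    proof (rule ccontr)
      assume "\<not> ?thesis"
      then obtain \<sigma> where \<sigma>: "rearrangement g t < \<sigma>" "\<sigma> < real n * ?\<phi> k ?v"
        using dense by (metis not_le)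
      have zv: "?z * ?v = 1 + ?u - ?z"
        using v by (simp add: field_simps)
      have "fact n \<le> exp (real n * ?v)"
      proof -
        have "fact n \<le> real n ^ n"
          using fact_le_power[where 'a = real, of n] by simp
        also have "\<dots> \<le> (1 + ?u) ^ n"
        proof (rule power_mono)
          have "?z \<le> (1 + ?u) / 1"
            using u v by (intro divide_left_mono) auto
          then have "2 * real n \<le> (1 + ?u) / 1"
            by (rule order_trans[OF n(2)])
          then show "real n \<le> 1 + ?u"
            by simp
        qed simp
        also have "\<dots> = exp (real n * ?v)"
          using u by (simp add: exp_of_nat_mult)
        finally show ?thesis .
      qed
      then have "exp (-1) / exp (real n * ?v) * exp (- ?v) ^ n \<le> exp (-1) / fact n * exp (- ?v) ^ n"
        by (intro mult_right_mono divide_left_mono) auto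
      moreover have "exp (-1) / exp (real n * ?v) * exp (- ?v) ^ n = exp (-1 - 2 * real n * ?v)"
        by (simp add: exp_of_nat_mult[symmetric] exp_diff[symmetric] exp_add[symmetric] algebra_simps)
      moreover have "- ?u \<le> -1 - 2 * real n * ?v"
      proof -
        have "2 * real n * ?v \<le> ?z * ?v"
          by (rule mult_right_mono[OF n(2) v(1)])
        then show ?thesis
          using zv False by linarith
      qed
      then have "exp (- ?u) \<le> exp (-1 - 2 * real n * ?v)"
        by simp
      ultimately have "exp (- ?u) \<le> exp (-1) / fact n * exp (- ?v) ^ n"
        by linarith
      also have "\<dots> \<le> exp (-1) / fact n * measure mes {t \<in> space mes. ?\<phi> k ?v \<le> profile_term k t} ^ n"
        using profile_term_tail[OF v(1), of k] by (intro mult_left_mono power_mono) auto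
      also have "\<dots> \<le> dist_fun g \<sigma>"
        using \<phi> \<sigma> by (intro kruglov_tail_ge[OF measurable_profile_term g]) auto
      also have "\<dots> < t"
        using dist_fun_less_of_rearrangement_less[OF g(1) t(1) \<sigma>(1)] .
      finally show False
        using t by simp
    qed
    then have "4 * (real n * ?\<phi> k ?v) \<le> 4 * rearrangement g t"
      by simp
    moreover have "?z * ?\<phi> k ?v \<le> (4 * real n) * ?\<phi> k ?v"
      using n \<phi> by (intro mult_right_mono) auto
    moreover have "0 \<le> profile_term k t"
      using \<phi> by linarith
    ultimately show ?thesis
      using eq by (simp add: mult.assoc)
  qed
qed

context
  fixes E :: "(real \<Rightarrow> real) set" and N :: "(real \<Rightarrow> real) \<Rightarrow> real"
  assumes ri: "ri_space E N"
begin

lemma ri_measurable: "x \<in> E \<Longrightarrow> x \<in> borel_measurable mes"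
  using ri by (auto simp: ri_space_def banach_fun_space_def)

lemma ri_add: "x \<in> E \<Longrightarrow> y \<in> E \<Longrightarrow> (\<lambda>t. x t + y t) \<in> E"
  and ri_norm_add: "x \<in> E \<Longrightarrow> y \<in> E \<Longrightarrow> N (\<lambda>t. x t + y t) \<le> N x + N y"
  and ri_cmult: "x \<in> E \<Longrightarrow> (\<lambda>t. c * x t) \<in> E"
  and ri_norm_cmult: "x \<in> E \<Longrightarrow> N (\<lambda>t. c * x t) = \<bar>c\<bar> * N x"
  and ri_norm_eq_0: "x \<in> E \<Longrightarrow> N x = 0 \<longleftrightarrow> (AE t in mes. x t = 0)"
  using ri by (auto simp: ri_space_def banach_fun_space_def)

lemma ri_complete:
  assumes "\<And>n. X n \<in> E" "\<And>e. 0 < e \<Longrightarrow> \<exists>K. \<forall>m\<ge>K. \<forall>n\<ge>K. N (\<lambda>t. X m t - X n t) < e"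
  obtains x where "x \<in> E" "(\<lambda>n::nat. N (\<lambda>t. X n t - x t)) \<longlonglongrightarrow> 0"
proof -
  have "\<forall>X. (\<forall>n. X n \<in> E) \<and> (\<forall>e>0. \<exists>K. \<forall>m\<ge>K. \<forall>n\<ge>K. N (\<lambda>t. X m t - X n t) < e) \<longrightarrow>
          (\<exists>x\<in>E. (\<lambda>n::nat. N (\<lambda>t. X n t - x t)) \<longlonglongrightarrow> 0)"
    using ri unfolding ri_space_def banach_fun_space_def by (elim conjE)
  from this[rule_format, of X] assms that show thesis
    by blast
qed

lemma ri_ideal:
  assumes "x \<in> borel_measurable mes" "y \<in> E" "AE t in mes. \<bar>x t\<bar> \<le> \<bar>y t\<bar>"
  shows "x \<in> E" "N x \<le> N y"
proof -
  have "\<forall>x\<in>borel_measurable mes. \<forall>y\<in>E. (AE t in mes. \<bar>x t\<bar> \<le> \<bar>y t\<bar>) \<longrightarrow> x \<in> E \<and> N x \<le> N y"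
    using ri unfolding ri_space_def by (elim conjE)
  then show "x \<in> E" "N x \<le> N y"
    using assms by blast+
qed

lemma ri_equimeasurable:
  assumes "x \<in> borel_measurable mes" "y \<in> E" "equimeasurable x y"
  shows "x \<in> E" "N x = N y"
proof -
  have "\<forall>x\<in>borel_measurable mes. \<forall>y\<in>E. equimeasurable x y \<longrightarrow> x \<in> E \<and> N x = N y"
    using ri unfolding ri_space_def by (elim conjE)
  then show "x \<in> E" "N x = N y"
    using assms by blast+
qed

lemma ri_diff: "x \<in> E \<Longrightarrow> y \<in> E \<Longrightarrow> (\<lambda>t. x t - y t) \<in> E"
  using ri_add[of x "\<lambda>t. (-1) * y t"] ri_cmult[of y "-1"] by simp

lemma ri_norm_nonneg:
  assumes "x \<in> E"
  shows "0 \<le> N x"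
proof -
  have "N (\<lambda>t. x t + (-1) * x t) \<le> N x + N (\<lambda>t. (-1) * x t)"
    by (intro ri_norm_add ri_cmult assms)
  moreover have "(\<lambda>t. x t + (-1) * x t) = (\<lambda>t. 0 * x t)"
    by auto
  ultimately show ?thesis
    using ri_norm_cmult[OF assms, of 0] ri_norm_cmult[OF assms, of "-1"] by simp
qed

lemma ri_rearrangement:
  assumes "x \<in> E"
  shows "rearrangement x \<in> E" "N (rearrangement x) = N x"
  using ri_equimeasurable[OF measurable_rearrangement assms equimeasurable_rearrangement]
    ri_measurable[OF assms] by auto

lemma mem_of_rearrangement_mem:
  assumes x: "x \<in> borel_measurable mes" and mem: "rearrangement x \<in> E"
  shows "x \<in> E" "N x = N (rearrangement x)"
proof -
  have "equimeasurable x (rearrangement x)"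
    using equimeasurable_rearrangement[OF x] by (simp add: equimeasurable_def)
  from ri_equimeasurable[OF x mem this] show "x \<in> E" "N x = N (rearrangement x)"
    by auto
qed

text \<open>
  Every function has the same norm as its rearrangement, and rearrangements inherit the order of the
  distribution functions.
\<close>

lemma ri_dominated:
  assumes x: "x \<in> borel_measurable mes" and y: "y \<in> E"
    and le: "\<And>\<tau>. 0 \<le> \<tau> \<Longrightarrow> dist_fun x \<tau> \<le> dist_fun y \<tau>"
  shows "x \<in> E" "N x \<le> N y"
proof -
  have ym: "y \<in> borel_measurable mes"
    using y by (rule ri_measurable)
  have le: "rearrangement x t \<le> rearrangement y t" if "0 < t" for t
    unfolding rearrangement_def using dist_fun_small[OF ym that] le
    by (intro cInf_superset_mono) (force intro: bdd_belowI[of _ 0])+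
  have "AE t in mes. \<bar>rearrangement x t\<bar> \<le> \<bar>rearrangement y t\<bar>"
    using AE_mes_pos by eventually_elim (use le rearrangement_nonneg[OF x] rearrangement_nonneg[OF ym] in force)
  from ri_ideal[OF measurable_rearrangement[OF x] ri_rearrangement(1)[OF y] this]
  show "x \<in> E" "N x \<le> N y"
    using mem_of_rearrangement_mem[OF x] ri_rearrangement[OF y] by auto
qed

text \<open>
  Some element exceeds some \<open>\<sigma> > 0\<close> on a set of positive measure \<open>p\<close>. Hence the indicators of all sets
  of measure at most \<open>p\<close> belong to the space, and finitely many of them cover the unit interval.
\<close>

lemma ri_const_mem: "(\<lambda>t. 1) \<in> E"
proof -
  obtain x where x: "x \<in> E" "\<not> (AE t in mes. x t = 0)"
    using ri by (auto simp: ri_space_def banach_fun_space_def)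
  note [measurable] = ri_measurable[OF x(1)]
  have "dist_fun x 0 \<noteq> 0"
  proof
    assume "dist_fun x 0 = 0"
    then have "emeasure mes {t \<in> space mes. 0 < \<bar>x t\<bar>} = 0"
      by (simp only: dist_fun_eq_emeasure[symmetric] ennreal_0)
    then have "AE t in mes. \<not> 0 < \<bar>x t\<bar>"
      by (subst AE_iff_measurable[OF _ refl]) (auto, measurable)
    with x(2) show False
      by (auto elim: eventually_mono)
  qed
  then have "0 < dist_fun x 0"
    using dist_fun_nonneg[of x 0] by linarith
  then obtain \<sigma> where \<sigma>: "0 < \<sigma>" "0 < dist_fun x \<sigma>"
    using dist_fun_right_continuous[OF ri_measurable[OF x(1)]] by blast
  let ?p = "dist_fun x \<sigma>"
  have small: "indicator A \<in> E" if A[measurable]: "A \<in> sets mes" and le: "measure mes A \<le> ?p" for A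
  proof -
    have "(\<lambda>t. \<sigma> * indicator A t) \<in> E"
    proof (rule ri_dominated(1)[OF _ x(1)])
      fix \<tau> :: real assume \<tau>: "0 \<le> \<tau>"
      show "dist_fun (\<lambda>t. \<sigma> * indicator A t) \<tau> \<le> dist_fun x \<tau>"
      proof (cases "\<tau> < \<sigma>")
        case True
        have "dist_fun (\<lambda>t. \<sigma> * indicator A t) \<tau> \<le> measure mes A"
          unfolding dist_fun_def using \<tau>
          by (intro mes.finite_measure_mono) (auto simp: indicator_def split: if_splits)
        also have "\<dots> \<le> dist_fun x \<sigma>"
          by (rule le)
        also have "\<dots> \<le> dist_fun x \<tau>"
          using True by (intro dist_fun_antimono) auto
        finally show ?thesis .
      next
        case False
        then have "{t \<in> space mes. \<tau> < \<bar>\<sigma> * indicator A t\<bar>} = {}"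
          using \<sigma> \<tau> by (auto simp: indicator_def)
        then have "dist_fun (\<lambda>t. \<sigma> * indicator A t) \<tau> = 0"
          unfolding dist_fun_def by (simp only: measure_empty)
        then show ?thesis
          by simp
      qed
    qed measurable
    from ri_cmult[OF this, of "1 / \<sigma>"] show ?thesis
      using \<sigma> by simp
  qed
  have ind: "indicator ({0..real n * ?p} \<inter> {0..1}) \<in> E" for n
  proof (induction n)
    case 0
    show ?case
      by (intro small) (auto intro!: interval_in_sets_mes simp: measure_def emeasure_mes sets_restrict_space_iff)
  next
    case (Suc n)
    let ?A = "{0..real n * ?p} \<inter> {0..1}" and ?B = "{real n * ?p<..real (Suc n) * ?p} \<inter> {0..1}"
    have "measure mes ?B \<le> ?p"
    proof -
      have "emeasure mes ?B \<le> emeasure lebesgue {real n * ?p<..real (Suc n) * ?p}"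
        by (subst emeasure_mes) (auto intro!: emeasure_mono)
      also have "\<dots> = ennreal ?p"
        using \<sigma>(2) by (simp add: algebra_simps)
      finally show ?thesis
        using \<sigma>(2) by (simp add: mes.emeasure_eq_measure)
    qed
    then have "indicator ?B \<in> E"
      by (intro small interval_in_sets_mes) auto
    from ri_add[OF Suc this] have sum: "(\<lambda>t. indicator ?A t + indicator ?B t) \<in> E" .
    show ?case
    proof (rule ri_ideal(1)[OF _ sum])
      show "indicator ({0..real (Suc n) * ?p} \<inter> {0..1}) \<in> borel_measurable mes"
        by (intro borel_measurable_indicator interval_in_sets_mes) simp
      show "AE t in mes. \<bar>indicator ({0..real (Suc n) * ?p} \<inter> {0..1}) t :: real\<bar>
          \<le> \<bar>indicator ?A t + indicator ?B t\<bar>"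
        by (rule AE_I2) (auto simp: indicator_def algebra_simps)
    qed
  qed
  obtain n where n: "1 < real n * ?p"
    using reals_Archimedean3[OF \<sigma>(2)] by blast
  have "AE t in mes. \<bar>1::real\<bar> \<le> \<bar>indicator ({0..real n * ?p} \<inter> {0..1}) t\<bar>"
    using AE_space by eventually_elim (use n in \<open>auto simp: space_mes\<close>)
  from ri_ideal(1)[OF _ ind this] show ?thesis
    by simp
qed

text \<open>
  The norm limit \<open>x\<close> of the partial sums dominates each of them: the positive part of \<open>S n - x\<close> is below
  \<open>\<bar>S m - x\<bar>\<close> for all \<open>m \<ge> n\<close>, so its norm vanishes.
\<close>

lemma ri_sum_dominated:
  assumes h: "\<And>n::nat. h n \<in> E" "\<And>n. AE t in mes. 0 \<le> h n t" "\<And>n. N (h n) \<le> b n" and b: "summable b"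
  obtains x where "x \<in> E" "AE t in mes. \<forall>n. (\<Sum>i<n. h i t) \<le> x t"
proof -
  define S where "S n t = (\<Sum>i<n. h i t)" for n t
  have seg: "(\<lambda>t. \<Sum>i\<in>{m..<m+k}. h i t) \<in> E \<and> N (\<lambda>t. \<Sum>i\<in>{m..<m+k}. h i t) \<le> (\<Sum>i\<in>{m..<m+k}. b i)" for m k
  proof (induction k)
    case 0
    have "(\<lambda>t. 0 * h 0 t) \<in> E" "N (\<lambda>t. 0 * h 0 t) = 0"
      using ri_cmult[OF h(1)[of 0], of 0] ri_norm_cmult[OF h(1)[of 0], of 0] by (simp_all only: abs_zero mult_zero_left)
    then show ?case by simp
  next
    case (Suc k)
    have "(\<lambda>t. (\<Sum>i\<in>{m..<m+k}. h i t) + h (m + k) t) \<in> E"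
      using Suc h by (intro ri_add) auto
    moreover have "N (\<lambda>t. (\<Sum>i\<in>{m..<m+k}. h i t) + h (m + k) t) \<le> (\<Sum>i\<in>{m..<m+k}. b i) + b (m + k)"
      using Suc h(1,3) by (intro order_trans[OF ri_norm_add] add_mono) auto
    ultimately show ?case by simp
  qed
  have SE: "S n \<in> E" for n
    using seg[of 0 n] by (simp add: S_def[abs_def] atLeast0LessThan)
  have S_diff: "N (\<lambda>t. S m t - S n t) \<le> norm (\<Sum>i\<in>{n..<m}. b i)" if "n \<le> m" for m n
  proof -
    have "(\<lambda>t. S m t - S n t) = (\<lambda>t. \<Sum>i\<in>{n..<n+(m-n)}. h i t)"
    proof
      fix t
      have "S m t = S n t + (\<Sum>i\<in>{n..<m}. h i t)"
        using sum.atLeastLessThan_concat[of 0 n m "\<lambda>i. h i t"] that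
        by (simp add: S_def atLeast0LessThan)
      then show "S m t - S n t = (\<Sum>i\<in>{n..<n+(m-n)}. h i t)"
        using that by simp
    qed
    moreover have "(\<Sum>i\<in>{n..<n+(m-n)}. b i) \<le> norm (\<Sum>i\<in>{n..<m}. b i)"
      using that by simp
    ultimately show ?thesis
      using seg[of n "m - n"] by (auto simp del: le_add_diff_inverse)
  qed
  have flip: "N (\<lambda>t. y t - z t) = N (\<lambda>t. z t - y t)" if "y \<in> E" "z \<in> E" for y z
    using ri_norm_cmult[OF ri_diff[OF that], of "-1"] by simp
  obtain x where x: "x \<in> E" "(\<lambda>n. N (\<lambda>t. S n t - x t)) \<longlonglongrightarrow> 0"
  proof (rule ri_complete[of S])
    show "S n \<in> E" for n by (rule SE)
    fix e :: real assume "0 < e"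
    then obtain K where K: "\<forall>n\<ge>K. \<forall>m. norm (\<Sum>i\<in>{n..<m}. b i) < e"
      using b unfolding summable_Cauchy by blast
    have "N (\<lambda>t. S m t - S n t) < e" if "K \<le> m" "K \<le> n" for m n
    proof (cases "n \<le> m")
      case True
      then show ?thesis
        using S_diff[OF True] K that by (meson le_less_trans)
    next
      case False
      then have "N (\<lambda>t. S n t - S m t) < e"
        using S_diff[of m n] K that by (meson le_less_trans nat_le_linear)
      then show ?thesis
        using flip[OF SE SE] by simp
    qed
    then show "\<exists>K. \<forall>m\<ge>K. \<forall>n\<ge>K. N (\<lambda>t. S m t - S n t) < e"
      by blast
  qed
  have "AE t in mes. S n t \<le> x t" for n
  proof -
    note [measurable] = ri_measurable[OF x(1)] ri_measurable[OF SE] ri_measurable[OF h(1)]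
    let ?d = "\<lambda>t. max 0 (S n t - x t)"
    have mono: "AE t in mes. S n t \<le> S m t" if "n \<le> m" for m
    proof -
      have "AE t in mes. \<forall>i. 0 \<le> h i t"
        using h(2) by (simp add: AE_all_countable)
      then show ?thesis
      proof eventually_elim
        case (elim t)
        then show ?case
          unfolding S_def using that by (intro sum_mono2) auto
      qed
    qed
    have le: "?d \<in> E" "N ?d \<le> N (\<lambda>t. S m t - x t)" if "n \<le> m" for m
    proof -
      have "AE t in mes. \<bar>?d t\<bar> \<le> \<bar>S m t - x t\<bar>"
        using mono[OF that] by eventually_elim auto
      moreover have "?d \<in> borel_measurable mes"
        by measurable
      ultimately show "?d \<in> E" "N ?d \<le> N (\<lambda>t. S m t - x t)"
        using ri_ideal[OF _ ri_diff[OF SE x(1)]] by auto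
    qed
    have "N ?d \<le> 0"
      using le(2) by (intro LIMSEQ_le_const[OF x(2)]) auto
    then have "AE t in mes. ?d t = 0"
      using ri_norm_eq_0[OF le(1)] ri_norm_nonneg[OF le(1)] by auto
    then show ?thesis
      by eventually_elim auto
  qed
  then have "AE t in mes. \<forall>n. (\<Sum>i<n. h i t) \<le> x t"
    by (simp add: AE_all_countable S_def)
  with x(1) that show thesis
    by blast
qed

context
  assumes kr: "kruglov_property E"
begin

text \<open>
  A gliding hump. If no \<open>C\<close> worked, there would be nonnegative \<open>f n\<close> with summable norms while the norms of
  the corresponding compound Poisson variables are unbounded. An element above all \<open>f n\<close> has a compound
  Poisson variable in the space, and it dominates all of them in distribution.
\<close>

lemma kruglov_bounded:
  obtains C where "0 < C"
    "\<And>f g. f \<in> E \<Longrightarrow> AE t in mes. 0 \<le> f t \<Longrightarrow> g \<in> borel_measurable mes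
      \<Longrightarrow> distr mes borel g = kruglov_law f \<Longrightarrow> g \<in> E \<and> N g \<le> C * N f"
proof -
  have mem: "g \<in> E" if "f \<in> E" "g \<in> borel_measurable mes" "distr mes borel g = kruglov_law f" for f g
    using kr that ri_measurable[OF that(1)] by (auto simp: kruglov_property_def)
  let ?P = "\<lambda>f g. f \<in> E \<and> (AE t in mes. 0 \<le> f t) \<and> g \<in> borel_measurable mes \<and> distr mes borel g = kruglov_law f"
  have "\<exists>C>0. \<forall>f g. ?P f g \<longrightarrow> N g \<le> C * N f"
  proof (rule ccontr)
    assume neg: "\<not> ?thesis"
    have "\<exists>f g. ?P f g \<and> N f \<le> (1/2) ^ n \<and> N g = real (Suc n)" for n :: nat
    proof -
      have "0 < real (Suc n) * 2 ^ n"
        by simp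
      then obtain f g where fg: "?P f g" "real (Suc n) * 2 ^ n * N f < N g"
        using neg by (meson not_le)
      note fE = conjunct1[OF fg(1)]
      have gE: "g \<in> E"
        using mem fg(1) by blast
      have "0 \<le> real (Suc n) * 2 ^ n * N f"
        using ri_norm_nonneg[OF fE] by simp
      then have pos: "0 < N g"
        using fg(2) by linarith
      \<comment> \<open>Normalising by \<open>N g\<close> rather than by \<open>N f\<close> also covers the case \<open>N f = 0\<close>.\<close>
      let ?s = "real (Suc n) / N g"
      have s: "0 \<le> ?s"
        using pos by simp
      have "N (\<lambda>t. ?s * f t) \<le> (1/2) ^ n"
      proof -
        have "N (\<lambda>t. ?s * f t) = (real (Suc n) * 2 ^ n * N f) * (1/2) ^ n / N g"
          using ri_norm_cmult[OF fE, of ?s] pos by (simp add: power_divide)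
        also have "\<dots> \<le> N g * (1/2) ^ n / N g"
          using fg(2) pos by (intro divide_right_mono mult_right_mono) auto
        finally show ?thesis
          using pos by simp
      qed
      moreover have "N (\<lambda>t. ?s * g t) = real (Suc n)"
        using ri_norm_cmult[OF gE, of ?s] s pos by simp
      moreover have "?P (\<lambda>t. ?s * f t) (\<lambda>t. ?s * g t)"
      proof (intro conjI)
        show "(\<lambda>t. ?s * f t) \<in> E"
          by (rule ri_cmult[OF fE])
        have "AE t in mes. 0 \<le> f t"
          using fg(1) by blast
        then show "AE t in mes. 0 \<le> ?s * f t"
          by eventually_elim (intro mult_nonneg_nonneg s)
        show "(\<lambda>t. ?s * g t) \<in> borel_measurable mes"
          by (rule ri_measurable[OF ri_cmult[OF gE]])
        show "distr mes borel (\<lambda>t. ?s * g t) = kruglov_law (\<lambda>t. ?s * f t)"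
          using fg(1) by (intro kruglov_law_scale ri_measurable[OF fE]) auto
      qed
      ultimately show ?thesis
        by blast
    qed
    then obtain f g where fg: "\<And>n. ?P (f n) (g n)" "\<And>n. N (f n) \<le> (1/2) ^ n" "\<And>n. N (g n) = real (Suc n)"
      by metis
    have nonneg: "AE t in mes. \<forall>n. 0 \<le> f n t"
      using fg(1) by (simp add: AE_all_countable)
    obtain x where x: "x \<in> E" "AE t in mes. \<forall>n. (\<Sum>i<n. f i t) \<le> x t"
      by (rule ri_sum_dominated[of f "\<lambda>n. (1/2) ^ n"]) (use fg in auto)
    note xm = ri_measurable[OF x(1)]
    obtain k where k: "k \<in> borel_measurable mes" "distr mes borel k = kruglov_law x"
      using kruglov_realised[OF xm] by blast
    have kE: "k \<in> E"
      using mem[OF x(1) k] .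
    have unbounded: "real (Suc n) \<le> N k" for n
    proof -
      have "AE t in mes. 0 \<le> f n t \<and> f n t \<le> x t"
        using nonneg x(2)
      proof eventually_elim
        case (elim t)
        have "f n t \<le> (\<Sum>i<Suc n. f i t)"
          using elim(1) by (simp add: sum_nonneg)
        also have "\<dots> \<le> x t"
          using elim(2) by blast
        finally show ?case
          using elim(1) by blast
      qed
      then have "N (g n) \<le> N k"
        using fg(1)[of n] k xm ri_measurable[of "f n"]
        by (intro ri_dominated(2)[OF _ kE] dist_fun_kruglov_mono[of "f n" x]) auto
      then show ?thesis
        using fg(3) by simp
    qed
    obtain n where "N k < real n"
      using reals_Archimedean2 by blast
    with unbounded[of n] show False
      by simp
  qed
  then show thesis
    using that mem by blast
qed

lemma profile_term_mem:
  obtains B where "0 < B" "\<And>k. profile_term k \<in> E" "\<And>k. N (profile_term k) \<le> B ^ k * N (\<lambda>t. 1)"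
proof -
  obtain C where C: "0 < C" "\<And>f g. f \<in> E \<Longrightarrow> AE t in mes. 0 \<le> f t \<Longrightarrow> g \<in> borel_measurable mes
      \<Longrightarrow> distr mes borel g = kruglov_law f \<Longrightarrow> g \<in> E \<and> N g \<le> C * N f"
    using kruglov_bounded by blast
  let ?B = "2 + 4 * C"
  have "profile_term k \<in> E \<and> N (profile_term k) \<le> ?B ^ k * N (\<lambda>t. 1)" for k
  proof (induction k)
    case 0
    have "AE t in mes. profile_term 0 t = 1"
      using AE_mes_pos AE_space
    proof eventually_elim
      case (elim t)
      then have "ln t \<le> 0"
        by (simp add: space_mes)
      then have "1 + - ln t \<noteq> 0"
        by linarith
      then show ?case
        by (simp add: profile_term_def)
    qed
    then have "AE t in mes. \<bar>profile_term 0 t\<bar> \<le> \<bar>1\<bar>"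
      by eventually_elim simp
    from ri_ideal[OF measurable_profile_term ri_const_mem this] show ?case
      by simp
  next
    case (Suc k)
    obtain g where g: "g \<in> borel_measurable mes" "distr mes borel g = kruglov_law (profile_term k)"
      using kruglov_realised[OF measurable_profile_term] by blast
    have gE: "g \<in> E" "N g \<le> C * N (profile_term k)"
      using C(2)[OF _ profile_term_nonneg g] Suc by auto
    let ?y = "\<lambda>t. 2 * profile_term k t + 4 * rearrangement g t"
    have parts: "(\<lambda>t. 2 * profile_term k t) \<in> E" "(\<lambda>t. 4 * rearrangement g t) \<in> E"
      using Suc ri_rearrangement[OF gE(1)] by (auto intro!: ri_cmult)
    have y: "?y \<in> E"
      by (rule ri_add[OF parts])
    have "AE t in mes. \<bar>profile_term (Suc k) t\<bar> \<le> \<bar>?y t\<bar>"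
      using AE_mes_pos AE_space profile_term_nonneg[of "Suc k"]
    proof eventually_elim
      case (elim t)
      then show ?case
        using profile_term_Suc_le[OF g, of t] by (simp add: space_mes)
    qed
    from ri_ideal[OF measurable_profile_term y this]
    have "profile_term (Suc k) \<in> E" "N (profile_term (Suc k)) \<le> N ?y"
      by auto
    note this(2)
    also have "N ?y \<le> N (\<lambda>t. 2 * profile_term k t) + N (\<lambda>t. 4 * rearrangement g t)"
      by (rule ri_norm_add[OF parts])
    also have "\<dots> = 2 * N (profile_term k) + 4 * N g"
      using Suc ri_rearrangement[OF gE(1)] by (simp add: ri_norm_cmult)
    also have "\<dots> \<le> ?B * N (profile_term k)"
      using gE(2) by (simp add: algebra_simps)
    also have "\<dots> \<le> ?B * (?B ^ k * N (\<lambda>t. 1))"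
      using Suc C(1) by (intro mult_left_mono) auto
    finally show ?case
      using \<open>profile_term (Suc k) \<in> E\<close> by simp
  qed
  then show thesis
    using that[of ?B] C(1) by auto
qed

text \<open>
  The norms of the \<open>profile_term k\<close> grow at most like \<open>B ^ k\<close>, so for \<open>\<epsilon> < 1 / B\<close> the series defining the
  profile converges in norm, and everything whose rearrangement is below a multiple of the profile
  belongs to the space.
\<close>

lemma marcinkiewicz_subset_kruglov_space:
  "\<forall>\<^sub>F \<epsilon> in at_right 0. marcinkiewicz (profile_integral \<epsilon>) \<subseteq> E"
proof -
  obtain B where B: "0 < B" "\<And>k. profile_term k \<in> E" "\<And>k. N (profile_term k) \<le> B ^ k * N (\<lambda>t. 1)"
    using profile_term_mem by blast
  have main: "marcinkiewicz (profile_integral \<epsilon>) \<subseteq> E" if eps: "0 < \<epsilon>" "\<epsilon> < 1" and small: "\<epsilon> * B < 1" for \<epsilon>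
  proof -
    let ?h = "\<lambda>k t. \<epsilon> ^ k * profile_term k t"
    obtain x where x: "x \<in> E" "AE t in mes. \<forall>n. (\<Sum>k<n. ?h k t) \<le> x t"
    proof (rule ri_sum_dominated[of ?h "\<lambda>k. (\<epsilon> * B) ^ k * N (\<lambda>t. 1)"])
      show "?h k \<in> E" for k
        by (intro ri_cmult B)
      show "AE t in mes. 0 \<le> ?h k t" for k
        using profile_term_nonneg[of k] eps by (auto elim!: eventually_mono)
      show "N (?h k) \<le> (\<epsilon> * B) ^ k * N (\<lambda>t. 1)" for k
        using ri_norm_cmult[OF B(2), of "\<epsilon> ^ k" k] mult_left_mono[OF B(3), of "\<epsilon> ^ k" k] eps
        by (simp add: power_mult_distrib mult.assoc)
      show "summable (\<lambda>k. (\<epsilon> * B) ^ k * N (\<lambda>t. 1))"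
        using small eps B(1) by (intro summable_mult2 summable_geometric) simp
    qed auto
    have le: "AE t in mes. 0 < t \<and> t \<le> 1 \<and> profile \<epsilon> t \<le> x t"
      using AE_mes_pos AE_space x(2)
    proof eventually_elim
      case (elim t)
      then have u: "0 \<le> - ln t"
        by (simp add: space_mes)
      have "summable (\<lambda>k. (1 + - ln t) * (\<epsilon> ^ k * recip_log k (- ln t)))"
        "profile \<epsilon> t = (\<Sum>k. (1 + - ln t) * (\<epsilon> ^ k * recip_log k (- ln t)))"
        unfolding profile_def growth_def log_series_def
        using summable_log_series[OF eps u] by (auto intro: summable_mult suminf_mult[symmetric])
      moreover have "(\<lambda>k. (1 + - ln t) * (\<epsilon> ^ k * recip_log k (- ln t))) = (\<lambda>k. ?h k t)"
        by (simp add: profile_term_def mult_ac)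
      ultimately have "summable (\<lambda>k. ?h k t)" "profile \<epsilon> t = (\<Sum>k. ?h k t)"
        by (simp_all only:)
      then have "profile \<epsilon> t \<le> x t"
        using elim(3) by (auto intro!: suminf_le_const)
      then show ?case
        using elim by (simp add: space_mes)
    qed
    show ?thesis
    proof
      fix y assume y: "y \<in> marcinkiewicz (profile_integral \<epsilon>)"
      then have ym: "y \<in> borel_measurable mes"
        by (simp add: marcinkiewicz_def)
      obtain C where C: "0 \<le> C" "\<And>t. 0 < t \<Longrightarrow> t \<le> 1 \<Longrightarrow> rearrangement y t \<le> C * profile \<epsilon> t"
        using rearrangement_le_of_mem[OF eps y] by blast
      have "AE t in mes. \<bar>rearrangement y t\<bar> \<le> \<bar>C * x t\<bar>"
        using le
      proof eventually_elim
        case (elim t)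
        have "\<bar>rearrangement y t\<bar> \<le> C * profile \<epsilon> t"
          using elim C(2)[of t] rearrangement_nonneg[OF ym, of t] by simp
        also have "\<dots> \<le> C * x t"
          using elim C(1) by (intro mult_left_mono) auto
        finally show ?case by simp
      qed
      from ri_ideal(1)[OF measurable_rearrangement[OF ym] ri_cmult[OF x(1)] this]
      show "y \<in> E"
        by (rule mem_of_rearrangement_mem(1)[OF ym])
    qed
  qed
  have "\<forall>\<^sub>F \<epsilon>::real in at_right 0. 0 < \<epsilon> \<and> \<epsilon> < min 1 (1 / B)"
    using B(1) by (auto simp: eventually_at_right[of 0 1] intro!: exI[of _ "min 1 (1 / B)"])
  then show ?thesis
    by eventually_elim (use main B(1) in \<open>auto simp: field_simps\<close>)
qed

end

end

section \<open>The separable part of the exponential Orlicz space\<close>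

context
  fixes x :: "real \<Rightarrow> real"
  assumes x[measurable]: "x \<in> borel_measurable mes"
    and moments: "\<And>l. (\<integral>\<^sup>+t. ennreal (exp (l * \<bar>x t\<bar>)) \<partial>mes) < \<infinity>"
begin

text \<open>
  Dominated convergence, with a large exponential of \<open>\<bar>x\<bar>\<close> as the dominating function.
\<close>

lemma exp_modular_eventually_le_1:
  assumes y[measurable]: "\<And>j::nat. y j \<in> borel_measurable mes"
    and le: "\<And>j t. \<bar>y j t\<bar> \<le> b * \<bar>x t\<bar>" and lim: "\<And>t. (\<lambda>j. y j t) \<longlonglongrightarrow> 0"
  shows "\<exists>j. (\<integral>\<^sup>+t. ennreal (exp \<bar>y j t\<bar> - 1) \<partial>mes) \<le> 1"
proof -
  have "(\<lambda>j. \<integral>\<^sup>+t. ennreal (exp \<bar>y j t\<bar> - 1) \<partial>mes) \<longlonglongrightarrow> (\<integral>\<^sup>+t. 0 \<partial>mes)"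
  proof (rule nn_integral_dominated_convergence)
    show "AE t in mes. ennreal (exp \<bar>y j t\<bar> - 1) \<le> ennreal (exp (b * \<bar>x t\<bar>))" for j
    proof (rule AE_I2, rule ennreal_leI)
      fix t
      have "exp \<bar>y j t\<bar> \<le> exp (b * \<bar>x t\<bar>)"
        using le[of j t] by simp
      then show "exp \<bar>y j t\<bar> - 1 \<le> exp (b * \<bar>x t\<bar>)"
        by linarith
    qed
    show "AE t in mes. (\<lambda>j. ennreal (exp \<bar>y j t\<bar> - 1)) \<longlonglongrightarrow> 0"
    proof (rule AE_I2)
      fix t
      have "(\<lambda>j. exp \<bar>y j t\<bar> - 1) \<longlonglongrightarrow> exp \<bar>0\<bar> - 1"
        by (intro tendsto_diff tendsto_exp tendsto_rabs lim tendsto_const)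
      then have "(\<lambda>j. ennreal (exp \<bar>y j t\<bar> - 1)) \<longlonglongrightarrow> ennreal (exp \<bar>0\<bar> - 1)"
        by (rule tendsto_ennrealI)
      then show "(\<lambda>j. ennreal (exp \<bar>y j t\<bar> - 1)) \<longlonglongrightarrow> 0"
        by simp
    qed
  qed (use moments in auto)
  then have "(\<lambda>j. \<integral>\<^sup>+t. ennreal (exp \<bar>y j t\<bar> - 1) \<partial>mes) \<longlonglongrightarrow> 0"
    by simp
  then have "\<forall>\<^sub>F j in sequentially. (\<integral>\<^sup>+t. ennreal (exp \<bar>y j t\<bar> - 1) \<partial>mes) < 1"
    by (rule order_tendstoD(2)) simp
  then show ?thesis
    by (auto simp: eventually_sequentially intro: less_imp_le)
qed

lemma exp_moments_imp_mem_exp_L1: "x \<in> exp_L1"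
proof -
  have "\<exists>j. (\<integral>\<^sup>+t. ennreal (exp \<bar>x t / real (Suc j)\<bar> - 1) \<partial>mes) \<le> 1"
  proof (rule exp_modular_eventually_le_1[where b = 1])
    show "\<bar>x t / real (Suc j)\<bar> \<le> 1 * \<bar>x t\<bar>" for j t
      by (simp add: abs_divide divide_le_eq mult_left_mono[of 1 "real (Suc j)" "\<bar>x t\<bar>", simplified])
    show "(\<lambda>j. x t / real (Suc j)) \<longlonglongrightarrow> 0" for t
      by (intro lim_const_over_n[THEN LIMSEQ_Suc])
  qed measurable
  then obtain j where "(\<integral>\<^sup>+t. ennreal (exp (\<bar>x t\<bar> / real (Suc j)) - 1) \<partial>mes) \<le> 1"
    by (auto simp: abs_divide)
  then show ?thesis
    unfolding exp_L1_def orlicz_def using x by (intro CollectI conjI exI[of _ "real (Suc j)"]) auto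
qed

end

text \<open>
  The truncations of \<open>x\<close> at height \<open>n\<close> approximate it: the remainders tend to \<open>0\<close> pointwise.
\<close>

lemma exp_moments_imp_mem_separable_part:
  assumes x[measurable]: "x \<in> borel_measurable mes"
    and moments: "\<And>l. (\<integral>\<^sup>+t. ennreal (exp (l * \<bar>x t\<bar>)) \<partial>mes) < \<infinity>"
  shows "x \<in> separable_part exp_L1 exp_L1_norm"
  unfolding separable_part_def
proof (intro CollectI conjI allI impI)
  show "x \<in> exp_L1"
    using x moments by (rule exp_moments_imp_mem_exp_L1)
  fix e :: real assume e: "0 < e"
  let ?cut = "\<lambda>n t. if \<bar>x t\<bar> \<le> real n then x t else 0"
  have "\<exists>n. (\<integral>\<^sup>+t. ennreal (exp \<bar>2 / e * (x t - ?cut n t)\<bar> - 1) \<partial>mes) \<le> 1"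
  proof (rule exp_modular_eventually_le_1[OF x moments])
    show "\<bar>2 / e * (x t - ?cut n t)\<bar> \<le> 2 / e * \<bar>x t\<bar>" for n t
      using e by (auto simp: abs_mult)
    show "(\<lambda>n. 2 / e * (x t - ?cut n t)) \<longlonglongrightarrow> 0" for t
    proof (rule tendsto_eventually)
      obtain m where "\<bar>x t\<bar> \<le> real m"
        using real_arch_simple by blast
      then show "\<forall>\<^sub>F n in sequentially. 2 / e * (x t - ?cut n t) = 0"
        by (auto simp: eventually_sequentially intro!: exI[of _ m])
    qed
  qed measurable
  then obtain n where "(\<integral>\<^sup>+t. ennreal (exp \<bar>2 / e * (x t - ?cut n t)\<bar> - 1) \<partial>mes) \<le> 1"
    by blast
  moreover have "\<bar>2 / e * r\<bar> = \<bar>r\<bar> / (e / 2)" for r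
    using e by (simp add: abs_mult)
  ultimately have n: "(\<integral>\<^sup>+t. ennreal (exp (\<bar>x t - ?cut n t\<bar> / (e / 2)) - 1) \<partial>mes) \<le> 1"
    by (simp only:)
  show "\<exists>y\<in>exp_L1 \<inter> L_infinity. exp_L1_norm (\<lambda>t. x t - y t) < e"
  proof (intro bexI[of _ "?cut n"] IntI)
    have "exp_L1_norm (\<lambda>t. x t - ?cut n t) \<le> e / 2"
      unfolding exp_L1_norm_def orlicz_norm_def
    proof (rule cInf_lower)
      show "e / 2 \<in> {l. 0 < l \<and> (\<integral>\<^sup>+t. ennreal (exp (\<bar>x t - ?cut n t\<bar> / l) - 1) \<partial>mes) \<le> 1}"
      proof (intro CollectI conjI)
        show "0 < e / 2"
          using e by simp
      qed (rule n)
      show "bdd_below {l. 0 < l \<and> (\<integral>\<^sup>+t. ennreal (exp (\<bar>x t - ?cut n t\<bar> / l) - 1) \<partial>mes) \<le> 1}"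
        by (rule bdd_belowI[of _ 0]) (elim CollectE conjE, erule less_imp_le)
    qed
    then show "exp_L1_norm (\<lambda>t. x t - ?cut n t) < e"
      using e by simp
    show "?cut n \<in> L_infinity"
      unfolding L_infinity_def
    proof (intro CollectI conjI exI[of _ "real n"])
      show "?cut n \<in> borel_measurable mes"
        by measurable
      show "AE t in mes. \<bar>?cut n t\<bar> \<le> real n"
        by (rule AE_I2) simp
    qed
    show "?cut n \<in> exp_L1"
    proof (rule exp_moments_imp_mem_exp_L1)
      show "?cut n \<in> borel_measurable mes"
        by measurable
      fix l :: real
      have "(\<integral>\<^sup>+t. ennreal (exp (l * \<bar>?cut n t\<bar>)) \<partial>mes) \<le> (\<integral>\<^sup>+t. ennreal (exp (\<bar>l\<bar> * \<bar>x t\<bar>)) \<partial>mes)"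
        by (intro nn_integral_mono ennreal_leI) (auto simp: mult_right_mono)
      also have "\<dots> < \<infinity>"
        by (rule moments)
      finally show "(\<integral>\<^sup>+t. ennreal (exp (l * \<bar>?cut n t\<bar>)) \<partial>mes) < \<infinity>" .
    qed
  qed
qed

text \<open>
  A profile with a larger parameter still has all exponential moments, but leaves the smaller space.
\<close>

lemma marcinkiewicz_psubset_separable_part:
  assumes eps: "0 < \<epsilon>" "\<epsilon> < 1"
  shows "marcinkiewicz (profile_integral \<epsilon>) \<subset> separable_part exp_L1 exp_L1_norm"
proof -
  have sub: "marcinkiewicz (profile_integral \<delta>) \<subseteq> separable_part exp_L1 exp_L1_norm" if "0 < \<delta>" "\<delta> < 1" for \<delta>
    using exp_moment_finite[OF that] by (auto simp: marcinkiewicz_def intro!: exp_moments_imp_mem_separable_part)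
  define \<delta> where "\<delta> = (1 + \<epsilon>) / 2"
  have \<delta>: "0 < \<delta>" "\<epsilon> < \<delta>" "\<delta> < 1"
    using eps by (auto simp: \<delta>_def)
  have "profile \<delta> \<in> separable_part exp_L1 exp_L1_norm"
    using profile_mem[OF \<delta>(1,3)] sub[OF \<delta>(1,3)] by blast
  then show ?thesis
    using sub[OF eps] profile_not_mem[OF eps(1) \<delta>(2,3)] by blast
qed

section \<open>The family of Marcinkiewicz spaces\<close>

theorem theorem1:
  shows "\<exists>\<psi> :: real \<Rightarrow> real \<Rightarrow> real.
    (\<forall>\<epsilon>. 0 < \<epsilon> \<and> \<epsilon> < 1 \<longrightarrow>
       strict_mono_on {0..1} (\<psi> \<epsilon>) \<and> concave_on {0..1} (\<psi> \<epsilon>) \<and> \<psi> \<epsilon> 0 = 0 \<and>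
       (\<forall>t\<in>{0..1}. 0 \<le> \<psi> \<epsilon> t)) \<and>
    (\<forall>\<epsilon> \<delta>. 0 < \<epsilon> \<and> \<epsilon> \<le> \<delta> \<and> \<delta> < 1 \<longrightarrow> marcinkiewicz (\<psi> \<epsilon>) \<subseteq> marcinkiewicz (\<psi> \<delta>)) \<and>
    (\<forall>\<epsilon>. 0 < \<epsilon> \<and> \<epsilon> < 1 \<longrightarrow>
       ri_kruglov (marcinkiewicz (\<psi> \<epsilon>)) (marcinkiewicz_norm (\<psi> \<epsilon>))) \<and>
    (\<forall>E N. ri_kruglov E N \<longrightarrow> (\<forall>\<^sub>F \<epsilon> in at_right 0. marcinkiewicz (\<psi> \<epsilon>) \<subseteq> E)) \<and>
    (\<forall>\<epsilon> \<delta>. 0 < \<epsilon> \<and> \<epsilon> < \<delta> \<and> \<delta> < 1 \<longrightarrow>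
       ((\<lambda>t. \<psi> \<epsilon> t / \<psi> \<delta> t) \<longlongrightarrow> 0) (at_right 0)) \<and>
    (\<forall>\<^sub>F \<epsilon> in at_right 0. marcinkiewicz (\<psi> \<epsilon>) \<subset> separable_part exp_L1 exp_L1_norm)"
proof (intro exI[of _ profile_integral] conjI allI impI)
  fix \<epsilon> :: real assume "0 < \<epsilon> \<and> \<epsilon> < 1"
  then have eps: "0 < \<epsilon>" "\<epsilon> < 1"
    by auto
  show "strict_mono_on {0..1} (profile_integral \<epsilon>)"
    by (rule profile_integral_strict_mono[OF eps])
  show "concave_on {0..1} (profile_integral \<epsilon>)"
    by (rule profile_integral_concave[OF eps])
  show "profile_integral \<epsilon> 0 = 0"
    by (rule profile_integral_0)
  show "\<forall>t\<in>{0..1}. 0 \<le> profile_integral \<epsilon> t"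
  proof
    fix t :: real assume "t \<in> {0..1}"
    then show "0 \<le> profile_integral \<epsilon> t"
      using profile_integral_ge_id[OF eps, of t] by (cases "t = 0") auto
  qed
  show "ri_kruglov (marcinkiewicz (profile_integral \<epsilon>)) (marcinkiewicz_norm (profile_integral \<epsilon>))"
    unfolding ri_kruglov_def
    using ri_space_profile_integral[OF eps] kruglov_property_profile_integral[OF eps] by simp
next
  fix \<epsilon> \<delta> :: real assume "0 < \<epsilon> \<and> \<epsilon> \<le> \<delta> \<and> \<delta> < 1"
  then show "marcinkiewicz (profile_integral \<epsilon>) \<subseteq> marcinkiewicz (profile_integral \<delta>)"
    by (intro marcinkiewicz_profile_integral_mono) auto
next
  fix E :: "(real \<Rightarrow> real) set" and N assume "ri_kruglov E N"
  then show "\<forall>\<^sub>F \<epsilon> in at_right 0. marcinkiewicz (profile_integral \<epsilon>) \<subseteq> E"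
    unfolding ri_kruglov_def using marcinkiewicz_subset_kruglov_space by blast
next
  fix \<epsilon> \<delta> :: real assume "0 < \<epsilon> \<and> \<epsilon> < \<delta> \<and> \<delta> < 1"
  then show "((\<lambda>t. profile_integral \<epsilon> t / profile_integral \<delta> t) \<longlongrightarrow> 0) (at_right 0)"
    by (intro profile_integral_ratio_tendsto_0) auto
next
  have "\<forall>\<^sub>F \<epsilon>::real in at_right 0. 0 < \<epsilon> \<and> \<epsilon> < 1"
    by (auto simp: eventually_at_right[of 0 1] intro!: exI[of _ 1])
  then show "\<forall>\<^sub>F \<epsilon> in at_right 0. marcinkiewicz (profile_integral \<epsilon>) \<subset> separable_part exp_L1 exp_L1_norm"
    by eventually_elim (rule marcinkiewicz_psubset_separable_part, auto)
qed

end
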